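(* Let $s\in(0,1)$, $2<p<\frac{6}{3-2s}$, and let $A:\mathbb{R}^3\to\mathbb{R}^3$ be continuous with locally bounded gradient. Let $$\mathscr{M}_A=\inf_{u\in\mathscr{S}}\|u\|_{s,A}^2,\qquad \mathscr{S}=\Big\{u\in H^s_A(\mathbb{R}^3,\mathbb{C}):\int_{\mathbb{R}^3}|u|^p\,dx=1\Big\},$$ and let $\mathscr{M}_{A,r}$ be the infimum of $\|u\|_{s,A}^2$ over those $u\in\mathscr{S}$ that are radially symmetric. Then: (i) the infimum $\mathscr{M}_{A,r}$ is attained; (ii) if $A$ is linear, then the infimum $\mathscr{M}_A$ is attained; (iii) if $A$ satisfies assumption $\mathscr{A}$ and $\mathscr{M}_A<\inf_{\Xi\in\mathscr{X}}\mathscr{M}_{A_\Xi}$, then the infimum $\mathscr{M}_A$ is attained.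
   Context: Throughout $s\in(0,1)$ and $c_s=s2^{2s}\frac{\Gamma(\frac{3+2s}{2})}{\pi^{3/2}\Gamma(1-s)}$. "Locally bounded gradient" means $A$ is locally Lipschitz. For a (measurable, locally bounded) $A:\mathbb{R}^3\to\mathbb{R}^3$ and measurable $u:\mathbb{R}^3\to\mathbb{C}$ set $$[u]_{s,A}^2=\frac{c_s}{2}\int_{\mathbb{R}^6}\frac{|e^{-\mathrm{i}(x-y)\cdot A(\frac{x+y}{2})}u(x)-u(y)|^2}{|x-y|^{3+2s}}\,dx\,dy,\qquad \|u\|_{s,A}^2=\|u\|_{L^2}^2+[u]_{s,A}^2 .$$ $\mathcal{H}$ is the space of measurable $u:\mathbb{R}^3\to\mathbb{C}$ (modulo a.e. equality) with $\|u\|_{s,A}<\infty$; it is a real Hilbert space containing $C_c^\infty(\mathbb{R}^3,\mathbb{C})$, and $H^s_A(\mathbb{R}^3,\mathbb{C})$ is the closure of $C^\infty_c(\mathbb{R}^3,\mathbb{C})$ in $\mathcal{H}$. The number $\mathscr{M}_{A_\Xi}$ is defined as $\mathscr{M}_A$ with $A_\Xi$ in place of $A$. Assumption $\mathscr{A}$: for any unbounded sequence $\Xi=\{\xi_n\}_{n\in\mathbb{N}}\subset\mathbb{R}^3$ there exist a subsequence (still denoted $\{\xi_n\}$) with $|\xi_n|\to\infty$, a sequence $\{H_n\}_{n\in\mathbb{N}}\subset\mathbb{R}^3$ and a function $A_\Xi:\mathbb{R}^3\to\mathbb{R}^3$ such that, with $A_n(x):=A(x+\xi_n)+H_n$, $$\lim_n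 A_n(x)=A_\Xi(x)\ \text{ for all }x\in\mathbb{R}^3\quad\text{and}\quad \sup_n\|A_n\|_{L^\infty(K)}<\infty\ \text{ for all compact sets }K\subset\mathbb{R}^3.$$ $\mathscr{X}$ denotes the set of unbounded sequences $\Xi$ for which this condition holds, and to each $\Xi\in\mathscr{X}$ is associated such a limit function $A_\Xi$. *)

theory Defs
  imports "HOL-Analysis.Analysis"
begin

definition c_const :: "real \<Rightarrow> real" where
  "c_const s = s * 2 powr (2 * s) * (Gamma ((3 + 2 * s) / 2) / (pi powr (3 / 2) * Gamma (1 - s)))"

text \<open>
  Functions are not quotiented by a.e. equality: the integrals below do not distinguish
  a.e. equal functions. The integrals are taken in the extended nonnegative reals, so that the
  squared seminorm and norm are defined (possibly infinite) for every measurable function.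
  On the diagonal, a null set, the integrand is the junk value 0.
\<close>

definition magnetic_seminorm_sq ::
    "real \<Rightarrow> (real^3 \<Rightarrow> real^3) \<Rightarrow> (real^3 \<Rightarrow> complex) \<Rightarrow> ennreal" where
  "magnetic_seminorm_sq s A u = ennreal (c_const s / 2) *
     (\<integral>\<^sup>+ (x, y). ennreal
        ((cmod (exp (- \<i> * complex_of_real ((x - y) \<bullet> A ((1/2) *\<^sub>R (x + y)))) * u x - u y))\<^sup>2
          / norm (x - y) powr (3 + 2 * s)) \<partial>lebesgue)"

definition magnetic_norm_sq ::
    "real \<Rightarrow> (real^3 \<Rightarrow> real^3) \<Rightarrow> (real^3 \<Rightarrow> complex) \<Rightarrow> ennreal" where
  "magnetic_norm_sq s A u =
     (\<integral>\<^sup>+ x. ennreal ((cmod (u x))\<^sup>2) \<partial>lebesgue) + magnetic_seminorm_sq s A u"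

text \<open>
  A function is of class \<open>C^(k+1)\<close> iff it is (Frechet) differentiable everywhere and all its
  directional derivatives are of class \<open>C^k\<close>.
\<close>

primrec C_k :: "nat \<Rightarrow> (real^3 \<Rightarrow> complex) \<Rightarrow> bool" where
  "C_k 0 f \<longleftrightarrow> continuous_on UNIV f"
| "C_k (Suc k) f \<longleftrightarrow>
     (\<forall>x. f differentiable (at x)) \<and> (\<forall>v. C_k k (\<lambda>x. frechet_derivative f (at x) v))"

definition test_functions :: "(real^3 \<Rightarrow> complex) set" where
  "test_functions = {\<phi>. (\<forall>k. C_k k \<phi>) \<and> compact (closure {x. \<phi> x \<noteq> 0})}"

definition magnetic_space :: "real \<Rightarrow> (real^3 \<Rightarrow> real^3) \<Rightarrow> (real^3 \<Rightarrow> complex) set" where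
  "magnetic_space s A = {u \<in> borel_measurable lebesgue. magnetic_norm_sq s A u < \<infinity>}"

text \<open>The space \<open>H^s_A\<close>: the closure of the test functions in \<open>magnetic_space\<close>.\<close>

definition HsA :: "real \<Rightarrow> (real^3 \<Rightarrow> real^3) \<Rightarrow> (real^3 \<Rightarrow> complex) set" where
  "HsA s A = {u \<in> magnetic_space s A.
     \<forall>\<epsilon>>0. \<exists>\<phi>\<in>test_functions. magnetic_norm_sq s A (\<lambda>x. u x - \<phi> x) < ennreal (\<epsilon>\<^sup>2)}"

definition constraint_set ::
    "real \<Rightarrow> real \<Rightarrow> (real^3 \<Rightarrow> real^3) \<Rightarrow> (real^3 \<Rightarrow> complex) set" where
  "constraint_set s p A = {u \<in> HsA s A. (\<integral>\<^sup>+ x. ennreal (cmod (u x) powr p) \<partial>lebesgue) = 1}"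

text \<open>Radial symmetry is understood modulo a.e. equality.\<close>

definition radially_symmetric :: "(real^3 \<Rightarrow> complex) \<Rightarrow> bool" where
  "radially_symmetric u \<longleftrightarrow> (\<exists>g :: real \<Rightarrow> complex. AE x in lebesgue. u x = g (norm x))"

definition radial_constraint_set ::
    "real \<Rightarrow> real \<Rightarrow> (real^3 \<Rightarrow> real^3) \<Rightarrow> (real^3 \<Rightarrow> complex) set" where
  "radial_constraint_set s p A = {u \<in> constraint_set s p A. radially_symmetric u}"

definition M_inf :: "real \<Rightarrow> real \<Rightarrow> (real^3 \<Rightarrow> real^3) \<Rightarrow> ennreal" where
  "M_inf s p A = (INF u\<in>constraint_set s p A. magnetic_norm_sq s A u)"

definition M_inf_rad :: "real \<Rightarrow> real \<Rightarrow> (real^3 \<Rightarrow> real^3) \<Rightarrow> ennreal" where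
  "M_inf_rad s p A = (INF u\<in>radial_constraint_set s p A. magnetic_norm_sq s A u)"

definition locally_Lipschitz :: "(real^3 \<Rightarrow> real^3) \<Rightarrow> bool" where
  "locally_Lipschitz A \<longleftrightarrow> (\<forall>x. \<exists>r>0. \<exists>L. L-lipschitz_on (ball x r) A)"

text \<open>
  \<open>is_limit_potential A \<Xi> B\<close>: along a subsequence \<open>\<Xi> \<circ> r\<close> diverging to infinity, and up to additive
  constants \<open>H n\<close>, the translates of \<open>A\<close> converge pointwise to \<open>B\<close> and are bounded in
  \<open>L^\<infinity>(K)\<close> for every compact \<open>K\<close>.
\<close>

definition is_limit_potential ::
    "(real^3 \<Rightarrow> real^3) \<Rightarrow> (nat \<Rightarrow> real^3) \<Rightarrow> (real^3 \<Rightarrow> real^3) \<Rightarrow> bool" where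
  "is_limit_potential A \<Xi> B \<longleftrightarrow>
     (\<exists>(r :: nat \<Rightarrow> nat) (H :: nat \<Rightarrow> real^3).
        strict_mono r \<and>
        filterlim (\<lambda>n. norm (\<Xi> (r n))) at_top sequentially \<and>
        (\<forall>x. (\<lambda>n. A (x + \<Xi> (r n)) + H n) \<longlonglongrightarrow> B x) \<and>
        (\<forall>K. compact K \<longrightarrow>
           (\<exists>C. \<forall>n. AE x in lebesgue. x \<in> K \<longrightarrow> norm (A (x + \<Xi> (r n)) + H n) \<le> C)))"

definition admissible_seqs :: "(real^3 \<Rightarrow> real^3) \<Rightarrow> (nat \<Rightarrow> real^3) set" where
  "admissible_seqs A = {\<Xi>. \<not> bounded (range \<Xi>) \<and> (\<exists>B. is_limit_potential A \<Xi> B)}"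

definition assumption_A :: "(real^3 \<Rightarrow> real^3) \<Rightarrow> bool" where
  "assumption_A A \<longleftrightarrow> (\<forall>\<Xi>. \<not> bounded (range \<Xi>) \<longrightarrow> \<Xi> \<in> admissible_seqs A)"

end

theory Submission
  imports Defs "HOL-Complex_Analysis.Great_Picard"
begin

text \<open>
  For a minimizing sequence, a telescoping sum of dyadic averages bounds the \<open>L^p\<close> norm by
  a power of the largest \<open>L^2\<close> mass in a cell of a fixed generation, up to a small multiple of
  the fractional seminorm; applied to the modulus (diamagnetic inequality), this gives the Sobolev
  inequality and shows that some ball of fixed radius carries \<open>L^2\<close> mass bounded below. A magnetic
  translation moves this ball to the origin, and Rellich compactness yields a nonzero limit \<open>v\<close>.
  By the Brezis--Lieb splitting the part \<open>\<theta>\<close> of the constraint captured by \<open>v\<close> satisfies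
  \<open>\<theta>^(2/p) + (1 - \<theta>)^(2/p) \<le> 1\<close>, so \<open>\<theta> = 1\<close> by strict concavity. If \<open>A\<close> is linear, a magnetic
  translation can be chosen that preserves \<open>A\<close>. Under assumption \<open>\<A>\<close> an unbounded sequence of
  centres would produce a competitor for the limit potential below its infimum. In the radial case
  a distant ball has many disjoint rotated copies, so \<open>L^2\<close> mass cannot escape and the \<open>L^p\<close> constraint
  passes to the limit.
\<close>

section \<open>Splitting lemmas for square integrable functions\<close>

text \<open>The obstacle is that translated potentials \<open>A n\<close> converge only locally: the
  limit \<open>v\<close> lies in the space of the limit potential, but is not known to have finite
  energy for any \<open>A n\<close>. The splitting is therefore applied with the truncation
  \<open>cutoff R x * v x\<close>, which belongs to the spaces of all locally bounded potentials;
  \<open>n\<close> tends to infinity for fixed \<open>R\<close>, and \<open>R\<close> afterwards.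
  Membership in the closure of the test functions is transported by truncation as well. Truncations
  and changes of potential are affordable because both cost at most a multiple of the kernel
  \<open>min 1 |z|^2 / |z|^(3+2s)\<close>, which is integrable for \<open>0 < s < 1\<close>. Weak
  convergence is always realised concretely: bounded sequences are made to converge almost
  everywhere, and integrals converge because they are dominated up to a small multiple of a bounded
  quantity. The inequality for \<open>\<theta>\<close> comes from homogeneity:
  \<open>m * I w powr (2 / p) \<le> Q A w\<close> is used once for the captured part and once for
  the remainder. The bound \<open>p < 6 / (3 - 2 * s)\<close> says that the \<open>L^p\<close>
  integrals of successive dyadic increments are bounded by a geometric sequence of ratio
  \<open>\<rho> < 1\<close>.\<close>

lemma integral_tendsto_dominated_up_to_small:
  fixes h k :: "nat \<Rightarrow> 'a \<Rightarrow> real"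
  assumes h: "\<And>n. h n \<in> borel_measurable M" and h0: "integrable M h0"
    and k: "\<And>n. integrable M (k n)" and k0: "\<And>n x. 0 \<le> k n x" and K: "\<And>n. integral\<^sup>L M (k n) \<le> K"
    and dom: "\<And>\<epsilon>. 0 < \<epsilon> \<Longrightarrow> \<exists>g. integrable M g \<and> (\<forall>n. AE x in M. \<bar>h n x\<bar> \<le> \<epsilon> * k n x + g x)"
    and lim: "AE x in M. (\<lambda>n. h n x) \<longlonglongrightarrow> h0 x"
  shows "(\<lambda>n. integral\<^sup>L M (h n)) \<longlonglongrightarrow> integral\<^sup>L M h0"
proof -
  note [measurable] = h h0[THEN borel_measurable_integrable] k[THEN borel_measurable_integrable]
  have hint: "integrable M (h n)" for n
  proof -
    obtain g where "integrable M g" "\<forall>n. AE x in M. \<bar>h n x\<bar> \<le> 1 * k n x + g x"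
      using dom[of 1] by auto
    then have g: "integrable M g" "AE x in M. \<bar>h n x\<bar> \<le> k n x + g x" by auto
    show ?thesis
      by (rule Bochner_Integration.integrable_bound[of M "\<lambda>x. k n x + g x"])
         (use g k in \<open>auto elim!: eventually_mono\<close>)
  qed
  show ?thesis
  proof (rule LIMSEQ_I)
    fix r :: real assume r: "0 < r"
    define K' where "K' = max K 0 + 1"
    have K': "K' > 0" "K \<le> K'" by (auto simp: K'_def)
    define e where "e = r / (2 * K')"
    have e: "e > 0" "e * K' = r / 2" using r K' by (auto simp: e_def)
    obtain g where g: "integrable M g" "\<And>n. AE x in M. \<bar>h n x\<bar> \<le> e * k n x + g x"
      using dom[OF e(1)] by blast
    note [measurable] = g(1)[THEN borel_measurable_integrable]
    define g' where "g' x = \<bar>g x\<bar> + \<bar>h0 x\<bar>" for x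
    have g': "integrable M g'" unfolding g'_def using g(1) h0 by auto
    note [measurable] = g'[THEN borel_measurable_integrable]
    \<comment> \<open>Truncating \<open>h n\<close> at the height \<open>g'\<close> gives functions
      to which dominated convergence applies; since \<open>g'\<close> contains the modulus of
      \<open>h0\<close>, the limit is not truncated. What is cut off is at most
      \<open>e * k n\<close>, whose integral is at most \<open>r / 2\<close>.\<close>
    define c where "c n x = max (- g' x) (min (g' x) (h n x))" for n x
    have cm[measurable]: "c n \<in> borel_measurable M" for n unfolding c_def by measurable
    have g'0: "0 \<le> g' x" for x by (simp add: g'_def)
    have cb: "\<bar>c n x\<bar> \<le> g' x" for n x using g'0[of x] unfolding c_def by linarith
    have cint: "integrable M (c n)" for n
      by (rule Bochner_Integration.integrable_bound[OF g']) (use cb in \<open>auto simp: g'_def\<close>)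
    have climit: "(\<lambda>n. integral\<^sup>L M (c n)) \<longlonglongrightarrow> integral\<^sup>L M h0"
    proof (rule integral_dominated_convergence[where w = g'])
      show "AE x in M. (\<lambda>n. c n x) \<longlonglongrightarrow> h0 x"
        using lim
      proof eventually_elim
        case (elim x)
        have "(\<lambda>n. c n x) \<longlonglongrightarrow> max (- g' x) (min (g' x) (h0 x))"
          unfolding c_def by (intro tendsto_intros elim)
        also have "max (- g' x) (min (g' x) (h0 x)) = h0 x" by (auto simp: g'_def)
        finally show ?case .
      qed
    qed (use g' cb in auto)
    have diff: "\<bar>integral\<^sup>L M (h n) - integral\<^sup>L M (c n)\<bar> \<le> r / 2" for n
    proof -
      have "\<bar>integral\<^sup>L M (h n) - integral\<^sup>L M (c n)\<bar> = \<bar>integral\<^sup>L M (\<lambda>x. h n x - c n x)\<bar>"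
        using hint cint by simp
      also have "\<dots> \<le> integral\<^sup>L M (\<lambda>x. \<bar>h n x - c n x\<bar>)"
        by (rule integral_abs_bound)
      also have "\<dots> \<le> integral\<^sup>L M (\<lambda>x. e * k n x)"
      proof (rule integral_mono_AE)
        show "AE x in M. \<bar>h n x - c n x\<bar> \<le> e * k n x"
          using g(2)[of n]
        proof eventually_elim
          case (elim x)
          have "0 \<le> e * k n x" using e k0 by simp
          moreover have "g x \<le> g' x" by (simp add: g'_def)
          ultimately show ?case using elim g'0[of x] unfolding c_def by linarith
        qed
      qed (use hint cint k in auto)
      also have "\<dots> \<le> e * K'" using K[of n] K'(2) e(1) by simp
      finally show ?thesis using e by simp
    qed
    obtain N where "\<And>n. n \<ge> N \<Longrightarrow> norm (integral\<^sup>L M (c n) - integral\<^sup>L M h0) < r / 2"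
      using LIMSEQ_D[OF climit, of "r/2"] r by auto
    then show "\<exists>no. \<forall>n\<ge>no. norm (integral\<^sup>L M (h n) - integral\<^sup>L M h0) < r"
    proof (intro exI[of _ N] allI impI)
      fix n assume "N \<le> n"
      then have "\<bar>integral\<^sup>L M (c n) - integral\<^sup>L M h0\<bar> < r / 2"
        using \<open>\<And>n. n \<ge> N \<Longrightarrow> norm (integral\<^sup>L M (c n) - integral\<^sup>L M h0) < r / 2\<close>[of n] by simp
      then show "norm (integral\<^sup>L M (h n) - integral\<^sup>L M h0) < r"
        using diff[of n] unfolding real_norm_def by linarith
    qed
  qed
qed

section \<open>Elementary inequalities and square integrable complex functions\<close>

lemma cmod_diff_squared: "(cmod (a - b))\<^sup>2 = (cmod a)\<^sup>2 - 2 * Re (cnj a * b) + (cmod b)\<^sup>2"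
  unfolding cmod_power2 by (simp add: power2_eq_square algebra_simps)

lemma convergent_imp_bounded_above:
  fixes f :: "nat \<Rightarrow> real"
  assumes "f \<longlonglongrightarrow> m" shows "\<exists>K. \<forall>n. f n \<le> K"
  using convergent_imp_Bseq[OF convergentI[OF assms]] unfolding Bseq_def by (auto dest: abs_le_D1)

lemma limit_diff_bound:
  fixes f :: "nat \<Rightarrow> 'a::real_normed_vector"
  assumes "f \<longlonglongrightarrow> l" "\<And>n. norm (f n) \<le> C"
  shows "norm (f n - l) \<le> 2 * C"
proof -
  have "norm l \<le> C" by (rule LIMSEQ_le_const2[OF tendsto_norm[OF assms(1)]]) (use assms(2) in auto)
  then show ?thesis using assms(2)[of n] norm_triangle_ineq4[of "f n" l] by linarith
qed

lemma two_mult_le_weighted_squares: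
  fixes a b e :: real
  assumes "0 < e" shows "2 * (a * b) \<le> e * a\<^sup>2 + b\<^sup>2 / e"
proof -
  have "0 \<le> (e * a - b)\<^sup>2 / e" using assms by simp
  also have "\<dots> = e * a\<^sup>2 - 2 * (a * b) + b\<^sup>2 / e" using assms by (simp add: field_simps power2_eq_square)
  finally show ?thesis by simp
qed

lemma cmod_cross_le:
  assumes "0 < e" shows "2 * \<bar>Re (cnj a * b)\<bar> \<le> e * (cmod b)\<^sup>2 + (cmod a)\<^sup>2 / e"
proof -
  have "2 * \<bar>Re (cnj a * b)\<bar> \<le> 2 * cmod (cnj a * b)" using abs_Re_le_cmod[of "cnj a * b"] by linarith
  also have "\<dots> = 2 * (cmod b * cmod a)" by (simp add: norm_mult)
  also have "\<dots> \<le> e * (cmod b)\<^sup>2 + (cmod a)\<^sup>2 / e" by (rule two_mult_le_weighted_squares[OF assms])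
  finally show ?thesis .
qed

lemma cmod_add_squared_le: "(cmod (a + b))\<^sup>2 \<le> 2 * (cmod a)\<^sup>2 + 2 * (cmod b)\<^sup>2"
proof -
  have "(cmod (a + b))\<^sup>2 \<le> (cmod a + cmod b)\<^sup>2" by (simp add: norm_triangle_ineq)
  also have "\<dots> \<le> 2 * (cmod a)\<^sup>2 + 2 * (cmod b)\<^sup>2"
    using sum_squares_bound[of "cmod a" "cmod b"] by (simp add: power2_eq_square algebra_simps)
  finally show ?thesis .
qed

lemma cmod_diff_squared_le: "(cmod (a - b))\<^sup>2 \<le> 2 * (cmod a)\<^sup>2 + 2 * (cmod b)\<^sup>2"
  using cmod_add_squared_le[of a "- b"] by simp

definition square_integrable :: "'a measure \<Rightarrow> ('a \<Rightarrow> complex) \<Rightarrow> bool" where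
  "square_integrable M f \<longleftrightarrow> f \<in> borel_measurable M \<and> integrable M (\<lambda>x. (cmod (f x))\<^sup>2)"

lemma square_integrableD:
  assumes "square_integrable M f"
  shows "f \<in> borel_measurable M" "integrable M (\<lambda>x. (cmod (f x))\<^sup>2)"
  using assms by (auto simp: square_integrable_def)

lemma square_integrable_bound:
  assumes "f \<in> borel_measurable M" "integrable M g" "AE x in M. (cmod (f x))\<^sup>2 \<le> g x"
  shows "square_integrable M f"
  unfolding square_integrable_def
  using assms(1)
  by (auto intro!: Bochner_Integration.integrable_bound[OF assms(2)] eventually_mono[OF assms(3)])

lemma square_integrable_add:
  assumes "square_integrable M f" "square_integrable M g"
  shows "square_integrable M (\<lambda>x. f x + g x)"
proof (rule square_integrable_bound)
  show "integrable M (\<lambda>x. 2 * (cmod (f x))\<^sup>2 + 2 * (cmod (g x))\<^sup>2)"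
    using assms by (auto simp: square_integrable_def)
qed (use assms in \<open>auto simp: square_integrable_def cmod_add_squared_le\<close>)

lemma square_integrable_cmult:
  assumes "square_integrable M f" shows "square_integrable M (\<lambda>x. c * f x)"
  using assms by (auto simp: square_integrable_def norm_mult power_mult_distrib)

lemma square_integrable_diff:
  assumes "square_integrable M f" "square_integrable M g"
  shows "square_integrable M (\<lambda>x. f x - g x)"
  using square_integrable_add[OF assms(1) square_integrable_cmult[OF assms(2), of "-1"]] by simp

lemma square_integrable_nn:
  assumes "f \<in> borel_measurable M"
  shows "square_integrable M f \<longleftrightarrow> (\<integral>\<^sup>+x. ennreal ((cmod (f x))\<^sup>2) \<partial>M) < \<infinity>"
  using assms by (auto simp: square_integrable_def integrable_iff_bounded)

lemma nn_integral_square: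
  assumes "square_integrable M f"
  shows "(\<integral>\<^sup>+x. ennreal ((cmod (f x))\<^sup>2) \<partial>M) = ennreal (\<integral>x. (cmod (f x))\<^sup>2 \<partial>M)"
  using assms by (intro nn_integral_eq_integral) (auto simp: square_integrable_def)

lemma square_integrable_Re_prod:
  assumes "square_integrable M f" "square_integrable M g"
  shows "integrable M (\<lambda>x. Re (cnj (f x) * g x))"
proof (rule Bochner_Integration.integrable_bound)
  show "integrable M (\<lambda>x. (cmod (f x))\<^sup>2 + (cmod (g x))\<^sup>2)"
    using assms by (auto simp: square_integrable_def)
  have [measurable]: "f \<in> borel_measurable M" "g \<in> borel_measurable M"
    using assms by (auto simp: square_integrable_def)
  show "(\<lambda>x. Re (cnj (f x) * g x)) \<in> borel_measurable M" by simp
  show "AE x in M. norm (Re (cnj (f x) * g x)) \<le> norm ((cmod (f x))\<^sup>2 + (cmod (g x))\<^sup>2)"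
  proof (intro AE_I2)
    fix x show "norm (Re (cnj (f x) * g x)) \<le> norm ((cmod (f x))\<^sup>2 + (cmod (g x))\<^sup>2)"
      using cmod_cross_le[of 1 "f x" "g x"] unfolding real_norm_def by linarith
  qed
qed

lemma integral_cmod_diff_squared:
  assumes "square_integrable M f" "square_integrable M g"
  shows "(\<integral>x. (cmod (f x - complex_of_real t * g x))\<^sup>2 \<partial>M) =
    (\<integral>x. (cmod (f x))\<^sup>2 \<partial>M) - 2 * t * (\<integral>x. Re (cnj (f x) * g x) \<partial>M) + t\<^sup>2 * (\<integral>x. (cmod (g x))\<^sup>2 \<partial>M)"
proof -
  have "(cmod (f x - complex_of_real t * g x))\<^sup>2
      = (cmod (f x))\<^sup>2 - 2 * t * Re (cnj (f x) * g x) + t\<^sup>2 * (cmod (g x))\<^sup>2" for x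
    unfolding cmod_diff_squared by (simp add: norm_mult power_mult_distrib algebra_simps)
  then show ?thesis
    using assms square_integrable_Re_prod[OF assms] by (simp add: square_integrable_def)
qed

lemma Fatou_square:
  assumes f: "\<And>n. square_integrable M (f n)" and f0: "f0 \<in> borel_measurable M"
    and K: "\<And>n. (\<integral>x. (cmod (f n x))\<^sup>2 \<partial>M) \<le> K" and lim: "AE x in M. (\<lambda>n. f n x) \<longlonglongrightarrow> f0 x"
  shows "square_integrable M f0" "(\<integral>x. (cmod (f0 x))\<^sup>2 \<partial>M) \<le> K"
proof -
  note [measurable] = f[THEN square_integrableD(1)] f0
  have K0: "0 \<le> K" using K[of 0] by (rule order_trans[rotated]) simp
  have "(\<integral>\<^sup>+x. ennreal ((cmod (f0 x))\<^sup>2) \<partial>M) = (\<integral>\<^sup>+x. liminf (\<lambda>n. ennreal ((cmod (f n x))\<^sup>2)) \<partial>M)"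
  proof (rule nn_integral_cong_AE)
    show "AE x in M. ennreal ((cmod (f0 x))\<^sup>2) = liminf (\<lambda>n. ennreal ((cmod (f n x))\<^sup>2))"
      using lim
      by eventually_elim (rule lim_imp_Liminf[symmetric], auto intro!: tendsto_intros)
  qed
  also have "\<dots> \<le> liminf (\<lambda>n. \<integral>\<^sup>+x. ennreal ((cmod (f n x))\<^sup>2) \<partial>M)"
    by (rule nn_integral_liminf) simp
  also have "\<dots> \<le> limsup (\<lambda>n. \<integral>\<^sup>+x. ennreal ((cmod (f n x))\<^sup>2) \<partial>M)"
    by (rule Liminf_le_Limsup) simp
  also have "\<dots> \<le> ennreal K"
    by (rule Limsup_bounded) (use K in \<open>auto simp: nn_integral_square[OF f] intro!: always_eventually ennreal_leI\<close>)
  finally have le: "(\<integral>\<^sup>+x. ennreal ((cmod (f0 x))\<^sup>2) \<partial>M) \<le> ennreal K" .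
  then show sq: "square_integrable M f0"
    by (subst square_integrable_nn) (auto simp: less_top[symmetric] top_unique intro: le_less_trans)
  show "(\<integral>x. (cmod (f0 x))\<^sup>2 \<partial>M) \<le> K"
    using le K0 unfolding nn_integral_square[OF sq] by simp
qed

text \<open>Under an \<open>L^2\<close> bound, almost everywhere convergence forces weak
  convergence: by weighted squares the pairing is at most \<open>e * |f n|^2\<close> plus the fixed
  integrable function \<open>|h|^2 / e\<close>. Weak convergence is used in this form
  throughout.\<close>

lemma square_integrable_weak_limit:
  assumes h: "square_integrable M h" and f: "\<And>n. square_integrable M (f n)" and f0: "square_integrable M f0"
    and K: "\<And>n. (\<integral>x. (cmod (f n x))\<^sup>2 \<partial>M) \<le> K" and lim: "AE x in M. (\<lambda>n. f n x) \<longlonglongrightarrow> f0 x"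
  shows "(\<lambda>n. \<integral>x. Re (cnj (h x) * f n x) \<partial>M) \<longlonglongrightarrow> (\<integral>x. Re (cnj (h x) * f0 x) \<partial>M)"
proof (rule integral_tendsto_dominated_up_to_small[where k = "\<lambda>n x. (cmod (f n x))\<^sup>2" and K = K])
  note [measurable] = h[THEN square_integrableD(1)] f[THEN square_integrableD(1)]
  show "(\<lambda>x. Re (cnj (h x) * f n x)) \<in> borel_measurable M" for n by simp
  show "integrable M (\<lambda>x. Re (cnj (h x) * f0 x))" by (rule square_integrable_Re_prod[OF h f0])
  show "integrable M (\<lambda>x. (cmod (f n x))\<^sup>2)" for n using f by (simp add: square_integrable_def)
  show "AE x in M. (\<lambda>n. Re (cnj (h x) * f n x)) \<longlonglongrightarrow> Re (cnj (h x) * f0 x)"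
    using lim by eventually_elim (intro tendsto_intros)
  fix e :: real assume e: "0 < e"
  show "\<exists>g. integrable M g \<and> (\<forall>n. AE x in M. \<bar>Re (cnj (h x) * f n x)\<bar> \<le> e * (cmod (f n x))\<^sup>2 + g x)"
  proof (intro exI[of _ "\<lambda>x. (cmod (h x))\<^sup>2 / e"] conjI allI AE_I2)
    show "integrable M (\<lambda>x. (cmod (h x))\<^sup>2 / e)" using h by (simp add: square_integrable_def)
    fix n x 
    show "\<bar>Re (cnj (h x) * f n x)\<bar> \<le> e * (cmod (f n x))\<^sup>2 + (cmod (h x))\<^sup>2 / e"
      using cmod_cross_le[OF e, of "h x" "f n x"] by linarith
  qed
qed (use K in auto)

text \<open>The quadratic case of the Brezis--Lieb splitting, with a correction \<open>g n\<close> that may vary with \<open>n\<close>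
  as long as it stays dominated.\<close>

lemma square_integrable_splitting:
  assumes f: "\<And>n. square_integrable M (f n)" and f0: "square_integrable M f0"
    and g: "\<And>n. g n \<in> borel_measurable M" and g0: "square_integrable M g0"
    and d: "integrable M d" "\<And>n. AE x in M. (cmod (g n x))\<^sup>2 \<le> d x"
    and K: "\<And>n. (\<integral>x. (cmod (f n x))\<^sup>2 \<partial>M) \<le> K" 
    and limf: "AE x in M. (\<lambda>n. f n x) \<longlonglongrightarrow> f0 x" and limg: "AE x in M. (\<lambda>n. g n x) \<longlonglongrightarrow> g0 x"
  shows "(\<lambda>n. (\<integral>x. (cmod (f n x))\<^sup>2 \<partial>M) - (\<integral>x. (cmod (f n x - g n x))\<^sup>2 \<partial>M)) \<longlonglongrightarrow>
     (\<integral>x. (cmod (f0 x))\<^sup>2 \<partial>M) - (\<integral>x. (cmod (f0 x - g0 x))\<^sup>2 \<partial>M)"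
proof -
  have gs: "square_integrable M (g n)" for n by (rule square_integrable_bound[OF g d])
  note ff = f[THEN square_integrableD(2)] f0[THEN square_integrableD(2)]
    square_integrable_diff[OF f gs, THEN square_integrableD(2)] square_integrable_diff[OF f0 g0, THEN square_integrableD(2)]
  note [measurable] = g f[THEN square_integrableD(1)]
  have "(\<lambda>n. (\<integral>x. (cmod (f n x))\<^sup>2 - (cmod (f n x - g n x))\<^sup>2 \<partial>M)) \<longlonglongrightarrow>
     (\<integral>x. (cmod (f0 x))\<^sup>2 - (cmod (f0 x - g0 x))\<^sup>2 \<partial>M)"
  proof (rule integral_tendsto_dominated_up_to_small[where k = "\<lambda>n x. (cmod (f n x))\<^sup>2" and K = K])
    show "AE x in M. (\<lambda>n. (cmod (f n x))\<^sup>2 - (cmod (f n x - g n x))\<^sup>2) \<longlonglongrightarrow> (cmod (f0 x))\<^sup>2 - (cmod (f0 x - g0 x))\<^sup>2"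
      using limf limg by eventually_elim (intro tendsto_intros)
    fix e :: real assume e: "0 < e"
    show "\<exists>b. integrable M b \<and> (\<forall>n. AE x in M. \<bar>(cmod (f n x))\<^sup>2 - (cmod (f n x - g n x))\<^sup>2\<bar> \<le> e * (cmod (f n x))\<^sup>2 + b x)"
    \<comment> \<open>In the factor, \<open>1 / e\<close> pays for the cross term by weighted
      squares and \<open>1\<close> for the square of \<open>g n\<close> itself.\<close>
    proof (intro exI[of _ "\<lambda>x. (1 + 1 / e) * d x"] conjI allI)
      fix n 
      show "AE x in M. \<bar>(cmod (f n x))\<^sup>2 - (cmod (f n x - g n x))\<^sup>2\<bar> \<le> e * (cmod (f n x))\<^sup>2 + (1 + 1 / e) * d x"
        using d(2)[of n]
      proof eventually_elim
        case (elim x)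
        have "\<bar>(cmod (f n x))\<^sup>2 - (cmod (f n x - g n x))\<^sup>2\<bar> \<le> 2 * \<bar>Re (cnj (g n x) * f n x)\<bar> + (cmod (g n x))\<^sup>2"
        proof -
          have "Re (cnj (f n x) * g n x) = Re (cnj (g n x) * f n x)" by simp
          then show ?thesis
            unfolding cmod_diff_squared[of "f n x"]
            using zero_le_power2[of "cmod (g n x)"] by linarith
        qed
        also have "\<dots> \<le> e * (cmod (f n x))\<^sup>2 + (cmod (g n x))\<^sup>2 / e + (cmod (g n x))\<^sup>2"
          using cmod_cross_le[OF e, of "g n x" "f n x"] by linarith
        also have "\<dots> = e * (cmod (f n x))\<^sup>2 + (1 + 1 / e) * (cmod (g n x))\<^sup>2"
          using e by (simp add: field_simps)
        also have "\<dots> \<le> e * (cmod (f n x))\<^sup>2 + (1 + 1 / e) * d x"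
          using elim e by (intro add_left_mono mult_left_mono) auto
        finally show ?case .
      qed
    qed (intro integrable_mult_right d(1))
  next
    show "integrable M (\<lambda>x. (cmod (f0 x))\<^sup>2 - (cmod (f0 x - g0 x))\<^sup>2)"
      by (intro Bochner_Integration.integrable_diff ff)
    show "(\<lambda>x. (cmod (f n x))\<^sup>2 - (cmod (f n x - g n x))\<^sup>2) \<in> borel_measurable M" for n by measurable
    show "integrable M (\<lambda>x. (cmod (f n x))\<^sup>2)" for n by (rule ff)
  qed (auto intro: K)
  then show ?thesis
    by (subst (asm) (1 2) Bochner_Integration.integral_diff) (rule ff)+
qed

text \<open>Either \<open>t\<close> is at most \<open>h * x\<close>, and \<open>y\<close> is a
  slight multiple of \<open>x\<close>, or \<open>x\<close> is at most \<open>t / h\<close>, and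
  \<open>y\<close> is a large multiple of \<open>t\<close>. As \<open>h\<close> tends to 0 the
  coefficient of \<open>x\<close> tends to 1, which a plain convexity estimate would not
  give.\<close>

lemma powr_le_of_le_add:
  fixes x y t p h :: real
  assumes "0 \<le> x" "0 \<le> y" "0 \<le> t" "y \<le> x + t" "0 < p" "0 < h"
  shows "y powr p \<le> (1 + h) powr p * x powr p + (1 + 1 / h) powr p * t powr p"
proof (cases "t \<le> h * x")
  case True
  then have "y \<le> (1 + h) * x" using assms by (simp add: algebra_simps)
  then have "y powr p \<le> ((1 + h) * x) powr p" using assms by (intro powr_mono2) auto
  then show ?thesis using assms by (simp add: powr_mult add_increasing2)
next
  case False
  then have "x \<le> t / h" using assms by (simp add: field_simps)
  then have "y \<le> (1 + 1 / h) * t" using assms by (simp add: algebra_simps)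
  then have "y powr p \<le> ((1 + 1 / h) * t) powr p" using assms by (intro powr_mono2) auto
  then show ?thesis using assms by (simp add: powr_mult add_increasing)
qed

text \<open>The inequality behind the Brezis--Lieb lemma. Both triangle inequalities are used, with
  \<open>h\<close> so small that the coefficient in \<open>powr_le_of_le_add\<close> is
  \<open>1 + q\<close>. One of them leaves \<open>q * y\<close> on the wrong side; it is estimated
  once more through \<open>x\<close>, and the cap in \<open>min e 1\<close> keeps
  \<open>q \<le> 1/2\<close>, so that this second substitution costs little.\<close>

lemma abs_powr_diff_le:
  fixes p e :: real
  assumes p: "0 < p" and e: "0 < e"
  obtains C where "0 \<le> C"
    "\<And>a b :: complex. \<bar>cmod a powr p - cmod (a - b) powr p\<bar> \<le> e * cmod a powr p + C * cmod b powr p"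
proof -
  have "((\<lambda>h. (1 + h) powr p) \<longlongrightarrow> (1 + 0) powr p) (at_right 0)"
    by (intro tendsto_intros) auto
  then have "eventually (\<lambda>h. (1 + h) powr p < 1 + min e 1 / 2) (at_right 0)"
    using e by (intro order_tendstoD) auto
  moreover have "eventually (\<lambda>h::real. h > 0) (at_right 0)" by (simp add: eventually_at_right_less)
  ultimately have "eventually (\<lambda>h::real. 0 < h \<and> (1 + h) powr p < 1 + min e 1 / 2) (at_right 0)"
    by eventually_elim auto
  then obtain h :: real where h: "0 < h" "(1 + h) powr p < 1 + min e 1 / 2"
    using eventually_happens'[of "at_right (0::real)"] by auto
  define C where "C = 2 * (1 + 1 / h) powr p"
  show thesis
  proof
    show "0 \<le> C" by (simp add: C_def)
    fix a b :: complex
    define x y t where "x = cmod a powr p" and "y = cmod (a - b) powr p" and "t = (1 + 1 / h) powr p * cmod b powr p"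
    have nn: "0 \<le> x" "0 \<le> y" "0 \<le> t" by (auto simp: x_def y_def t_def)
    have "cmod (a - b) \<le> cmod a + cmod b" by (rule norm_triangle_ineq4)
    then have 1: "y \<le> (1 + h) powr p * x + t"
      unfolding x_def y_def t_def using p h by (intro powr_le_of_le_add) auto
    have "cmod a \<le> cmod (a - b) + cmod b" by (metis add.commute norm_triangle_sub)
    then have 2: "x \<le> (1 + h) powr p * y + t"
      unfolding x_def y_def t_def using p h by (intro powr_le_of_le_add) auto
    define q where "q = (1 + h) powr p - 1"
    have q: "0 \<le> q" "q \<le> 1/2" "2 * q \<le> e" using h p by (auto simp: q_def intro!: ge_one_powr_ge_zero)
    have 1: "y - x \<le> q * x + t" and 2: "x - y \<le> q * y + t" using 1 2 by (auto simp: q_def algebra_simps)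
    have qx: "q * x \<le> e * x" "0 \<le> q * x" using q nn e by (auto intro: mult_right_mono)
    have qx2: "2 * (q * x) \<le> e * x" using mult_right_mono[OF q(3) nn(1)] by simp
    have qqx: "q * (q * x) \<le> 1/2 * (q * x)" by (rule mult_right_mono[OF q(2) qx(2)])
    have qt: "q * t \<le> 1/2 * t" "0 \<le> q * t" using mult_right_mono[OF q(2) nn(3)] q nn by auto
    have "q * y \<le> q * (x + q * x + t)" using 1 q by (intro mult_left_mono) auto
    then have "q * y \<le> q * x + q * (q * x) + q * t" by (simp add: algebra_simps)
    with 2 have "x - y \<le> e * x + 2 * t" using qqx qx qx2 qt by linarith
    moreover have "y - x \<le> e * x + 2 * t" using 1 qx nn by linarith
    ultimately show "\<bar>cmod a powr p - cmod (a - b) powr p\<bar> \<le> e * cmod a powr p + C * cmod b powr p"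
      unfolding C_def x_def y_def t_def by (simp add: abs_le_iff)
  qed
qed

text \<open>The Brezis--Lieb lemma with a subtracted function \<open>g\<close> that may differ from
  the limit \<open>f0\<close>; the discrepancy \<open>f0 - g\<close> stays on the right. It is
  applied to truncations of the limit and, in the radial case, to the limit itself.\<close>

lemma powr_splitting:
  fixes f :: "nat \<Rightarrow> 'a \<Rightarrow> complex" and p :: real
  assumes p: "0 < p" and f: "\<And>n. f n \<in> borel_measurable M" and g: "g \<in> borel_measurable M"
    and fp: "\<And>n. integrable M (\<lambda>x. cmod (f n x) powr p)" and f0p: "integrable M (\<lambda>x. cmod (f0 x) powr p)"
    and gp: "integrable M (\<lambda>x. cmod (g x) powr p)" and fgp: "integrable M (\<lambda>x. cmod (f0 x - g x) powr p)"
    and K: "\<And>n. (\<integral>x. cmod (f n x) powr p \<partial>M) \<le> K" and lim: "AE x in M. (\<lambda>n. f n x) \<longlonglongrightarrow> f0 x"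
  shows "\<And>n. integrable M (\<lambda>x. cmod (f n x - g x) powr p)"
    and "(\<lambda>n. (\<integral>x. cmod (f n x) powr p \<partial>M) - (\<integral>x. cmod (f n x - g x) powr p \<partial>M)) \<longlonglongrightarrow>
     (\<integral>x. cmod (f0 x) powr p \<partial>M) - (\<integral>x. cmod (f0 x - g x) powr p \<partial>M)"
proof -
  note [measurable] = f g
  show i: "integrable M (\<lambda>x. cmod (f n x - g x) powr p)" for n
  proof -
    obtain C where C: "0 \<le> C" "\<And>a b :: complex. \<bar>cmod a powr p - cmod (a - b) powr p\<bar> \<le> 1 * cmod a powr p + C * cmod b powr p"
      using abs_powr_diff_le[OF p, of 1] by auto
    show ?thesis
    proof (rule Bochner_Integration.integrable_bound)
      show "integrable M (\<lambda>x. 2 * cmod (f n x) powr p + C * cmod (g x) powr p)" using fp gp by auto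
      show "AE x in M. norm (cmod (f n x - g x) powr p) \<le> norm (2 * cmod (f n x) powr p + C * cmod (g x) powr p)"
      proof (intro AE_I2)
        fix x
        have "0 \<le> C * cmod (g x) powr p" using C(1) by simp
        then show "norm (cmod (f n x - g x) powr p) \<le> norm (2 * cmod (f n x) powr p + C * cmod (g x) powr p)"
          using C(2)[of "f n x" "g x"] powr_ge_zero[of "cmod (f n x)" p] powr_ge_zero[of "cmod (f n x - g x)" p]
          unfolding real_norm_def by linarith
      qed
    qed auto
  qed
  have "(\<lambda>n. (\<integral>x. cmod (f n x) powr p - cmod (f n x - g x) powr p \<partial>M)) \<longlonglongrightarrow>
     (\<integral>x. cmod (f0 x) powr p - cmod (f0 x - g x) powr p \<partial>M)"
  proof (rule integral_tendsto_dominated_up_to_small[where k = "\<lambda>n x. cmod (f n x) powr p" and K = K])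
    show "AE x in M. (\<lambda>n. cmod (f n x) powr p - cmod (f n x - g x) powr p) \<longlonglongrightarrow> cmod (f0 x) powr p - cmod (f0 x - g x) powr p"
      using lim by eventually_elim (use p in \<open>intro tendsto_intros tendsto_powr'; auto\<close>)
    fix e :: real assume e: "0 < e"
    obtain C where C: "0 \<le> C" "\<And>a b :: complex. \<bar>cmod a powr p - cmod (a - b) powr p\<bar> \<le> e * cmod a powr p + C * cmod b powr p"
      using abs_powr_diff_le[OF p e] by auto
    show "\<exists>b. integrable M b \<and> (\<forall>n. AE x in M. \<bar>cmod (f n x) powr p - cmod (f n x - g x) powr p\<bar> \<le> e * cmod (f n x) powr p + b x)"
      by (intro exI[of _ "\<lambda>x. C * cmod (g x) powr p"] conjI allI AE_I2 C(2)) (use gp in auto)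
  next
    show "integrable M (\<lambda>x. cmod (f0 x) powr p - cmod (f0 x - g x) powr p)"
      by (intro Bochner_Integration.integrable_diff f0p fgp)
    show "(\<lambda>x. cmod (f n x) powr p - cmod (f n x - g x) powr p) \<in> borel_measurable M" for n by measurable
    show "integrable M (\<lambda>x. cmod (f n x) powr p)" for n by (rule fp)
  qed (auto intro: K)
  then show "(\<lambda>n. (\<integral>x. cmod (f n x) powr p \<partial>M) - (\<integral>x. cmod (f n x - g x) powr p \<partial>M)) \<longlonglongrightarrow>
     (\<integral>x. cmod (f0 x) powr p \<partial>M) - (\<integral>x. cmod (f0 x - g x) powr p \<partial>M)"
    by (subst (asm) (1 2) Bochner_Integration.integral_diff) (rule fp i f0p fgp)+
qed

section \<open>The magnetic quotient and its quadratic form\<close>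

lemma borel_measurable_fst_snd [measurable]:
  "fst \<in> borel_measurable (borel :: ((real^3) \<times> (real^3)) measure)"
  "snd \<in> borel_measurable (borel :: ((real^3) \<times> (real^3)) measure)"
  by (auto intro!: borel_measurable_continuous_onI continuous_intros)

lemma AE_lborel_fst_snd:
  fixes P :: "'a::euclidean_space \<Rightarrow> bool"
  assumes "AE x in lborel. P x"
  shows "AE z in (lborel :: ('a \<times> 'a) measure). P (fst z) \<and> P (snd z)"
proof -
  from assms obtain N :: "'a set" where N: "{x \<in> space lborel. \<not> P x} \<subseteq> N" "emeasure lborel N = 0" "N \<in> sets lborel"
    by (rule AE_E)
  have "emeasure (lborel \<Otimes>\<^sub>M lborel) (N \<times> (UNIV :: 'a set)) = 0" "emeasure (lborel \<Otimes>\<^sub>M lborel) ((UNIV :: 'a set) \<times> N) = 0"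
    using N(2,3) by (subst lborel.emeasure_pair_measure_Times; simp)+
  moreover have "N \<times> (UNIV :: 'a set) \<in> sets (lborel \<Otimes>\<^sub>M lborel)" "(UNIV :: 'a set) \<times> N \<in> sets (lborel \<Otimes>\<^sub>M lborel)"
    using N(3) by auto
  ultimately have "N \<times> UNIV \<in> null_sets (lborel :: ('a \<times> 'a) measure)" "UNIV \<times> N \<in> null_sets (lborel :: ('a \<times> 'a) measure)"
    unfolding lborel_prod[symmetric] by auto
  then have "N \<times> UNIV \<union> UNIV \<times> N \<in> null_sets (lborel :: ('a \<times> 'a) measure)" by (rule null_sets.Un)
  then show ?thesis
    by (rule AE_I') (use N(1) in auto)
qed

text \<open>The spaces are defined with Lebesgue measurable functions, while the analysis composes
  functions with projections, shifts and rotations, which preserve Borel measurability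
  directly.\<close>

lemma borel_representative:
  fixes u :: "'a::euclidean_space \<Rightarrow> complex"
  assumes "u \<in> borel_measurable lebesgue"
  obtains v where "v \<in> borel_measurable borel" "AE x in lborel. u x = v x"
proof -
  have "(\<lambda>x. Re (u x)) \<in> borel_measurable lebesgue" "(\<lambda>x. Im (u x)) \<in> borel_measurable lebesgue"
    using assms by measurable
  then obtain f g where fg: "f \<in> borel_measurable lborel" "AE x in lborel. Re (u x) = f x"
      "g \<in> borel_measurable lborel" "AE x in lborel. Im (u x) = g x"
    using completion_ex_borel_measurable_real[of "\<lambda>x. Re (u x)" lborel]
      completion_ex_borel_measurable_real[of "\<lambda>x. Im (u x)" lborel] by blast
  show thesis
  proof
    show "(\<lambda>x. Complex (f x) (g x)) \<in> borel_measurable borel"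
      using fg(1,3) unfolding Complex_eq by measurable
    show "AE x in lborel. u x = Complex (f x) (g x)"
      using fg(2,4) by eventually_elim (simp add: complex_eq_iff)
  qed
qed

section \<open>Dyadic shells, reflections and the integrable kernel\<close>

lemma dyadic_scale:
  fixes x :: real assumes "1 \<le> x"
  obtains j :: nat where "2 powr j \<le> x" "x \<le> 2 powr (j + 1)"
proof
  have l: "0 \<le> log 2 x" using assms by simp
  have "real (nat \<lfloor>log 2 x\<rfloor>) \<le> log 2 x" "log 2 x \<le> real (nat \<lfloor>log 2 x\<rfloor>) + 1" using l by linarith+
  then have "2 powr (nat \<lfloor>log 2 x\<rfloor>) \<le> 2 powr log 2 x" "2 powr log 2 x \<le> 2 powr (nat \<lfloor>log 2 x\<rfloor> + 1)"
    by (simp_all only: powr_le_cancel_iff)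
  then show "2 powr (nat \<lfloor>log 2 x\<rfloor>) \<le> x" "x \<le> 2 powr (nat \<lfloor>log 2 x\<rfloor> + 1)"
    using assms by simp_all
qed

lemma nn_integral_lborel_reflect:
  fixes a :: "'a::euclidean_space"
  assumes "f \<in> borel_measurable borel"
  shows "(\<integral>\<^sup>+y. f (a - y) \<partial>lborel) = (\<integral>\<^sup>+y. f y \<partial>lborel)"
proof -
  have [measurable]: "f \<in> borel_measurable borel" by fact
  have "(\<integral>\<^sup>+y. f y \<partial>lborel) = (\<integral>\<^sup>+y. f y \<partial>(density (distr lborel borel (\<lambda>x. a + (-1) *\<^sub>R x)) (\<lambda>_. ennreal (\<bar>-1\<bar>^DIM('a)))))"
    by (subst lborel_affine[of "-1" a]) auto
  also have "\<dots> = (\<integral>\<^sup>+y. f (a - y) \<partial>lborel)"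
    by (subst nn_integral_density) (auto simp: nn_integral_distr)
  finally show ?thesis ..
qed

lemma nn_integral_lborel_shift:
  fixes a :: "'a::euclidean_space"
  assumes "f \<in> borel_measurable borel"
  shows "(\<integral>\<^sup>+y. f (y + a) \<partial>lborel) = (\<integral>\<^sup>+y. f y \<partial>lborel)"
proof -
  have [measurable]: "f \<in> borel_measurable borel" by fact
  have "(\<integral>\<^sup>+y. f (y + a) \<partial>lborel) = (\<integral>\<^sup>+y. f (a - (0 - y)) \<partial>lborel)" by (simp add: add.commute)
  also have "\<dots> = (\<integral>\<^sup>+y. f (a - y) \<partial>lborel)" by (rule nn_integral_lborel_reflect) simp
  also have "\<dots> = (\<integral>\<^sup>+y. f y \<partial>lborel)" by (rule nn_integral_lborel_reflect) simp
  finally show ?thesis .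
qed

text \<open>In dimension 3 the volume of a ball is a constant times the cube of its radius, so
  geometric decay of \<open>a j * \<rho> j ^ 3\<close> suffices. This takes the role of polar
  coordinates for the kernel.\<close>

lemma nn_integral_sum_balls_finite:
  fixes C q :: real and \<rho> :: "nat \<Rightarrow> real"
  assumes "0 \<le> C" "0 \<le> q" "q < 1" "\<And>j. 0 \<le> a j" "\<And>j. 0 \<le> \<rho> j" "\<And>j. a j * \<rho> j ^ 3 \<le> C * q ^ j"
  shows "(\<integral>\<^sup>+z. (\<Sum>j. ennreal (a j) * indicator (cball (0 :: real^3) (\<rho> j)) z) \<partial>lborel) < \<infinity>"
proof -
  define V where "V = unit_ball_vol (real DIM(real^3))"
  have V: "0 \<le> V" by (auto simp: V_def unit_ball_vol_nonneg)
  have "(\<integral>\<^sup>+z. (\<Sum>j. ennreal (a j) * indicator (cball (0 :: real^3) (\<rho> j)) z) \<partial>lborel)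
      = (\<Sum>j. \<integral>\<^sup>+z. ennreal (a j) * indicator (cball (0 :: real^3) (\<rho> j)) z \<partial>lborel)"
    by (intro nn_integral_suminf borel_measurable_times_ennreal borel_measurable_indicator) auto
  also have "\<dots> = (\<Sum>j. ennreal (a j * (V * \<rho> j ^ 3)))"
  proof (rule arg_cong[where f = suminf], rule ext)
    fix j
    have "emeasure lborel (cball (0 :: real^3) (\<rho> j)) = ennreal (V * \<rho> j ^ 3)"
      using emeasure_cball[of "\<rho> j" "0 :: real^3"] assms(5)[of j] by (simp add: V_def)
    then show "(\<integral>\<^sup>+z. ennreal (a j) * indicator (cball (0 :: real^3) (\<rho> j)) z \<partial>lborel) = ennreal (a j * (V * \<rho> j ^ 3))"
      using assms(4) by (simp add: nn_integral_cmult_indicator ennreal_mult'[symmetric])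
  qed
  also have "\<dots> \<le> (\<Sum>j. ennreal (V * C * q ^ j))"
  proof (intro suminf_le ennreal_leI)
    fix j show "a j * (V * \<rho> j ^ 3) \<le> V * C * q ^ j"
      using mult_left_mono[OF assms(6)[of j] V] by (simp add: mult_ac)
  qed simp_all
  also have "\<dots> = ennreal (\<Sum>j. V * C * q ^ j)"
    using assms V by (intro suminf_ennreal2 summable_mult summable_geometric) auto
  finally show ?thesis by (simp add: le_less_trans)
qed

text \<open>The singularity of the seminorm, weakened by \<open>|z|^2\<close> near the origin. This
  weight remains after the increment of a bounded Lipschitz cutoff, or of a phase with locally
  bounded potential, has been estimated.\<close>

definition singular_kernel :: "real \<Rightarrow> real^3 \<Rightarrow> real" where
  "singular_kernel s z = min 1 ((norm z)\<^sup>2) / norm z powr (3 + 2 * s)"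

text \<open>A square root of the integrand of the seminorm that keeps its phase: the seminorm
  becomes an ordinary \<open>L^2\<close> norm on pairs of points, and the splitting lemmas apply.
  Division by zero makes it 0 on the diagonal, as in \<open>magnetic_seminorm_sq\<close>.\<close>

definition magnetic_quotient ::
    "real \<Rightarrow> (real^3 \<Rightarrow> real^3) \<Rightarrow> (real^3 \<Rightarrow> complex) \<Rightarrow> (real^3) \<times> (real^3) \<Rightarrow> complex" where
  "magnetic_quotient s A u z =
     (exp (- \<i> * complex_of_real ((fst z - snd z) \<bullet> A ((1/2) *\<^sub>R (fst z + snd z)))) * u (fst z) - u (snd z))
      / complex_of_real (norm (fst z - snd z) powr ((3 + 2 * s) / 2))"

abbreviation L2sq :: "('a::euclidean_space \<Rightarrow> complex) \<Rightarrow> real" where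
  "L2sq u \<equiv> \<integral>x. (cmod (u x))\<^sup>2 \<partial>lborel"

abbreviation ball_mass :: "real^3 \<Rightarrow> real \<Rightarrow> (real^3 \<Rightarrow> complex) \<Rightarrow> ennreal" where
  "ball_mass \<xi> R u \<equiv> \<integral>\<^sup>+x. indicator (cball \<xi> R) x * ennreal ((cmod (u x))\<^sup>2) \<partial>lborel"

locale fractional_order =
  fixes s :: real
  assumes s: "0 < s" "s < 1"
begin

abbreviation \<kappa> :: "real^3 \<Rightarrow> real" where "\<kappa> \<equiv> singular_kernel s"
abbreviation D :: "(real^3 \<Rightarrow> real^3) \<Rightarrow> (real^3 \<Rightarrow> complex) \<Rightarrow> (real^3) \<times> (real^3) \<Rightarrow> complex" where
  "D \<equiv> magnetic_quotient s"

lemma kernel_nonneg: "0 \<le> \<kappa> z"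
  by (simp add: singular_kernel_def)

lemma kernel_measurable [measurable]: "\<kappa> \<in> borel_measurable borel"
  unfolding singular_kernel_def[abs_def] by measurable

text \<open>The kernel lies below step functions on dyadic shells. Far from the origin the shells
  contribute multiples of \<open>2 powr (- 2 * s * j)\<close>, summable as \<open>0 < s\<close>;
  near the origin, of \<open>2 powr ((2 * s - 2) * j)\<close>, summable as
  \<open>s < 1\<close>.\<close>

lemma kernel_integrable: "integrable lborel \<kappa>"
proof -
  define a b where "a j = 2 powr (- real j * (3 + 2 * s))" and "b j = 2 powr (real (j + 1) * (1 + 2 * s))" for j :: nat
  define \<rho> \<sigma> :: "nat \<Rightarrow> real" where "\<rho> j = 2 powr (real j + 1)" and "\<sigma> j = 2 powr (- real j)" for j
  let ?S = "\<lambda>c \<rho> z. (\<Sum>j. ennreal (c j) * indicator (cball (0 :: real^3) (\<rho> j)) z)"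
  have pick: "ennreal (c j) \<le> ?S c r z" if "norm z \<le> r j" for c r z j
  proof -
    have "ennreal (c j) = ennreal (c j) * indicator (cball 0 (r j)) z" using that by simp
    also have "\<dots> \<le> ?S c r z"
      using sum_le_suminf[of "\<lambda>j. ennreal (c j) * indicator (cball 0 (r j)) z" "{j}"]
      by (simp del: sum_mult_indicator)
    finally show ?thesis .
  qed
  have pw: "ennreal (\<kappa> z) \<le> ?S a \<rho> z + ?S b \<sigma> z" for z
  proof (cases "norm z \<ge> 1")
    case True
    then obtain j :: nat where j: "2 powr j \<le> norm z" "norm z \<le> 2 powr (j + 1)"
      by (rule dyadic_scale)
    have "\<kappa> z \<le> 1 / norm z powr (3 + 2 * s)" by (auto simp: singular_kernel_def intro!: divide_right_mono)
    also have "\<dots> \<le> 1 / (2 powr j) powr (3 + 2 * s)"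
      using j s by (intro divide_left_mono powr_mono2 mult_pos_pos) auto
    also have "\<dots> = a j" by (simp add: a_def powr_powr powr_minus_divide)
    finally have "ennreal (\<kappa> z) \<le> ennreal (a j)" by (rule ennreal_leI)
    also have "\<dots> \<le> ?S a \<rho> z" by (rule pick) (use j in \<open>simp add: \<rho>_def add.commute\<close>)
    finally show ?thesis by (simp add: add_increasing2)
  next
    case False
    show ?thesis
    proof (cases "z = 0")
      case False
      then have "1 \<le> 1 / norm z" using \<open>\<not> 1 \<le> norm z\<close> by simp
      then obtain j :: nat where j: "2 powr j \<le> 1 / norm z" "1 / norm z \<le> 2 powr (j + 1)"
        by (rule dyadic_scale)
      have z: "2 powr (- real (j + 1)) \<le> norm z" "norm z \<le> 2 powr (- real j)"
        using j False by (simp_all add: powr_minus powr_diff powr_add field_simps)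
      have "\<kappa> z \<le> norm z powr 2 / norm z powr (3 + 2 * s)"
        using False by (auto simp: singular_kernel_def intro!: divide_right_mono)
      also have "\<dots> = norm z powr (2 - (3 + 2 * s))" by (simp only: powr_diff)
      also have "\<dots> = norm z powr (- (1 + 2 * s))" by simp
      also have "\<dots> \<le> (2 powr (- real (j + 1))) powr (- (1 + 2 * s))"
        using z s by (intro powr_mono2') auto
      also have "\<dots> = b j" by (simp only: b_def powr_powr minus_mult_minus)
      finally have "ennreal (\<kappa> z) \<le> ennreal (b j)" by (rule ennreal_leI)
      also have "\<dots> \<le> ?S b \<sigma> z" by (rule pick) (use z in \<open>simp add: \<sigma>_def\<close>)
      finally show ?thesis by (simp add: add_increasing)
    qed (simp add: singular_kernel_def)
  qed
  have 1: "(\<integral>\<^sup>+z. ?S a \<rho> z \<partial>lborel) < \<infinity>"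
  proof (rule nn_integral_sum_balls_finite)
    show "a j * \<rho> j ^ 3 \<le> 8 * (2 powr (- 2 * s)) ^ j" for j
      by (simp add: a_def \<rho>_def powr_realpow[symmetric] powr_powr powr_add[symmetric] algebra_simps)
         (simp add: powr_diff powr_minus field_simps)
    show "2 powr (- 2 * s) < 1" using s powr_less_mono[of "- 2 * s" 0 2] by simp
  qed (auto simp: a_def \<rho>_def)
  have 2: "(\<integral>\<^sup>+z. ?S b \<sigma> z \<partial>lborel) < \<infinity>"
  proof (rule nn_integral_sum_balls_finite)
    show "b j * \<sigma> j ^ 3 \<le> 2 powr (1 + 2 * s) * (2 powr (2 * s - 2)) ^ j" for j
      by (simp add: b_def \<sigma>_def powr_realpow[symmetric] powr_powr powr_add[symmetric] algebra_simps)
    show "2 powr (2 * s - 2) < 1" using s powr_less_mono[of "2 * s - 2" 0 2] by simp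
  qed (auto simp: b_def \<sigma>_def)
  have "(\<integral>\<^sup>+z. ennreal (\<kappa> z) \<partial>lborel) \<le> (\<integral>\<^sup>+z. ?S a \<rho> z + ?S b \<sigma> z \<partial>lborel)"
    by (intro nn_integral_mono pw)
  also have "\<dots> = (\<integral>\<^sup>+z. ?S a \<rho> z \<partial>lborel) + (\<integral>\<^sup>+z. ?S b \<sigma> z \<partial>lborel)"
    by (intro nn_integral_add borel_measurable_suminf_order borel_measurable_times_ennreal borel_measurable_indicator) auto
  also have "\<dots> < \<infinity>" using 1 2 by simp
  finally show ?thesis
    by (intro integrableI_nonneg) (auto simp: kernel_nonneg)
qed

definition \<kappa>mass :: real where "\<kappa>mass = integral\<^sup>L lborel \<kappa>"

lemma kernel_mass_nonneg: "0 \<le> \<kappa>mass"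
  by (simp add: \<kappa>mass_def kernel_nonneg)

lemma kernel_fubini:
  assumes "square_integrable lborel g"
  shows "integrable lborel (\<lambda>z. (cmod (g (fst z)))\<^sup>2 * \<kappa> (fst z - snd z))"
    and "(\<integral>z. (cmod (g (fst z)))\<^sup>2 * \<kappa> (fst z - snd z) \<partial>lborel) = L2sq g * \<kappa>mass"
proof -
  have [measurable]: "g \<in> borel_measurable borel" using assms by (simp add: square_integrable_def)
  have m: "(\<lambda>z. (cmod (g (fst z)))\<^sup>2 * \<kappa> (fst z - snd z)) \<in> borel_measurable lborel" by simp
  have "(\<integral>\<^sup>+z. ennreal ((cmod (g (fst z)))\<^sup>2 * \<kappa> (fst z - snd z)) \<partial>lborel)
     = (\<integral>\<^sup>+x. \<integral>\<^sup>+y. ennreal ((cmod (g x))\<^sup>2) * ennreal (\<kappa> (x - y)) \<partial>lborel \<partial>lborel)"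
    unfolding lborel_prod[symmetric]
    by (subst lborel.nn_integral_fst[symmetric]) (auto simp: ennreal_mult kernel_nonneg borel_prod)
  also have "\<dots> = (\<integral>\<^sup>+x. ennreal ((cmod (g x))\<^sup>2) * (\<integral>\<^sup>+y. ennreal (\<kappa> y) \<partial>lborel) \<partial>lborel)"
    by (subst nn_integral_cmult) (auto simp: nn_integral_lborel_reflect[of "\<lambda>y. ennreal (\<kappa> y)"])
  also have "\<dots> = ennreal (L2sq g * \<kappa>mass)"
    by (subst nn_integral_multc)
       (auto simp: nn_integral_square[OF assms] \<kappa>mass_def ennreal_mult'' kernel_nonneg
          nn_integral_eq_integral[OF kernel_integrable])
  finally have eq: "(\<integral>\<^sup>+z. ennreal ((cmod (g (fst z)))\<^sup>2 * \<kappa> (fst z - snd z)) \<partial>lborel)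
    = ennreal (L2sq g * \<kappa>mass)" .
  show int: "integrable lborel (\<lambda>z. (cmod (g (fst z)))\<^sup>2 * \<kappa> (fst z - snd z))"
    by (rule integrableI_nonneg[OF m]) (auto simp: eq kernel_nonneg)
  show "(\<integral>z. (cmod (g (fst z)))\<^sup>2 * \<kappa> (fst z - snd z) \<partial>lborel) = L2sq g * \<kappa>mass"
    by (rule integral_eq_nn_integral[OF m, unfolded eq, THEN trans]) (auto simp: kernel_nonneg kernel_mass_nonneg)
qed

lemma quotient_measurable [measurable]:
  assumes "A \<in> borel_measurable borel" "u \<in> borel_measurable borel"
  shows "D A u \<in> borel_measurable borel"
  using assms unfolding magnetic_quotient_def[abs_def] by measurable

lemma cmod_quotient_squared:
  "(cmod (D A u z))\<^sup>2 =
    (cmod (exp (- \<i> * complex_of_real ((fst z - snd z) \<bullet> A ((1/2) *\<^sub>R (fst z + snd z)))) * u (fst z) - u (snd z)))\<^sup>2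
      / norm (fst z - snd z) powr (3 + 2 * s)"
proof -
  have "(norm (fst z - snd z) powr ((3 + 2 * s) / 2))\<^sup>2 = norm (fst z - snd z) powr (3 + 2 * s)"
    by (simp add: power2_eq_square powr_add[symmetric])
  then show ?thesis
    unfolding magnetic_quotient_def by (simp add: norm_divide power_divide)
qed

lemma quotient_diff: "D A (\<lambda>x. u x - v x) z = D A u z - D A v z"
  by (simp add: magnetic_quotient_def algebra_simps diff_divide_distrib add_divide_distrib)

lemma quotient_cmult: "D A (\<lambda>x. c * u x) z = c * D A u z"
  by (simp add: magnetic_quotient_def algebra_simps diff_divide_distrib)

lemma const_pos: "0 < c_const s"
  using s unfolding c_const_def by (intro mult_pos_pos divide_pos_pos Gamma_real_pos) auto

text \<open>Borel representatives of the whole finite energy space, without the closure of the test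
  functions; the latter is added in \<open>H\<close>.\<close>

definition HA :: "(real^3 \<Rightarrow> real^3) \<Rightarrow> (real^3 \<Rightarrow> complex) set" where
  "HA A = {u. square_integrable lborel u \<and> square_integrable lborel (D A u)}"

definition Q :: "(real^3 \<Rightarrow> real^3) \<Rightarrow> (real^3 \<Rightarrow> complex) \<Rightarrow> real" where
  "Q A u = L2sq u + c_const s / 2 * L2sq (D A u)"

lemma Q_nonneg: "0 \<le> Q A u"
  unfolding Q_def using const_pos by simp

lemma magnetic_norm_sq_lborel:
  assumes "A \<in> borel_measurable borel" "u \<in> borel_measurable borel"
  shows "magnetic_norm_sq s A u = (\<integral>\<^sup>+x. ennreal ((cmod (u x))\<^sup>2) \<partial>lborel)
    + ennreal (c_const s / 2) * (\<integral>\<^sup>+z. ennreal ((cmod (D A u z))\<^sup>2) \<partial>lborel)"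
  unfolding magnetic_norm_sq_def magnetic_seminorm_sq_def nn_integral_completion cmod_quotient_squared
  by (simp add: case_prod_beta')

lemma magnetic_norm_sq_HA:
  assumes "u \<in> HA A" "A \<in> borel_measurable borel"
  shows "magnetic_norm_sq s A u = ennreal (Q A u)"
proof -
  have u: "square_integrable lborel u" "square_integrable lborel (D A u)" using assms by (auto simp: HA_def)
  then have [measurable]: "u \<in> borel_measurable borel" by (simp add: square_integrable_def)
  show ?thesis
    using const_pos
    by (subst magnetic_norm_sq_lborel)
       (auto simp: assms nn_integral_square[OF u(1)] nn_integral_square[OF u(2)] Q_def ennreal_mult'[symmetric])
qed

lemma HA_iff:
  assumes [measurable]: "A \<in> borel_measurable borel" "u \<in> borel_measurable borel"
  shows "u \<in> HA A \<longleftrightarrow> magnetic_norm_sq s A u < \<infinity>"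
  using const_pos unfolding magnetic_norm_sq_lborel[OF assms] HA_def
  by (auto simp: square_integrable_nn ennreal_mult_less_top)

lemma magnetic_norm_sq_cong_AE:
  assumes "AE x in lborel. u x = v x"
  shows "magnetic_norm_sq s A u = magnetic_norm_sq s A v"
proof -
  have "(\<integral>\<^sup>+x. ennreal ((cmod (u x))\<^sup>2) \<partial>lebesgue) = (\<integral>\<^sup>+x. ennreal ((cmod (v x))\<^sup>2) \<partial>lebesgue)"
    by (rule nn_integral_cong_AE, rule AE_completion) (use assms in eventually_elim, simp)
  moreover have "magnetic_seminorm_sq s A u = magnetic_seminorm_sq s A v"
    unfolding magnetic_seminorm_sq_def
  proof (rule arg_cong2[where f = "(*)", OF refl], rule nn_integral_cong_AE, rule AE_completion)
    show "AE z in lborel. (case z of (x, y) \<Rightarrow> ennreal ((cmod (exp (- \<i> * complex_of_real ((x - y) \<bullet> A ((1/2) *\<^sub>R (x + y)))) * u x - u y))\<^sup>2 / norm (x - y) powr (3 + 2 * s))) =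
      (case z of (x, y) \<Rightarrow> ennreal ((cmod (exp (- \<i> * complex_of_real ((x - y) \<bullet> A ((1/2) *\<^sub>R (x + y)))) * v x - v y))\<^sup>2 / norm (x - y) powr (3 + 2 * s)))"
      using AE_lborel_fst_snd[OF assms] by eventually_elim (simp add: case_prod_beta')
  qed
  ultimately show ?thesis by (simp add: magnetic_norm_sq_def)
qed

lemma HA_measurable: "u \<in> HA A \<Longrightarrow> u \<in> borel_measurable borel"
  by (simp add: HA_def square_integrable_def)

lemma HA_diff: "u \<in> HA A \<Longrightarrow> v \<in> HA A \<Longrightarrow> (\<lambda>x. u x - v x) \<in> HA A"
  unfolding HA_def mem_Collect_eq quotient_diff[abs_def] by (auto intro: square_integrable_diff)

lemma HA_cmult: "u \<in> HA A \<Longrightarrow> (\<lambda>x. c * u x) \<in> HA A"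
  unfolding HA_def mem_Collect_eq quotient_cmult[abs_def] by (auto intro: square_integrable_cmult)

lemma HA_add: "u \<in> HA A \<Longrightarrow> v \<in> HA A \<Longrightarrow> (\<lambda>x. u x + v x) \<in> HA A"
  using HA_diff[of u A "\<lambda>x. - 1 * v x"] HA_cmult[of v A "-1"] by simp

lemma Q_cmult: "Q A (\<lambda>x. c * u x) = (cmod c)\<^sup>2 * Q A u"
  unfolding Q_def quotient_cmult by (simp add: norm_mult power_mult_distrib algebra_simps)

text \<open>The real scalar product whose square norm is \<open>Q\<close>; weak convergence of
  energies is expressed through it.\<close>

definition B :: "(real^3 \<Rightarrow> real^3) \<Rightarrow> (real^3 \<Rightarrow> complex) \<Rightarrow> (real^3 \<Rightarrow> complex) \<Rightarrow> real" where
  "B A u v = (\<integral>x. Re (cnj (u x) * v x) \<partial>lborel) + c_const s / 2 * (\<integral>z. Re (cnj (D A u z) * D A v z) \<partial>lborel)"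

lemma Q_diff:
  assumes "u \<in> HA A" "v \<in> HA A"
  shows "Q A (\<lambda>x. u x - complex_of_real t * v x) = Q A u - 2 * t * B A u v + t\<^sup>2 * Q A v"
proof -
  have [simp]: "D A (\<lambda>x. u x - complex_of_real t * v x) z = D A u z - complex_of_real t * D A v z" for z
    by (simp add: quotient_diff quotient_cmult)
  show ?thesis
    using assms unfolding Q_def B_def HA_def
    by (simp add: integral_cmod_diff_squared algebra_simps)
qed

text \<open>Parallelogram law: the expansions at \<open>t = 1\<close> and \<open>t = -1\<close> have
  opposite cross terms, and the energy of the sum is nonnegative.\<close>

lemma Q_diff_le:
  assumes "u \<in> HA A" "v \<in> HA A"
  shows "Q A (\<lambda>x. u x - v x) \<le> 2 * Q A u + 2 * Q A v"
proof -
  have "0 \<le> Q A (\<lambda>x. u x - complex_of_real (-1) * v x)" by (rule Q_nonneg)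
  then show ?thesis
    using Q_diff[OF assms, of "-1"] Q_diff[OF assms, of 1] by simp
qed

end

section \<open>Cutoffs and changes of the potential\<close>

lemma cmod_exp_ii_diff_le:
  fixes a b :: real
  shows "cmod (exp (- \<i> * complex_of_real a) - exp (- \<i> * complex_of_real b)) \<le> \<bar>a - b\<bar>"
proof -
  have "exp (- \<i> * complex_of_real a) - exp (- \<i> * complex_of_real b)
     = exp (- \<i> * complex_of_real b) * (exp (\<i> * complex_of_real (b - a)) - 1)"
    by (simp add: right_diff_distrib mult_exp_exp algebra_simps)
  then have "cmod (exp (- \<i> * complex_of_real a) - exp (- \<i> * complex_of_real b)) = dist (exp (\<i> * complex_of_real (b - a))) 1"
    by (simp add: norm_mult dist_norm)
  also have "\<dots> = 2 * \<bar>sin ((b - a) / 2)\<bar>" using dist_exp_i_1[of "b - a"] by (simp add: dist_norm)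
  also have "\<dots> \<le> 2 * \<bar>(b - a) / 2\<bar>" by (intro mult_left_mono abs_sin_x_le_abs_x) auto
  finally show ?thesis by simp
qed

context fractional_order
begin

text \<open>A discrete Leibniz rule: the cutoff at the second point multiplies the quotient of
  \<open>u\<close>, and the increment of the cutoff multiplies \<open>u\<close> at the first point.
  The phase has modulus 1 and disappears from the second term.\<close>

lemma quotient_mult_le:
  fixes \<zeta> :: "real^3 \<Rightarrow> real"
  shows "(cmod (D A (\<lambda>x. complex_of_real (\<zeta> x) * u x) z))\<^sup>2 \<le> 2 * (\<zeta> (snd z))\<^sup>2 * (cmod (D A u z))\<^sup>2
    + 2 * ((\<zeta> (fst z) - \<zeta> (snd z))\<^sup>2 / norm (fst z - snd z) powr (3 + 2 * s)) * (cmod (u (fst z)))\<^sup>2"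
proof -
  define e where "e = exp (- \<i> * complex_of_real ((fst z - snd z) \<bullet> A ((1/2) *\<^sub>R (fst z + snd z))))"
  have ne: "cmod e = 1" unfolding e_def by (simp add: norm_exp_eq_Re)
  have "e * (complex_of_real (\<zeta> (fst z)) * u (fst z)) - complex_of_real (\<zeta> (snd z)) * u (snd z)
     = complex_of_real (\<zeta> (snd z)) * (e * u (fst z) - u (snd z)) + complex_of_real (\<zeta> (fst z) - \<zeta> (snd z)) * (e * u (fst z))"
    by (simp add: algebra_simps)
  then have "(cmod (e * (complex_of_real (\<zeta> (fst z)) * u (fst z)) - complex_of_real (\<zeta> (snd z)) * u (snd z)))\<^sup>2
    \<le> 2 * (cmod (complex_of_real (\<zeta> (snd z)) * (e * u (fst z) - u (snd z))))\<^sup>2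
      + 2 * (cmod (complex_of_real (\<zeta> (fst z) - \<zeta> (snd z)) * (e * u (fst z))))\<^sup>2"
    using cmod_add_squared_le by metis
  also have "\<dots> = 2 * (\<zeta> (snd z))\<^sup>2 * (cmod (e * u (fst z) - u (snd z)))\<^sup>2
      + 2 * (\<zeta> (fst z) - \<zeta> (snd z))\<^sup>2 * (cmod (u (fst z)))\<^sup>2"
    by (simp add: norm_mult power_mult_distrib ne flip: of_real_diff)
  finally have "(cmod (e * (complex_of_real (\<zeta> (fst z)) * u (fst z)) - complex_of_real (\<zeta> (snd z)) * u (snd z)))\<^sup>2 / norm (fst z - snd z) powr (3 + 2 * s)
     \<le> (2 * (\<zeta> (snd z))\<^sup>2 * (cmod (e * u (fst z) - u (snd z)))\<^sup>2
      + 2 * (\<zeta> (fst z) - \<zeta> (snd z))\<^sup>2 * (cmod (u (fst z)))\<^sup>2) / norm (fst z - snd z) powr (3 + 2 * s)"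
    by (rule divide_right_mono) simp
  then show ?thesis
    unfolding cmod_quotient_squared e_def[symmetric] by (simp add: add_divide_distrib)
qed

lemma quotient_cutoff_le:
  fixes \<zeta> :: "real^3 \<Rightarrow> real"
  assumes "\<And>x. \<bar>\<zeta> x\<bar> \<le> b" "\<And>x y. (\<zeta> x - \<zeta> y)\<^sup>2 \<le> C * min 1 ((norm (x - y))\<^sup>2)"
  shows "(cmod (D A (\<lambda>x. complex_of_real (\<zeta> x) * u x) z))\<^sup>2
    \<le> 2 * b\<^sup>2 * (cmod (D A u z))\<^sup>2 + 2 * C * ((cmod (u (fst z)))\<^sup>2 * \<kappa> (fst z - snd z))"
proof -
  have 1: "(\<zeta> (snd z))\<^sup>2 \<le> b\<^sup>2" using assms(1)[of "snd z"] by (simp add: abs_le_square_iff[symmetric])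
  have "(\<zeta> (fst z) - \<zeta> (snd z))\<^sup>2 / norm (fst z - snd z) powr (3 + 2 * s) \<le> C * \<kappa> (fst z - snd z)"
    using divide_right_mono[OF assms(2)[of "fst z" "snd z"], of "norm (fst z - snd z) powr (3 + 2 * s)"]
    by (simp add: singular_kernel_def)
  then have 2: "2 * ((\<zeta> (fst z) - \<zeta> (snd z))\<^sup>2 / norm (fst z - snd z) powr (3 + 2 * s)) * (cmod (u (fst z)))\<^sup>2
     \<le> 2 * (C * \<kappa> (fst z - snd z)) * (cmod (u (fst z)))\<^sup>2"
    by (intro mult_right_mono mult_left_mono) auto
  have 3: "2 * (\<zeta> (snd z))\<^sup>2 * (cmod (D A u z))\<^sup>2 \<le> 2 * b\<^sup>2 * (cmod (D A u z))\<^sup>2"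
    using 1 by (intro mult_right_mono mult_left_mono) auto
  show ?thesis using quotient_mult_le[of A \<zeta> u z] 2 3 by (simp add: mult_ac)
qed

lemma
  assumes "u \<in> HA A"
  shows HA_D: "square_integrable lborel (D A u)" "integrable lborel (\<lambda>z. (cmod (D A u z))\<^sup>2)"
    and HA_L2: "square_integrable lborel u" "integrable lborel (\<lambda>x. (cmod (u x))\<^sup>2)"
  using assms by (auto simp: HA_def square_integrable_def)

lemma Q_bounds:
  "L2sq u \<le> Q A u" "c_const s / 2 * L2sq (D A u) \<le> Q A u"
  using const_pos by (auto simp: Q_def)

lemma quotient_integral_le:
  assumes "Q A u \<le> K" shows "L2sq (D A u) \<le> 2 / c_const s * K"
  using order_trans[OF Q_bounds(2) assms] const_pos by (simp add: field_simps)

text \<open>The common core of cutoffs and changes of potential: each gives the pointwise hypothesis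
  on the quotients. The kernel term integrates by Fubini to \<open>C * \<kappa>mass\<close> times
  the squared \<open>L^2\<close> norm, and the energy absorbs both terms.\<close>

lemma HA_by_domination:
  assumes u: "u \<in> HA A" and A[measurable]: "A' \<in> borel_measurable borel" and w[measurable]: "w \<in> borel_measurable borel"
    and le: "\<And>x. cmod (w x) \<le> cmod (u x)" and C: "0 \<le> C"
    and Dle: "\<And>z. (cmod (D A' w z))\<^sup>2 \<le> 2 * (cmod (D A u z))\<^sup>2 + 2 * C * ((cmod (u (fst z)))\<^sup>2 * \<kappa> (fst z - snd z))"
  shows "w \<in> HA A'" "Q A' w \<le> (2 + c_const s * C * \<kappa>mass) * Q A u"
proof -
  let ?b = "\<lambda>z. 2 * (cmod (D A u z))\<^sup>2 + 2 * C * ((cmod (u (fst z)))\<^sup>2 * \<kappa> (fst z - snd z))"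
  note k = kernel_fubini[OF HA_L2(1)[OF u]]
  have le2: "(cmod (w x))\<^sup>2 \<le> (cmod (u x))\<^sup>2" for x using le by (simp add: power_mono)
  have bi: "integrable lborel ?b" using HA_D(2)[OF u] k(1) by simp
  have w1: "square_integrable lborel w"
    by (rule square_integrable_bound[OF _ HA_L2(2)[OF u]]) (use le2 in auto)
  have w2: "square_integrable lborel (D A' w)"
    by (rule square_integrable_bound[OF _ bi]) (use Dle in auto)
  show w: "w \<in> HA A'" using w1 w2 by (simp add: HA_def)
  let ?N = "\<integral>x. (cmod (u x))\<^sup>2 \<partial>lborel" let ?E = "\<integral>z. (cmod (D A u z))\<^sup>2 \<partial>lborel"
  have i1: "L2sq w \<le> ?N"
    by (rule integral_mono[OF HA_L2(2)[OF w] HA_L2(2)[OF u]]) (rule le2)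
  have "L2sq (\<lambda>z. D A' w z) \<le> (\<integral>z. ?b z \<partial>lborel)"
    by (rule integral_mono[OF HA_D(2)[OF w] bi]) (rule Dle)
  also have "\<dots> = 2 * ?E + 2 * C * (?N * \<kappa>mass)"
    using HA_D(2)[OF u] k by simp
  finally have "c_const s / 2 * L2sq (\<lambda>z. D A' w z) \<le> c_const s / 2 * (2 * ?E + 2 * C * (?N * \<kappa>mass))"
    using const_pos by (intro mult_left_mono) auto
  also have "\<dots> = 2 * (c_const s / 2 * ?E) + c_const s * C * \<kappa>mass * ?N" by (simp add: algebra_simps)
  finally have "Q A' w \<le> ?N + 2 * (c_const s / 2 * ?E) + c_const s * C * \<kappa>mass * ?N"
    using i1 unfolding Q_def by linarith
  also have "\<dots> \<le> 2 * Q A u + c_const s * C * \<kappa>mass * Q A u"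
    using const_pos C kernel_mass_nonneg Q_bounds(1)[of u A]
    by (intro add_mono mult_left_mono) (auto simp: Q_def)
  finally show "Q A' w \<le> (2 + c_const s * C * \<kappa>mass) * Q A u" by (simp add: algebra_simps)
qed

lemma HA_cutoff:
  fixes \<zeta> :: "real^3 \<Rightarrow> real"
  assumes u: "u \<in> HA A" and A: "A \<in> borel_measurable borel" and \<zeta>[measurable]: "\<zeta> \<in> borel_measurable borel"
    and le: "\<And>x. \<bar>\<zeta> x\<bar> \<le> 1" and C: "\<And>x y. (\<zeta> x - \<zeta> y)\<^sup>2 \<le> C * min 1 ((norm (x - y))\<^sup>2)"
  shows "(\<lambda>x. complex_of_real (\<zeta> x) * u x) \<in> HA A"
    "Q A (\<lambda>x. complex_of_real (\<zeta> x) * u x) \<le> (2 + c_const s * C * \<kappa>mass) * Q A u"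
proof -
  have [measurable]: "u \<in> borel_measurable borel" by (rule HA_measurable[OF u])
  \<comment> \<open>Two points at distance 1 make the minimum equal to 1, so the hypothesis forces
    \<open>C\<close> to be nonnegative.\<close>
  have "0 \<le> C * min 1 ((norm ((axis 1 1 :: real^3) - 0))\<^sup>2)"
    using C[of "axis 1 1" 0] zero_le_power2 order_trans by blast
  then have C0: "0 \<le> C" by simp
  have 1: "(\<lambda>x. complex_of_real (\<zeta> x) * u x) \<in> borel_measurable borel" by measurable
  have 2: "cmod (complex_of_real (\<zeta> x) * u x) \<le> cmod (u x)" for x
    using le[of x] by (simp add: norm_mult mult_left_le_one_le)
  note 3 = quotient_cutoff_le[of \<zeta> 1 C A u, OF le C, simplified]
  show "(\<lambda>x. complex_of_real (\<zeta> x) * u x) \<in> HA A"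
    "Q A (\<lambda>x. complex_of_real (\<zeta> x) * u x) \<le> (2 + c_const s * C * \<kappa>mass) * Q A u"
    by (rule HA_by_domination[OF u A 1 2 C0]; rule 3)+
qed

text \<open>The complement \<open>1 - \<zeta> n\<close> has the same increments as the cutoff and is
  bounded by 2, so \<open>quotient_cutoff_le\<close> supplies one dominating function for all
  \<open>n\<close>, while \<open>quotient_mult_le\<close> gives pointwise convergence to 0.\<close>

lemma Q_cutoff_tendsto:
  fixes \<zeta> :: "nat \<Rightarrow> real^3 \<Rightarrow> real"
  assumes u: "u \<in> HA A" and A[measurable]: "A \<in> borel_measurable borel" and \<zeta>[measurable]: "\<And>n. \<zeta> n \<in> borel_measurable borel"
    and le: "\<And>n x. \<bar>\<zeta> n x\<bar> \<le> 1" and C: "\<And>n x y. (\<zeta> n x - \<zeta> n y)\<^sup>2 \<le> C * min 1 ((norm (x - y))\<^sup>2)"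
    and lim: "\<And>x. (\<lambda>n. \<zeta> n x) \<longlonglongrightarrow> 1"
  shows "(\<lambda>n. Q A (\<lambda>x. u x - complex_of_real (\<zeta> n x) * u x)) \<longlonglongrightarrow> 0"
proof -
  have [measurable]: "u \<in> borel_measurable borel" by (rule HA_measurable[OF u])
  define \<eta> where "\<eta> n x = 1 - \<zeta> n x" for n x
  have eq: "(\<lambda>x. u x - complex_of_real (\<zeta> n x) * u x) = (\<lambda>x. complex_of_real (\<eta> n x) * u x)" for n
    by (auto simp: \<eta>_def algebra_simps)
  have [measurable]: "\<eta> n \<in> borel_measurable borel" for n unfolding \<eta>_def by measurable
  have \<eta>2: "\<bar>\<eta> n x\<bar> \<le> 2" for n x using le[of n x] by (auto simp: \<eta>_def)
  have \<eta>C: "(\<eta> n x - \<eta> n y)\<^sup>2 \<le> C * min 1 ((norm (x - y))\<^sup>2)" for n x y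
    using C[of n y x] by (simp add: \<eta>_def norm_minus_commute)
  have \<eta>0: "(\<lambda>n. \<eta> n x) \<longlonglongrightarrow> 0" for x unfolding \<eta>_def using tendsto_diff[OF tendsto_const[of 1] lim[of x]] by simp
  note dom = quotient_cutoff_le[of "\<eta> _" 2 C A u, OF \<eta>2 \<eta>C]
  have "(\<lambda>n. \<integral>x. (cmod (complex_of_real (\<eta> n x) * u x))\<^sup>2 \<partial>lborel) \<longlonglongrightarrow> (\<integral>x. 0 \<partial>(lborel :: (real^3) measure))"
  proof (rule integral_dominated_convergence[where w = "\<lambda>x. 4 * (cmod (u x))\<^sup>2"])
    have "((\<lambda>n. (cmod (complex_of_real (\<eta> n x) * u x))\<^sup>2) \<longlongrightarrow> (cmod (complex_of_real 0 * u x))\<^sup>2) sequentially" for x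
      by (intro tendsto_intros \<eta>0)
    then show "AE x in lborel. (\<lambda>n. (cmod (complex_of_real (\<eta> n x) * u x))\<^sup>2) \<longlonglongrightarrow> 0" by simp
    fix n show "AE x in lborel. norm ((cmod (complex_of_real (\<eta> n x) * u x))\<^sup>2) \<le> 4 * (cmod (u x))\<^sup>2"
    proof (intro AE_I2)
      fix x
      have "(\<eta> n x)\<^sup>2 \<le> 2\<^sup>2" using \<eta>2[of n x] by (subst abs_le_square_iff[symmetric]) simp
      then show "norm ((cmod (complex_of_real (\<eta> n x) * u x))\<^sup>2) \<le> 4 * (cmod (u x))\<^sup>2"
        by (simp add: norm_mult power_mult_distrib mult_right_mono)
    qed
  qed (use HA_L2[OF u] in auto)
  moreover have "(\<lambda>n. \<integral>z. (cmod (D A (\<lambda>x. complex_of_real (\<eta> n x) * u x) z))\<^sup>2 \<partial>lborel) \<longlonglongrightarrow> (\<integral>x. 0 \<partial>(lborel :: ((real^3) \<times> (real^3)) measure))"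
  proof (rule integral_dominated_convergence[where w = "\<lambda>z. 2 * 2\<^sup>2 * (cmod (D A u z))\<^sup>2 + 2 * C * ((cmod (u (fst z)))\<^sup>2 * \<kappa> (fst z - snd z))"])
    show "integrable lborel (\<lambda>z. 2 * 2\<^sup>2 * (cmod (D A u z))\<^sup>2 + 2 * C * ((cmod (u (fst z)))\<^sup>2 * \<kappa> (fst z - snd z)))"
      using HA_D(2)[OF u] kernel_fubini(1)[OF HA_L2(1)[OF u]] by simp
    have "(\<lambda>n. (cmod (D A (\<lambda>x. complex_of_real (\<eta> n x) * u x) z))\<^sup>2) \<longlonglongrightarrow> 0" for z
    proof (rule tendsto_sandwich[of "\<lambda>_. 0"])
      let ?r = "\<lambda>n. 2 * (\<eta> n (snd z))\<^sup>2 * (cmod (D A u z))\<^sup>2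
    + 2 * ((\<eta> n (fst z) - \<eta> n (snd z))\<^sup>2 / norm (fst z - snd z) powr (3 + 2 * s)) * (cmod (u (fst z)))\<^sup>2"
      have "?r \<longlonglongrightarrow> 2 * 0\<^sup>2 * (cmod (D A u z))\<^sup>2
    + 2 * ((0 - 0)\<^sup>2 * inverse (norm (fst z - snd z) powr (3 + 2 * s))) * (cmod (u (fst z)))\<^sup>2"
        unfolding divide_inverse by (intro tendsto_intros \<eta>0)
      then show "?r \<longlonglongrightarrow> 0" by simp
      show "\<forall>\<^sub>F n in sequentially. (cmod (D A (\<lambda>x. complex_of_real (\<eta> n x) * u x) z))\<^sup>2 \<le> ?r n"
        by (intro always_eventually allI quotient_mult_le)
    qed auto
    then show "AE z in lborel. (\<lambda>n. (cmod (D A (\<lambda>x. complex_of_real (\<eta> n x) * u x) z))\<^sup>2) \<longlonglongrightarrow> 0" by simp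
    fix n show "AE z in lborel. norm ((cmod (D A (\<lambda>x. complex_of_real (\<eta> n x) * u x) z))\<^sup>2) \<le> 2 * 2\<^sup>2 * (cmod (D A u z))\<^sup>2 + 2 * C * ((cmod (u (fst z)))\<^sup>2 * \<kappa> (fst z - snd z))"
      using dom[of n] by simp
  qed auto
  ultimately have "(\<lambda>n. Q A (\<lambda>x. complex_of_real (\<eta> n x) * u x)) \<longlonglongrightarrow> 0 + c_const s / 2 * 0"
    unfolding Q_def by (intro tendsto_intros) simp_all
  then show ?thesis unfolding eq by simp
qed

text \<open>For points at distance at most 1 the phases differ by at most the distance times the
  difference of the potentials at the midpoint; for distant points they differ by at most 2. Both
  cases are covered by the squared factor \<open>max 2 C\<close> times
  \<open>min 1 |x - y|^2\<close>.\<close>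

lemma quotient_phase_le:
  assumes "u (fst z) \<noteq> 0 \<Longrightarrow> norm (fst z - snd z) \<le> 1 \<Longrightarrow>
      norm (A ((1/2) *\<^sub>R (fst z + snd z)) - A' ((1/2) *\<^sub>R (fst z + snd z))) \<le> C"
  shows "(cmod (D A u z - D A' u z))\<^sup>2 \<le> (max 2 C)\<^sup>2 * ((cmod (u (fst z)))\<^sup>2 * \<kappa> (fst z - snd z))"
proof (cases "u (fst z) = 0")
  case False
  define m where "m = (1/2) *\<^sub>R (fst z + snd z)"
  define d where "d = fst z - snd z"
  define e where "e A = exp (- \<i> * complex_of_real (d \<bullet> A m))" for A :: "real^3 \<Rightarrow> real^3"
  have K: "(cmod (e A - e A'))\<^sup>2 \<le> (max 2 C)\<^sup>2 * min 1 ((norm d)\<^sup>2)"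
  proof (cases "norm d \<le> 1")
    case True
    then have C: "norm (A m - A' m) \<le> C" using assms False by (simp add: m_def d_def)
    have "cmod (e A - e A') \<le> \<bar>d \<bullet> A m - d \<bullet> A' m\<bar>" unfolding e_def by (rule cmod_exp_ii_diff_le)
    also have "\<dots> = \<bar>d \<bullet> (A m - A' m)\<bar>" by (simp add: inner_diff_right)
    also have "\<dots> \<le> norm d * norm (A m - A' m)" by (rule Cauchy_Schwarz_ineq2)
    also have "\<dots> \<le> norm d * max 2 C" using C by (intro mult_left_mono) auto
    finally have "(cmod (e A - e A'))\<^sup>2 \<le> (norm d * max 2 C)\<^sup>2" by (rule power_mono) simp
    moreover have "(norm d)\<^sup>2 \<le> 1" using True by (simp add: power_le_one)
    ultimately show ?thesis by (simp add: power_mult_distrib mult.commute min_absorb2)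
  next
    case False
    have "cmod (e A - e A') \<le> cmod (e A) + cmod (e A')" by (rule norm_triangle_ineq4)
    also have "\<dots> \<le> max 2 C" by (simp add: e_def norm_exp_eq_Re)
    finally have "(cmod (e A - e A'))\<^sup>2 \<le> (max 2 C)\<^sup>2" by (rule power_mono) simp
    moreover have "1 \<le> (norm d)\<^sup>2" using False by simp
    ultimately show ?thesis by (simp add: min_absorb1)
  qed
  have "D A u z - D A' u z = (e A - e A') * u (fst z) / complex_of_real (norm d powr ((3 + 2 * s) / 2))"
    unfolding magnetic_quotient_def e_def m_def d_def by (simp add: diff_divide_distrib[symmetric] algebra_simps)
  moreover have "(norm d powr ((3 + 2 * s) / 2))\<^sup>2 = norm d powr (3 + 2 * s)"
    by (simp add: power2_eq_square powr_add[symmetric])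
  ultimately have "(cmod (D A u z - D A' u z))\<^sup>2 = (cmod (e A - e A'))\<^sup>2 * ((cmod (u (fst z)))\<^sup>2 / norm d powr (3 + 2 * s))"
    by (simp add: norm_divide norm_mult power_divide power_mult_distrib)
  also have "\<dots> \<le> ((max 2 C)\<^sup>2 * min 1 ((norm d)\<^sup>2)) * ((cmod (u (fst z)))\<^sup>2 / norm d powr (3 + 2 * s))"
    by (intro mult_right_mono K) auto
  finally show ?thesis unfolding singular_kernel_def d_def[symmetric] by (simp add: mult_ac)
qed (simp add: magnetic_quotient_def)

lemma midpoint_in_cball:
  fixes x y :: "'a::real_normed_vector"
  assumes "norm x \<le> R" "norm (x - y) \<le> 1" shows "(1/2) *\<^sub>R (x + y) \<in> cball 0 (R + 1)"
proof -
  have "(1/2) *\<^sub>R (x + y) = x - (1/2) *\<^sub>R (x - y)"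
    by (simp add: algebra_simps flip: scaleR_add_left)
  then have "norm ((1/2) *\<^sub>R (x + y)) \<le> norm x + norm ((1/2) *\<^sub>R (x - y))"
    using norm_triangle_ineq4 by metis
  then show ?thesis using assms by simp
qed

lemma quotient_phase_le_supported:
  assumes supp: "\<And>x. u x \<noteq> 0 \<Longrightarrow> norm x \<le> R"
    and C: "\<And>x. x \<in> cball 0 (R + 1) \<Longrightarrow> norm (A x - A' x) \<le> C"
  shows "(cmod (D A u z - D A' u z))\<^sup>2 \<le> (max 2 C)\<^sup>2 * ((cmod (u (fst z)))\<^sup>2 * \<kappa> (fst z - snd z))"
    "(cmod (D A u z))\<^sup>2 \<le> 2 * (cmod (D A' u z))\<^sup>2 + 2 * (max 2 C)\<^sup>2 * ((cmod (u (fst z)))\<^sup>2 * \<kappa> (fst z - snd z))"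
proof -
  show 1: "(cmod (D A u z - D A' u z))\<^sup>2 \<le> (max 2 C)\<^sup>2 * ((cmod (u (fst z)))\<^sup>2 * \<kappa> (fst z - snd z))"
    by (rule quotient_phase_le, rule C, rule midpoint_in_cball) (use supp in auto)
  show "(cmod (D A u z))\<^sup>2 \<le> 2 * (cmod (D A' u z))\<^sup>2 + 2 * (max 2 C)\<^sup>2 * ((cmod (u (fst z)))\<^sup>2 * \<kappa> (fst z - snd z))"
    using 1 cmod_add_squared_le[of "D A' u z" "D A u z - D A' u z"] by simp
qed

text \<open>Compact support confines the relevant midpoints to a ball. Hence for compactly supported
  functions, finiteness of the energy does not depend on the choice of the locally bounded
  potential.\<close>

lemma HA_change_potential:
  assumes u: "u \<in> HA A" and A': "A' \<in> borel_measurable borel"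
    and supp: "\<And>x. u x \<noteq> 0 \<Longrightarrow> norm x \<le> R"
    and C: "\<And>x. x \<in> cball 0 (R + 1) \<Longrightarrow> norm (A' x - A x) \<le> C"
  shows "u \<in> HA A'" "Q A' u \<le> (2 + c_const s * (max 2 C)\<^sup>2 * \<kappa>mass) * Q A u"
  using HA_by_domination[OF u A' HA_measurable[OF u] order_refl, of "(max 2 C)\<^sup>2"]
    quotient_phase_le_supported(2)[of u R A' A C, OF supp C] by auto

lemma quotient_tendsto:
  assumes "(\<lambda>n. A n ((1/2) *\<^sub>R (fst z + snd z))) \<longlonglongrightarrow> A0 ((1/2) *\<^sub>R (fst z + snd z))"
    "(\<lambda>n. u n (fst z)) \<longlonglongrightarrow> u0 (fst z)" "(\<lambda>n. u n (snd z)) \<longlonglongrightarrow> u0 (snd z)"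
  shows "(\<lambda>n. D (A n) (u n) z) \<longlonglongrightarrow> D A0 u0 z"
  unfolding magnetic_quotient_def divide_inverse[where b = "complex_of_real _"] by (intro tendsto_intros assms)

lemma Q_Fatou:
  assumes A: "\<And>x. (\<lambda>n. A n x) \<longlonglongrightarrow> A0 x" "A0 \<in> borel_measurable borel"
    and u: "\<And>n. u n \<in> HA (A n)" "u0 \<in> borel_measurable borel" and lim: "AE x in lborel. (\<lambda>n. u n x) \<longlonglongrightarrow> u0 x"
    and K: "\<And>n. Q (A n) (u n) \<le> K"
  shows "u0 \<in> HA A0"
proof -
  have DK: "L2sq (D (A n) (u n)) \<le> 2 / c_const s * K" for n
    by (rule quotient_integral_le[OF K])
  have limD: "AE z in lborel. (\<lambda>n. D (A n) (u n) z) \<longlonglongrightarrow> D A0 u0 z"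
    using AE_lborel_fst_snd[OF lim] by eventually_elim (intro quotient_tendsto A(1), auto)
  have "square_integrable lborel (D A0 u0)"
    by (rule Fatou_square(1)[OF HA_D(1)[OF u(1)] _ DK limD]) (simp add: quotient_measurable[OF A(2) u(2)])
  moreover have "square_integrable lborel u0"
    by (rule Fatou_square(1)[OF HA_L2(1)[OF u(1)] _ order_trans[OF Q_bounds(1) K] lim]) (simp add: u)
  ultimately show ?thesis by (simp add: HA_def)
qed

end

section \<open>Test functions\<close>

lemma C_k_SucI:
  assumes "\<And>x. (f has_derivative f' x) (at x)" "\<And>v. C_k k (\<lambda>x. f' x v)"
  shows "C_k (Suc k) f"
proof -
  have "frechet_derivative f (at x) = f' x" for x
    using frechet_derivative_at[OF assms(1)] by simp
  then show ?thesis using assms by (auto simp: differentiable_def)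
qed

lemma C_k_SucD:
  assumes "C_k (Suc k) f"
  shows "(f has_derivative frechet_derivative f (at x)) (at x)" "C_k k (\<lambda>x. frechet_derivative f (at x) v)"
  using assms frechet_derivative_works[of f "at x"] by auto

lemma C_k_Suc_imp: "C_k (Suc k) f \<Longrightarrow> C_k k f"
proof (induction k arbitrary: f)
  case 0
  then show ?case by (auto intro!: continuous_at_imp_continuous_on differentiable_imp_continuous_within)
next
  case (Suc k)
  from Suc.prems have "f differentiable (at x)" "C_k (Suc k) (\<lambda>x. frechet_derivative f (at x) v)" for x v
    unfolding C_k.simps(2)[of "Suc k"] by auto
  then show ?case using Suc.IH by simp
qed

lemma C_k_const: "C_k k (\<lambda>x. c)"
proof (induction k arbitrary: c)
  case (Suc k)
  show ?case by (rule C_k_SucI[where f' = "\<lambda>x v. 0"]) (auto intro: Suc)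
qed auto

lemma C_k_add: "C_k k f \<Longrightarrow> C_k k g \<Longrightarrow> C_k k (\<lambda>x. f x + g x)"
proof (induction k arbitrary: f g)
  case (Suc k)
  show ?case
    by (rule C_k_SucI[OF has_derivative_add[OF C_k_SucD(1)[OF Suc.prems(1)] C_k_SucD(1)[OF Suc.prems(2)]]])
       (intro Suc.IH C_k_SucD(2) Suc.prems)
qed (simp add: continuous_on_add)

lemma C_k_mult: "C_k k f \<Longrightarrow> C_k k g \<Longrightarrow> C_k k (\<lambda>x. f x * g x)"
proof (induction k arbitrary: f g)
  case (Suc k)
  show ?case
    by (rule C_k_SucI[OF has_derivative_mult[OF C_k_SucD(1)[OF Suc.prems(1)] C_k_SucD(1)[OF Suc.prems(2)]]])
       (intro Suc.IH C_k_add C_k_SucD(2) Suc.prems C_k_Suc_imp)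
qed (simp add: continuous_on_mult)

lemma C_k_shift: "C_k k f \<Longrightarrow> C_k k (\<lambda>x. f (x + a))"
proof (induction k arbitrary: f)
  case 0
  then show ?case by (auto intro!: continuous_on_compose2[of UNIV f] continuous_intros)
next
  case (Suc k)
  show ?case
  proof (rule C_k_SucI)
    show "((\<lambda>x. f (x + a)) has_derivative frechet_derivative f (at (x + a))) (at x)" for x
      by (rule has_derivative_compose[OF _ C_k_SucD(1)[OF Suc.prems], of "\<lambda>x. x + a" "\<lambda>v. v"])
         (auto intro!: derivative_eq_intros)
    show "C_k k (\<lambda>x. frechet_derivative f (at (x + a)) v)" for v
      using Suc.IH[OF C_k_SucD(2)[OF Suc.prems, of v]] .
  qed
qed

lemma C_k_inner: "C_k k (\<lambda>x. complex_of_real (x \<bullet> v))"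
proof (cases k)
  case (Suc j)
  show ?thesis unfolding Suc
    by (rule C_k_SucI[where f' = "\<lambda>x w. complex_of_real (w \<bullet> v)"])
       (auto intro!: derivative_eq_intros C_k_const)
qed (auto intro!: continuous_intros)

lemma C_k_exp_ii: "C_k k (\<lambda>x. exp (\<i> * complex_of_real (\<eta> \<bullet> x)))"
proof (induction k)
  case (Suc k)
  show ?case
  proof (rule C_k_SucI)
    show "((\<lambda>x. exp (\<i> * complex_of_real (\<eta> \<bullet> x))) has_derivative
       (\<lambda>v. (\<i> * complex_of_real (\<eta> \<bullet> v)) * exp (\<i> * complex_of_real (\<eta> \<bullet> x)))) (at x)" for x
    proof -
      have "((\<lambda>x. \<i> * complex_of_real (\<eta> \<bullet> x)) has_derivative (\<lambda>v. \<i> * complex_of_real (\<eta> \<bullet> v))) (at x)"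
        by (auto intro!: derivative_eq_intros)
      moreover have "(exp has_derivative (*) (exp z)) (at z)" for z :: complex
        using DERIV_exp[of z] by (simp add: has_field_derivative_def)
      ultimately have "((\<lambda>x. exp (\<i> * complex_of_real (\<eta> \<bullet> x))) has_derivative
         (\<lambda>v. exp (\<i> * complex_of_real (\<eta> \<bullet> x)) * (\<i> * complex_of_real (\<eta> \<bullet> v)))) (at x)"
        by (rule has_derivative_compose)
      then show ?thesis by (simp only: mult.commute)
    qed
    show "C_k k (\<lambda>x. (\<i> * complex_of_real (\<eta> \<bullet> v)) * exp (\<i> * complex_of_real (\<eta> \<bullet> x)))" for v
      by (intro C_k_mult C_k_const Suc)
  qed
qed (auto intro!: continuous_intros)

text \<open>The functions \<open>t \<mapsto> t^(-k) exp (-1/t)\<close>, extended by zero, are closed under differentiation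
  up to linear combinations; this makes the standard bump function smooth.\<close>

definition flat :: "nat \<Rightarrow> real \<Rightarrow> real" where
  "flat k t = (if 0 < t then exp (- inverse t) * inverse t ^ k else 0)"

lemma flat_tendsto_0: "(flat k \<longlongrightarrow> 0) (at_right 0)"
proof -
  have "((\<lambda>t. inverse t ^ k / exp (inverse t)) \<longlongrightarrow> 0) (at_right (0::real))"
    by (rule filterlim_compose[OF tendsto_power_div_exp_0 filterlim_inverse_at_top_right])
  then show ?thesis
    by (rule Lim_transform_eventually)
       (auto simp: flat_def eventually_at_filter exp_minus field_simps)
qed

lemma flat_has_derivative:
  "(flat k has_real_derivative flat (k + 2) t - real k * flat (k + 1) t) (at t)"
proof (rule linorder_cases[of t 0])
  assume t: "t < 0"
  have "((\<lambda>_. 0) has_real_derivative 0) (at t)" by simp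
  then have "(flat k has_real_derivative 0) (at t)"
    by (rule has_field_derivative_transform_within_open[of _ _ _ "{..<0}"]) (use t in \<open>auto simp: flat_def\<close>)
  then show ?thesis using t by (simp add: flat_def)
next
  assume t: "0 < t"
  have "((\<lambda>t. exp (- inverse t) * inverse t ^ k) has_real_derivative
     (exp (- inverse t) * inverse t ^ (k + 2) - real k * (exp (- inverse t) * inverse t ^ (k + 1)))) (at t)"
  proof -
    have "k * inverse t ^ (k - Suc 0) * inverse t = k * inverse t ^ k" by (cases k) auto
    then show ?thesis using t
      by (auto intro!: derivative_eq_intros simp: power_add power2_eq_square algebra_simps)
  qed
  then have "(flat k has_real_derivative
     (exp (- inverse t) * inverse t ^ (k + 2) - real k * (exp (- inverse t) * inverse t ^ (k + 1)))) (at t)"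
    by (rule has_field_derivative_transform_within_open[of _ _ _ "{0<..}"]) (use t in \<open>auto simp: flat_def\<close>)
  then show ?thesis using t by (simp add: flat_def)
next
  assume [simp]: "t = 0"
  \<comment> \<open>To the right of 0 the difference quotient at 0 is the next function
    \<open>flat (Suc k)\<close>; to the left it vanishes.\<close>
  have "((\<lambda>h. (flat k h - flat k 0) / (h - 0)) \<longlongrightarrow> 0) (at_right 0)"
    by (rule Lim_transform_eventually[OF flat_tendsto_0[of "Suc k"]])
       (auto simp: flat_def eventually_at_filter field_simps)
  moreover have "((\<lambda>h. (flat k h - flat k 0) / (h - 0)) \<longlongrightarrow> 0) (at_left 0)"
    by (rule Lim_transform_eventually[OF tendsto_const]) (auto simp: flat_def eventually_at_filter)
  ultimately have "(flat k has_real_derivative 0) (at 0)"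
    unfolding has_field_derivative_iff by (simp add: filterlim_at_split)
  then show ?thesis by (simp add: flat_def)
qed

text \<open>The induction runs over all \<open>j\<close> at once, because differentiation replaces
  \<open>flat j\<close> by a combination of \<open>flat (j + 1)\<close> and
  \<open>flat (j + 2)\<close>.\<close>

lemma C_k_flat:
  "C_k k (\<lambda>x. complex_of_real (flat j (1 - c * (x \<bullet> x))))"
proof (induction k arbitrary: j)
  case 0
  have "continuous_on UNIV (flat j)"
    by (intro continuous_at_imp_continuous_on ballI DERIV_isCont[OF flat_has_derivative])
  then show ?case
    by (auto intro!: continuous_intros continuous_on_compose2[of UNIV "flat j"])
next
  case (Suc k)
  let ?f' = "\<lambda>t. flat (j + 2) t - real j * flat (j + 1) t"
  let ?r = "\<lambda>x::real^3. 1 - c * (x \<bullet> x)"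
  show ?case
  proof (rule C_k_SucI)
    show "((\<lambda>x. complex_of_real (flat j (?r x))) has_derivative
       (\<lambda>v. (complex_of_real (flat (j + 2) (?r x)) + complex_of_real (- real j) * complex_of_real (flat (j + 1) (?r x)))
         * (complex_of_real (- 2 * c) * complex_of_real (x \<bullet> v)))) (at x)" for x
    proof -
      have 1: "(?r has_derivative (\<lambda>v. - 2 * c * (x \<bullet> v))) (at x)"
        by (auto intro!: derivative_eq_intros simp: inner_commute algebra_simps)
      have 2: "(flat j has_derivative (*) (?f' (?r x))) (at (?r x))"
        using flat_has_derivative[of j "?r x"] by (simp add: has_field_derivative_def)
      have "((\<lambda>x. complex_of_real (flat j (?r x))) has_derivative (\<lambda>v. complex_of_real (?f' (?r x) * (- 2 * c * (x \<bullet> v))))) (at x)"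
        by (rule has_derivative_of_real[OF has_derivative_compose[OF 1 2]])
      then show ?thesis by (simp add: algebra_simps)
    qed
    show "C_k k (\<lambda>x. (complex_of_real (flat (j + 2) (?r x)) + complex_of_real (- real j) * complex_of_real (flat (j + 1) (?r x)))
         * (complex_of_real (- 2 * c) * complex_of_real (x \<bullet> v)))" for v
      by (intro C_k_mult C_k_add C_k_const Suc C_k_inner)
  qed
qed

text \<open>The standard bump function rescaled to the ball of radius \<open>n + 1\<close>; the
  factor \<open>exp 1\<close> normalises its value at the origin to 1, so that the cutoffs tend to 1
  everywhere.\<close>

definition cutoff :: "nat \<Rightarrow> real^3 \<Rightarrow> real" where
  "cutoff n x = exp 1 * flat 0 (1 - (1 / (real n + 1)\<^sup>2) * (x \<bullet> x))"

lemma cutoff_bounds: "0 \<le> cutoff n x" "cutoff n x \<le> 1" "\<bar>cutoff n x\<bar> \<le> 1"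
proof -
  show 0: "0 \<le> cutoff n x" by (simp add: cutoff_def flat_def)
  have "flat 0 t \<le> exp (- 1)" if "t \<le> 1" for t
    using that by (auto simp: flat_def one_le_inverse)
  then have "flat 0 (1 - (1 / (real n + 1)\<^sup>2) * (x \<bullet> x)) \<le> exp (- 1)" by simp
  then have "cutoff n x \<le> exp 1 * exp (- 1)" unfolding cutoff_def by (intro mult_left_mono) auto
  then show "cutoff n x \<le> 1" by (simp add: exp_minus)
  then show "\<bar>cutoff n x\<bar> \<le> 1" using 0 by simp
qed

lemma isCont_flat: "isCont (flat k) t"
  by (rule DERIV_isCont[OF flat_has_derivative])

lemma cutoff_continuous: "continuous_on S (cutoff n)"
proof -
  have "continuous_on UNIV (flat 0)" by (simp add: continuous_at_imp_continuous_on isCont_flat)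
  then have "continuous_on S (\<lambda>x. flat 0 (1 - (1 / (real n + 1)\<^sup>2) * (x \<bullet> x)))"
    by (rule continuous_on_compose2) (auto intro!: continuous_intros)
  then show ?thesis unfolding cutoff_def[abs_def] by (rule continuous_on_mult_left)
qed

lemma cutoff_measurable [measurable]: "cutoff n \<in> borel_measurable borel"
  by (rule borel_measurable_continuous_onI[OF cutoff_continuous])

lemma cutoff_tendsto: "(\<lambda>n. cutoff n x) \<longlonglongrightarrow> 1"
proof -
  have "(\<lambda>n. 1 / (real n + 1)\<^sup>2) \<longlonglongrightarrow> 0"
    by real_asymp
  then have "(\<lambda>n. 1 - (1 / (real n + 1)\<^sup>2) * (x \<bullet> x)) \<longlonglongrightarrow> 1 - 0 * (x \<bullet> x)"
    by (rule tendsto_diff[OF tendsto_const tendsto_mult[OF _ tendsto_const]])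
  then have "(\<lambda>n. cutoff n x) \<longlonglongrightarrow> exp 1 * flat 0 (1 - 0 * (x \<bullet> x))"
    unfolding cutoff_def by (intro tendsto_mult tendsto_const isCont_tendsto_compose[OF isCont_flat])
  then show ?thesis by (simp add: flat_def exp_minus)
qed

lemma cutoff_support: "cutoff n x \<noteq> 0 \<Longrightarrow> norm x \<le> real n + 1"
proof (rule ccontr)
  assume *: "cutoff n x \<noteq> 0" "\<not> norm x \<le> real n + 1"
  then have "(real n + 1)\<^sup>2 \<le> (norm x)\<^sup>2" by (intro power_mono) auto
  moreover have "0 < (real n + 1)\<^sup>2" by (intro zero_less_power) simp
  ultimately have "1 \<le> (1 / (real n + 1)\<^sup>2) * (x \<bullet> x)"
    by (simp add: dot_square_norm)
  then have "cutoff n x = 0" by (simp add: cutoff_def flat_def)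
  then show False using * by simp
qed

text \<open>A truncation thus controls the function itself on half the radius. There the argument of
  \<open>flat\<close> is at least \<open>3/4\<close>, and
  \<open>exp 1 * exp (- (4/3)) = exp (- (1/3)) \<ge> 2/3\<close>.\<close>

lemma cutoff_lower:
  assumes "norm x \<le> (real n + 1) / 2" shows "1 / 2 \<le> cutoff n x"
proof -
  have "(norm x)\<^sup>2 \<le> ((real n + 1) / 2)\<^sup>2" using assms by (intro power_mono) auto
  then have "(1 / (real n + 1)\<^sup>2) * (x \<bullet> x) \<le> (1 / (real n + 1)\<^sup>2) * ((real n + 1) / 2)\<^sup>2"
    unfolding dot_square_norm by (intro mult_left_mono) auto
  also have "\<dots> = 1 / 4" by (simp add: power_divide)
  finally have t: "3 / 4 \<le> 1 - (1 / (real n + 1)\<^sup>2) * (x \<bullet> x)" (is "_ \<le> ?t") by simp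
  then have "inverse ?t \<le> inverse (3/4)" by (intro le_imp_inverse_le) auto
  moreover have "0 < ?t" using t by linarith
  ultimately have "exp (- (4/3)) \<le> flat 0 ?t" by (simp only: flat_def if_True exp_le_cancel_iff) simp
  then have "exp 1 * exp (- (4/3)) \<le> cutoff n x" unfolding cutoff_def by (intro mult_left_mono) auto
  then have "exp (- (1/3)) \<le> cutoff n x" by (simp add: mult_exp_exp)
  then show ?thesis using exp_ge_add_one_self[of "- (1/3)"] by linarith
qed

lemma flat_Lipschitz: "\<bar>flat 0 a - flat 0 b\<bar> \<le> 2 * \<bar>a - b\<bar>"
proof -
  have "norm (flat 0 a - flat 0 b) \<le> 2 * norm (a - b)"
  proof (rule field_differentiable_bound[of UNIV])
    show "(flat 0 has_field_derivative flat 2 t) (at t within UNIV)" for t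
      using flat_has_derivative[of 0 t] by (simp add: numeral_2_eq_2)
    show "norm (flat 2 t) \<le> 2" for t
    proof (cases "0 < t")
      case True
      \<comment> \<open>The derivative of \<open>flat 0\<close> is \<open>flat 2\<close>; the
        quadratic Taylor bound for the exponential at \<open>1/t\<close> shows that it never exceeds
        2.\<close>
      have "1 + inverse t + (inverse t)\<^sup>2 / 2 \<le> exp (inverse t)"
        using True by (intro exp_lower_Taylor_quadratic) simp
      then have "(inverse t)\<^sup>2 \<le> 2 * exp (inverse t)" using True by (smt (verit) field_sum_of_halves inverse_nonnegative_iff_nonnegative)
      then show ?thesis using True by (simp add: flat_def exp_minus field_simps abs_mult)
    qed (simp add: flat_def)
  qed auto
  then show ?thesis by simp
qed

text \<open>The constant is uniform in \<open>n\<close> because a point enters only through its norm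
  divided by \<open>n + 1\<close>. Since \<open>1 - a^2\<close> is not globally Lipschitz, it is
  replaced by \<open>max 0 (1 - a^2)\<close>, which has constant 2 for nonnegative \<open>a\<close>
  and the same image under \<open>flat 0\<close>. With the constant 2 of \<open>flat\<close> and the
  factor \<open>exp 1\<close> this gives \<open>4 * exp 1\<close>; the minimum with 1 uses that the
  values lie between 0 and 1.\<close>

lemma cutoff_Lipschitz: "(cutoff n x - cutoff n y)\<^sup>2 \<le> (4 * exp 1)\<^sup>2 * min 1 ((norm (x - y))\<^sup>2)"
proof -
  define a b where "a = norm x / (real n + 1)" and "b = norm y / (real n + 1)"
  have ab: "0 \<le> a" "0 \<le> b" by (auto simp: a_def b_def)
  have flat_max: "flat 0 t = flat 0 (max 0 t)" for t by (auto simp: flat_def)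
  have c: "cutoff n x = exp 1 * flat 0 (max 0 (1 - a\<^sup>2))" "cutoff n y = exp 1 * flat 0 (max 0 (1 - b\<^sup>2))"
    unfolding cutoff_def flat_max[symmetric] a_def b_def by (simp_all add: dot_square_norm power_divide)
  have sq: "\<bar>max 0 (1 - a\<^sup>2) - max 0 (1 - b\<^sup>2)\<bar> \<le> 2 * (b - a)" if "a \<le> b" "0 \<le> a" for a b :: real
  proof (cases "b \<le> 1")
    case True
    then have "a\<^sup>2 \<le> 1" "b\<^sup>2 \<le> 1" using that by (auto simp: power_le_one)
    moreover have "a\<^sup>2 \<le> b\<^sup>2" using that by (intro power_mono)
    moreover have "b\<^sup>2 - a\<^sup>2 \<le> 2 * (b - a)"
    proof -
      have "b\<^sup>2 - a\<^sup>2 = (b + a) * (b - a)" by (simp add: power2_eq_square algebra_simps)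
      also have "\<dots> \<le> 2 * (b - a)" using that True by (intro mult_right_mono) auto
      finally show ?thesis .
    qed
    ultimately show ?thesis by (simp add: abs_if)
  next
    case False
    then have b: "1 - b\<^sup>2 \<le> 0" by simp
    show ?thesis
    proof (cases "a \<le> 1")
      case True
      then have "a\<^sup>2 \<le> 1" using that by (simp add: power_le_one)
      moreover have "1 - a\<^sup>2 \<le> 2 * (1 - a)"
        using zero_le_power2[of "1 - a"] by (simp add: power2_eq_square algebra_simps)
      ultimately show ?thesis using b False by (simp add: abs_if)
    next
      case False
      then have "1 - a\<^sup>2 \<le> 0" by simp
      then show ?thesis using b that by simp
    qed
  qed
  have "\<bar>max 0 (1 - a\<^sup>2) - max 0 (1 - b\<^sup>2)\<bar> \<le> 2 * \<bar>a - b\<bar>"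
  proof (cases "a \<le> b")
    case True
    then show ?thesis using sq[OF True ab(1)] by simp
  next
    case False
    then show ?thesis using sq[of b a] ab(2) by (simp add: abs_minus_commute)
  qed
  also have "\<dots> \<le> 2 * norm (x - y)"
  proof -
    have "\<bar>a - b\<bar> = \<bar>norm x - norm y\<bar> / (real n + 1)" unfolding a_def b_def by (simp flip: diff_divide_distrib)
    also have "\<dots> \<le> \<bar>norm x - norm y\<bar> / 1" by (intro divide_left_mono) auto
    also have "\<dots> \<le> norm (x - y)" by (simp add: norm_triangle_ineq3)
    finally show ?thesis by simp
  qed
  finally have "\<bar>flat 0 (max 0 (1 - a\<^sup>2)) - flat 0 (max 0 (1 - b\<^sup>2))\<bar> \<le> 4 * norm (x - y)"
    using flat_Lipschitz[of "max 0 (1 - a\<^sup>2)" "max 0 (1 - b\<^sup>2)"] by linarith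
  then have "exp 1 * \<bar>flat 0 (max 0 (1 - a\<^sup>2)) - flat 0 (max 0 (1 - b\<^sup>2))\<bar> \<le> exp 1 * (4 * norm (x - y))"
    by (intro mult_left_mono) auto
  then have "\<bar>cutoff n x - cutoff n y\<bar> \<le> 4 * exp 1 * norm (x - y)"
    unfolding c right_diff_distrib[symmetric] abs_mult by (simp add: mult_ac)
  then have "\<bar>cutoff n x - cutoff n y\<bar>\<^sup>2 \<le> (4 * exp 1 * norm (x - y))\<^sup>2" by (rule power_mono) simp
  then have 1: "(cutoff n x - cutoff n y)\<^sup>2 \<le> (4 * exp 1)\<^sup>2 * (norm (x - y))\<^sup>2" by (simp add: power_mult_distrib)
  have "\<bar>cutoff n x - cutoff n y\<bar> \<le> 1" using cutoff_bounds[of n x] cutoff_bounds[of n y] by linarith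
  then have "(cutoff n x - cutoff n y)\<^sup>2 \<le> 1" by (simp add: abs_square_le_1)
  also have "1 \<le> (4 * exp 1 :: real)\<^sup>2" using exp_ge_add_one_self[of 1] by (intro one_le_power) linarith
  finally show ?thesis using 1 by (simp add: min_def)
qed

lemma test_function_measurable: "\<phi> \<in> test_functions \<Longrightarrow> \<phi> \<in> borel_measurable borel"
proof -
  assume "\<phi> \<in> test_functions"
  then have "C_k 0 \<phi>" unfolding test_functions_def by blast
  then show ?thesis by (intro borel_measurable_continuous_onI) simp
qed

lemma test_functionI:
  assumes "\<And>k. C_k k \<phi>" "\<And>x. \<phi> x \<noteq> 0 \<Longrightarrow> x \<in> S" "compact S"
  shows "\<phi> \<in> test_functions"
proof -
  have "closure {x. \<phi> x \<noteq> 0} \<subseteq> S" using assms by (intro closure_minimal compact_imp_closed) auto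
  then have "compact (closure {x. \<phi> x \<noteq> 0})"
    using assms(3) by (meson closed_closure compact_Int_closed compact_closure bounded_subset compact_imp_bounded closure_subset order_trans)
  then show ?thesis using assms(1) by (simp add: test_functions_def)
qed

lemma test_functionD:
  assumes "\<phi> \<in> test_functions" shows "C_k k \<phi>" "compact (closure {x. \<phi> x \<noteq> 0})" "\<phi> x \<noteq> 0 \<Longrightarrow> x \<in> closure {x. \<phi> x \<noteq> 0}"
  using assms subsetD[OF closure_subset[of "{x. \<phi> x \<noteq> 0}"], of x] by (simp_all add: test_functions_def)

lemma test_function_add:
  assumes "\<phi> \<in> test_functions" "\<psi> \<in> test_functions" shows "(\<lambda>x. \<phi> x + \<psi> x) \<in> test_functions"
proof (rule test_functionI)
  show "x \<in> closure {x. \<phi> x \<noteq> 0} \<union> closure {x. \<psi> x \<noteq> 0}" if "\<phi> x + \<psi> x \<noteq> 0" for x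
    using that test_functionD(3)[OF assms(1), of x] test_functionD(3)[OF assms(2), of x] by (cases "\<phi> x = 0") auto
  show "C_k k (\<lambda>x. \<phi> x + \<psi> x)" for k by (intro C_k_add test_functionD(1) assms)
  show "compact (closure {x. \<phi> x \<noteq> 0} \<union> closure {x. \<psi> x \<noteq> 0})"
    by (intro compact_Un test_functionD(2) assms)
qed

lemma test_function_mult:
  assumes "\<phi> \<in> test_functions" "\<And>k. C_k k \<psi>" shows "(\<lambda>x. \<psi> x * \<phi> x) \<in> test_functions"
proof (rule test_functionI)
  show "x \<in> closure {x. \<phi> x \<noteq> 0}" if "\<psi> x * \<phi> x \<noteq> 0" for x
    using that test_functionD(3)[OF assms(1), of x] by auto
  show "C_k k (\<lambda>x. \<psi> x * \<phi> x)" for k by (intro C_k_mult test_functionD(1) assms)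
qed (rule test_functionD(2)[OF assms(1)])

lemma test_function_shift:
  assumes "\<phi> \<in> test_functions" shows "(\<lambda>x. \<phi> (x + a)) \<in> test_functions"
proof (rule test_functionI)
  show "x \<in> (\<lambda>y. y - a) ` closure {x. \<phi> x \<noteq> 0}" if "\<phi> (x + a) \<noteq> 0" for x
    using test_functionD(3)[OF assms that] by (auto intro: image_eqI[of _ _ "x + a"])
  show "C_k k (\<lambda>x. \<phi> (x + a))" for k by (intro C_k_shift test_functionD(1) assms)
  show "compact ((\<lambda>y. y - a) ` closure {x. \<phi> x \<noteq> 0})"
    by (intro compact_continuous_image test_functionD(2) assms continuous_intros)
qed

lemma C_k_cutoff: "C_k k (\<lambda>x. complex_of_real (cutoff n x))"
  unfolding cutoff_def of_real_mult by (intro C_k_mult C_k_const C_k_flat)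

lemma cutoff_test_function: "(\<lambda>x. complex_of_real (cutoff n x)) \<in> test_functions"
  by (rule test_functionI[of _ "cball 0 (real n + 1)"]) (auto simp: C_k_cutoff cutoff_support)

section \<open>The space of Borel representatives\<close>

text \<open>A class wide enough for the limits in assumption \<A>: they arise as pointwise limits of
  continuous maps, and pointwise convergence does not hand continuity on to them.\<close>

definition locally_bounded_potential :: "(real^3 \<Rightarrow> real^3) \<Rightarrow> bool" where
  "locally_bounded_potential A \<longleftrightarrow> A \<in> borel_measurable borel \<and> (\<forall>R. \<exists>C. \<forall>x\<in>cball 0 R. norm (A x) \<le> C)"

lemma locally_bounded_potentialD:
  assumes "locally_bounded_potential A"
  shows "A \<in> borel_measurable borel" "\<exists>C. \<forall>x\<in>cball 0 R. norm (A x) \<le> C"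
  using assms by (auto simp: locally_bounded_potential_def)

lemma locally_bounded_potential_diff:
  assumes "locally_bounded_potential A" "locally_bounded_potential A'"
  obtains C where "\<And>x. x \<in> cball 0 R \<Longrightarrow> norm (A x - A' x) \<le> C"
proof -
  obtain C C' where "\<And>x. x \<in> cball 0 R \<Longrightarrow> norm (A x) \<le> C" "\<And>x. x \<in> cball 0 R \<Longrightarrow> norm (A' x) \<le> C'"
    using assms[THEN locally_bounded_potentialD(2), of R] by blast
  then have "\<And>x. x \<in> cball 0 R \<Longrightarrow> norm (A x - A' x) \<le> C + C'"
    by (meson add_mono norm_triangle_ineq4 order_trans)
  then show thesis by (rule that)
qed

lemma locally_bounded_potential_continuous:
  assumes "continuous_on UNIV A" shows "locally_bounded_potential A"
  unfolding locally_bounded_potential_def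
proof (intro conjI allI)
  fix R
  have "compact (A ` cball 0 R)"
    by (intro compact_continuous_image continuous_on_subset[OF assms]) auto
  then show "\<exists>C. \<forall>x\<in>cball 0 R. norm (A x) \<le> C"
    unfolding bounded_iff[symmetric] by (auto dest!: compact_imp_bounded simp: bounded_iff)
qed (use assms in \<open>rule borel_measurable_continuous_onI\<close>)

lemma locally_bounded_potential_0: "locally_bounded_potential (\<lambda>x. 0)"
  by (rule locally_bounded_potential_continuous) simp

context fractional_order
begin

text \<open>For the zero potential the Lipschitz bound gives a kernel bound wherever one of the two
  points lies in the support; hence the two symmetric terms \<open>?k\<close> and
  \<open>?k'\<close>. The compact support then allows a change to any locally bounded
  potential.\<close>

lemma cutoff_HA:
  assumes "locally_bounded_potential A"
  shows "(\<lambda>x. complex_of_real (cutoff n x)) \<in> HA A"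
proof -
  define f where "f = (\<lambda>x. complex_of_real (cutoff n x))"
  define g where "g = (\<lambda>x :: real^3. complex_of_real (indicator (cball 0 (real n + 1)) x) :: complex)"
  have fm[measurable]: "f \<in> borel_measurable borel" unfolding f_def by measurable
  have gsq: "(cmod (g x))\<^sup>2 = indicator (cball 0 (real n + 1)) x" for x
    by (auto simp: g_def indicator_def)
  have gm: "g \<in> borel_measurable borel"
  proof -
    have [measurable]: "(indicator (cball 0 (real n + 1)) :: real^3 \<Rightarrow> real) \<in> borel_measurable borel"
      by (intro borel_measurable_indicator borel_closed closed_cball)
    show ?thesis unfolding g_def by measurable
  qed
  have "integrable lborel (\<lambda>x :: real^3. indicator (cball 0 (real n + 1)) x :: real)"
    using emeasure_lborel_cball_finite[of "0 :: real^3" "real n + 1"]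
    by (intro integrable_real_indicator) auto
  then have g: "square_integrable lborel g"
    unfolding square_integrable_def gsq using gm by simp
  have f0: "f x \<noteq> 0 \<Longrightarrow> norm x \<le> real n + 1" for x
    using cutoff_support[of n x] by (auto simp: f_def)
  have f1: "(cmod (f x))\<^sup>2 \<le> (cmod (g x))\<^sup>2" for x
  proof (cases "f x = 0")
    case False
    then have "(cmod (g x))\<^sup>2 = 1" using f0 unfolding gsq by (simp add: indicator_def)
    moreover have "cmod (f x) \<le> 1" using cutoff_bounds[of n x] by (simp add: f_def)
    ultimately show ?thesis by (simp add: power_le_one)
  qed simp
  have f2: "square_integrable lborel f"
    by (rule square_integrable_bound[OF _ square_integrableD(2)[OF g]]) (auto simp: f1)
  let ?k = "\<lambda>z. (cmod (g (fst z)))\<^sup>2 * \<kappa> (fst z - snd z)"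
  let ?k' = "\<lambda>z. (cmod (g (snd z)))\<^sup>2 * \<kappa> (snd z - fst z)"
  have k: "integrable lborel ?k" by (rule kernel_fubini(1)[OF g])
  have "integrable (lborel \<Otimes>\<^sub>M lborel) (\<lambda>(x, y). ?k (y, x))"
    by (rule lborel_pair.integrable_product_swap) (use k in \<open>simp add: lborel_prod\<close>)
  then have k': "integrable lborel ?k'"
    by (simp add: lborel_prod case_prod_beta')
  have "square_integrable lborel (D (\<lambda>x. 0) f)"
  proof (rule square_integrable_bound)
    show "integrable lborel (\<lambda>z. (4 * exp 1)\<^sup>2 * (?k z + ?k' z))" using k k' by simp
    show "AE z in lborel. (cmod (D (\<lambda>x. 0) f z))\<^sup>2 \<le> (4 * exp 1)\<^sup>2 * (?k z + ?k' z)"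
    proof (intro AE_I2)
      fix z :: "(real^3) \<times> (real^3)"
      have sym: "\<kappa> (snd z - fst z) = \<kappa> (fst z - snd z)" by (simp add: singular_kernel_def norm_minus_commute)
      have kk: "?k z + ?k' z = ((cmod (g (fst z)))\<^sup>2 + (cmod (g (snd z)))\<^sup>2) * \<kappa> (fst z - snd z)"
        unfolding sym by (simp add: algebra_simps)
      show "(cmod (D (\<lambda>x. 0) f z))\<^sup>2 \<le> (4 * exp 1)\<^sup>2 * (?k z + ?k' z)"
      proof (cases "f (fst z) = 0 \<and> f (snd z) = 0")
        case True
        then show ?thesis unfolding kk by (simp add: magnetic_quotient_def kernel_nonneg)
      next
        case False
        then have 1: "1 \<le> (cmod (g (fst z)))\<^sup>2 + (cmod (g (snd z)))\<^sup>2"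
          using f0[of "fst z"] f0[of "snd z"] unfolding gsq by (auto simp: indicator_def)
        have "(cmod (D (\<lambda>x. 0) f z))\<^sup>2 = (cutoff n (fst z) - cutoff n (snd z))\<^sup>2 / norm (fst z - snd z) powr (3 + 2 * s)"
          unfolding cmod_quotient_squared f_def by (simp flip: of_real_diff)
        also have "\<dots> \<le> ((4 * exp 1)\<^sup>2 * min 1 ((norm (fst z - snd z))\<^sup>2)) / norm (fst z - snd z) powr (3 + 2 * s)"
          by (rule divide_right_mono[OF cutoff_Lipschitz]) simp
        also have "\<dots> = (4 * exp 1)\<^sup>2 * (1 * \<kappa> (fst z - snd z))" by (simp add: singular_kernel_def)
        also have "\<dots> \<le> (4 * exp 1)\<^sup>2 * (?k z + ?k' z)"
          unfolding kk using 1 by (intro mult_left_mono mult_right_mono kernel_nonneg) auto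
        finally show ?thesis .
      qed
    qed
  qed (use quotient_measurable[of "\<lambda>x. 0" f] in simp)
  then have f: "f \<in> HA (\<lambda>x. 0)" using f2 by (simp add: HA_def)
  obtain C where C: "\<And>x. x \<in> cball 0 (real n + 1 + 1) \<Longrightarrow> norm (A x - 0) \<le> C"
    using locally_bounded_potential_diff[OF assms locally_bounded_potential_0] by blast
  have "f \<in> HA A"
    by (rule HA_change_potential(1)[OF f locally_bounded_potentialD(1)[OF assms] f0 C])
  then show ?thesis unfolding f_def .
qed

text \<open>Borel representatives of the elements of \<open>HsA s A\<close>.\<close>

definition H :: "(real^3 \<Rightarrow> real^3) \<Rightarrow> (real^3 \<Rightarrow> complex) set" where
  "H A = {u \<in> HA A. \<forall>\<epsilon>>0. \<exists>\<phi>\<in>test_functions. \<phi> \<in> HA A \<and> Q A (\<lambda>x. u x - \<phi> x) < \<epsilon>}"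

lemma H_HA: "u \<in> H A \<Longrightarrow> u \<in> HA A"
  by (simp add: H_def)

lemma HsA_iff_H:
  assumes A: "A \<in> borel_measurable borel" and u: "u \<in> borel_measurable borel"
  shows "u \<in> HsA s A \<longleftrightarrow> u \<in> H A"
proof -
  have um: "u \<in> borel_measurable lebesgue"
    using u by (simp add: measurable_completion)
  have "u \<in> magnetic_space s A \<longleftrightarrow> u \<in> HA A"
    unfolding magnetic_space_def using um HA_iff[OF A u] by simp
  moreover have "(\<forall>\<epsilon>>0. \<exists>\<phi>\<in>test_functions. magnetic_norm_sq s A (\<lambda>x. u x - \<phi> x) < ennreal (\<epsilon>\<^sup>2))
    \<longleftrightarrow> (\<forall>\<epsilon>>0. \<exists>\<phi>\<in>test_functions. \<phi> \<in> HA A \<and> Q A (\<lambda>x. u x - \<phi> x) < \<epsilon>)" (is "?L \<longleftrightarrow> ?R") if uA: "u \<in> HA A"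
  proof -
    have eq: "magnetic_norm_sq s A (\<lambda>x. u x - \<phi> x) < ennreal r \<longleftrightarrow> \<phi> \<in> HA A \<and> Q A (\<lambda>x. u x - \<phi> x) < r"
      if \<phi>: "\<phi> \<in> test_functions" for \<phi> r
    proof -
      have [measurable]: "\<phi> \<in> borel_measurable borel" by (rule test_function_measurable[OF \<phi>])
      have m: "(\<lambda>x. u x - \<phi> x) \<in> borel_measurable borel" using u by measurable
      have "\<phi> \<in> HA A \<longleftrightarrow> (\<lambda>x. u x - \<phi> x) \<in> HA A"
        using HA_diff[OF uA, of \<phi>] HA_diff[OF uA, of "\<lambda>x. u x - \<phi> x"] by auto
      moreover have "magnetic_norm_sq s A (\<lambda>x. u x - \<phi> x) < ennreal r \<Longrightarrow> (\<lambda>x. u x - \<phi> x) \<in> HA A"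
        unfolding HA_iff[OF A m] by (auto intro: less_le_trans)
      moreover have "(\<lambda>x. u x - \<phi> x) \<in> HA A \<Longrightarrow>
         magnetic_norm_sq s A (\<lambda>x. u x - \<phi> x) < ennreal r \<longleftrightarrow> Q A (\<lambda>x. u x - \<phi> x) < r"
        by (simp add: magnetic_norm_sq_HA[OF _ A] ennreal_less_iff Q_nonneg)
      ultimately show ?thesis by blast
    qed
    show ?thesis
    proof
      assume L: ?L
      show ?R
      proof (intro allI impI)
        fix e :: real assume "0 < e"
        then have "sqrt e > 0" "(sqrt e)\<^sup>2 = e" by auto
        then show "\<exists>\<phi>\<in>test_functions. \<phi> \<in> HA A \<and> Q A (\<lambda>x. u x - \<phi> x) < e"
          using L eq by metis
      qed
    next
      assume R: ?R
      show ?L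
      proof (intro allI impI)
        fix e :: real assume "0 < e"
        then have "e\<^sup>2 > 0" by simp
        then show "\<exists>\<phi>\<in>test_functions. magnetic_norm_sq s A (\<lambda>x. u x - \<phi> x) < ennreal (e\<^sup>2)"
          using R eq by metis
      qed
    qed
  qed
  ultimately show ?thesis unfolding HsA_def H_def by blast
qed

lemma HsA_cong_AE:
  assumes "u \<in> HsA s A" "AE x in lborel. u x = v x" "v \<in> borel_measurable borel"
  shows "v \<in> HsA s A"
proof -
  have "v \<in> borel_measurable lebesgue" using assms(3) by (simp add: measurable_completion)
  moreover have "magnetic_norm_sq s A v = magnetic_norm_sq s A u"
    by (rule magnetic_norm_sq_cong_AE) (use assms(2) in auto)
  moreover have "magnetic_norm_sq s A (\<lambda>x. v x - \<phi> x) = magnetic_norm_sq s A (\<lambda>x. u x - \<phi> x)" for \<phi>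
    by (rule magnetic_norm_sq_cong_AE) (use assms(2) in auto)
  ultimately show ?thesis using assms(1) unfolding HsA_def magnetic_space_def by simp
qed

lemma Q_add_le:
  assumes "u \<in> HA A" "v \<in> HA A"
  shows "Q A (\<lambda>x. u x + v x) \<le> 2 * Q A u + 2 * Q A v"
  using Q_diff_le[OF assms(1) HA_cmult[OF assms(2), of "-1"]] by (simp only: Q_cmult) simp

lemma H_cmult: assumes "u \<in> H A" shows "(\<lambda>x. c * u x) \<in> H A"
  unfolding H_def
proof (intro CollectI conjI allI impI HA_cmult H_HA[OF assms])
  fix e :: real assume "0 < e"
  \<comment> \<open>The added 1 covers the case \<open>c = 0\<close>.\<close>
  have c: "0 < (cmod c)\<^sup>2 + 1" by (simp add: add_nonneg_pos)
  obtain \<phi> where \<phi>: "\<phi> \<in> test_functions" "\<phi> \<in> HA A" "Q A (\<lambda>x. u x - \<phi> x) < e / ((cmod c)\<^sup>2 + 1)"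
    using assms \<open>0 < e\<close> c unfolding H_def by (auto dest!: spec[of _ "e / ((cmod c)\<^sup>2 + 1)"])
  have "Q A (\<lambda>x. c * u x - c * \<phi> x) = (cmod c)\<^sup>2 * Q A (\<lambda>x. u x - \<phi> x)"
    unfolding right_diff_distrib[symmetric] Q_cmult ..
  also have "\<dots> \<le> ((cmod c)\<^sup>2 + 1) * Q A (\<lambda>x. u x - \<phi> x)" by (intro mult_right_mono Q_nonneg) simp
  also have "\<dots> < e" using \<phi>(3) c by (simp add: field_simps)
  finally have "Q A (\<lambda>x. c * u x - c * \<phi> x) < e" .
  moreover have "(\<lambda>x. c * \<phi> x) \<in> test_functions" by (rule test_function_mult[OF \<phi>(1) C_k_const])
  ultimately show "\<exists>\<psi>\<in>test_functions. \<psi> \<in> HA A \<and> Q A (\<lambda>x. c * u x - \<psi> x) < e"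
    using HA_cmult[OF \<phi>(2)] by blast
qed

lemma H_add: assumes "u \<in> H A" "v \<in> H A" shows "(\<lambda>x. u x + v x) \<in> H A"
  unfolding H_def
proof (intro CollectI conjI allI impI HA_add assms[THEN H_HA])
  fix e :: real assume "0 < e"
  then obtain \<phi> \<psi> where \<phi>: "\<phi> \<in> test_functions" "\<phi> \<in> HA A" "Q A (\<lambda>x. u x - \<phi> x) < e / 4"
      and \<psi>: "\<psi> \<in> test_functions" "\<psi> \<in> HA A" "Q A (\<lambda>x. v x - \<psi> x) < e / 4"
    using assms unfolding H_def by (auto dest!: spec[of _ "e / 4"])
  have "Q A (\<lambda>x. u x + v x - (\<phi> x + \<psi> x)) = Q A (\<lambda>x. (u x - \<phi> x) + (v x - \<psi> x))"
    by (simp add: algebra_simps)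
  also have "\<dots> \<le> 2 * Q A (\<lambda>x. u x - \<phi> x) + 2 * Q A (\<lambda>x. v x - \<psi> x)"
    by (intro Q_add_le HA_diff \<phi> \<psi> assms[THEN H_HA])
  also have "\<dots> < e" using \<phi>(3) \<psi>(3) by simp
  finally show "\<exists>\<phi>\<in>test_functions. \<phi> \<in> HA A \<and> Q A (\<lambda>x. u x + v x - \<phi> x) < e"
    using test_function_add[OF \<phi>(1) \<psi>(1)] HA_add[OF \<phi>(2) \<psi>(2)] by blast
qed

lemma H_diff: assumes "u \<in> H A" "v \<in> H A" shows "(\<lambda>x. u x - v x) \<in> H A"
  using H_add[OF assms(1) H_cmult[OF assms(2), of "-1"]] by simp

lemma H_closed:
  assumes u: "u \<in> HA A" and "\<And>\<epsilon>. 0 < \<epsilon> \<Longrightarrow> \<exists>w\<in>H A. Q A (\<lambda>x. u x - w x) < \<epsilon>"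
  shows "u \<in> H A"
  unfolding H_def
proof (intro CollectI conjI allI impI u)
  fix e :: real assume "0 < e"
  then obtain w where w: "w \<in> H A" "Q A (\<lambda>x. u x - w x) < e / 4" using assms(2)[of "e/4"] by auto
  then obtain \<phi> where \<phi>: "\<phi> \<in> test_functions" "\<phi> \<in> HA A" "Q A (\<lambda>x. w x - \<phi> x) < e / 4"
    using \<open>0 < e\<close> unfolding H_def by (auto dest!: spec[of _ "e / 4"])
  have "Q A (\<lambda>x. u x - \<phi> x) = Q A (\<lambda>x. (u x - w x) + (w x - \<phi> x))" by simp
  also have "\<dots> \<le> 2 * Q A (\<lambda>x. u x - w x) + 2 * Q A (\<lambda>x. w x - \<phi> x)"
    by (intro Q_add_le HA_diff \<phi> u H_HA[OF w(1)])
  also have "\<dots> < e" using \<phi>(3) w(2) by simp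
  finally show "\<exists>\<phi>\<in>test_functions. \<phi> \<in> HA A \<and> Q A (\<lambda>x. u x - \<phi> x) < e" using \<phi> by blast
qed

text \<open>The factor by which a cutoff may raise the energy, the same for every
  \<open>cutoff n\<close> and every potential.\<close>

definition K\<^sub>c :: real where "K\<^sub>c = 2 + c_const s * (4 * exp 1)\<^sup>2 * \<kappa>mass"

lemma cutoff_HA_mult:
  assumes "u \<in> HA A" "A \<in> borel_measurable borel"
  shows "(\<lambda>x. complex_of_real (cutoff n x) * u x) \<in> HA A"
    "Q A (\<lambda>x. complex_of_real (cutoff n x) * u x) \<le> K\<^sub>c * Q A u"
  unfolding K\<^sub>c_def
  by (rule HA_cutoff[OF assms cutoff_measurable cutoff_bounds(3) cutoff_Lipschitz])+

lemma cutoff_HA_change: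
  assumes u: "u \<in> HA A" and A: "A \<in> borel_measurable borel" "A' \<in> borel_measurable borel"
    and C: "\<And>x. x \<in> cball 0 (real n + 2) \<Longrightarrow> norm (A' x - A x) \<le> C"
  shows "(\<lambda>x. complex_of_real (cutoff n x) * u x) \<in> HA A'"
    "Q A' (\<lambda>x. complex_of_real (cutoff n x) * u x) \<le> (2 + c_const s * (max 2 C)\<^sup>2 * \<kappa>mass) * K\<^sub>c * Q A u"
proof -
  let ?v = "\<lambda>x. complex_of_real (cutoff n x) * u x"
  have supp: "\<And>x. ?v x \<noteq> 0 \<Longrightarrow> norm x \<le> real n + 1" using cutoff_support by auto
  have C': "\<And>x. x \<in> cball 0 (real n + 1 + 1) \<Longrightarrow> norm (A' x - A x) \<le> C" using C by auto
  note 1 = HA_change_potential[OF cutoff_HA_mult(1)[OF u A(1)] A(2) supp C']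
  show "?v \<in> HA A'" by (rule 1)
  have "0 \<le> 2 + c_const s * (max 2 C)\<^sup>2 * \<kappa>mass"
    using const_pos kernel_mass_nonneg by (intro add_nonneg_nonneg mult_nonneg_nonneg) auto
  then show "Q A' ?v \<le> (2 + c_const s * (max 2 C)\<^sup>2 * \<kappa>mass) * K\<^sub>c * Q A u"
    using 1(2) mult_left_mono[OF cutoff_HA_mult(2)[OF u A(1), of n]] by (fastforce simp: mult.assoc)
qed

text \<open>Approximating test functions stay test functions when multiplied by the smooth cutoff,
  and the energy for \<open>A'\<close> of a truncation is bounded by the energy for
  \<open>A\<close>. Truncation therefore moves functions between the closures belonging to any two
  locally bounded potentials.\<close>

lemma H_cutoff:
  assumes u: "u \<in> H A" and A: "locally_bounded_potential A" "locally_bounded_potential A'"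
  shows "(\<lambda>x. complex_of_real (cutoff n x) * u x) \<in> H A'"
proof -
  note Am = A[THEN locally_bounded_potentialD(1)]
  obtain C where C: "\<And>x. x \<in> cball 0 (real n + 2) \<Longrightarrow> norm (A' x - A x) \<le> C"
    using locally_bounded_potential_diff[OF A(2) A(1)] by blast
  define K where "K = (2 + c_const s * (max 2 C)\<^sup>2 * \<kappa>mass) * K\<^sub>c"
  note ch = cutoff_HA_change[OF _ Am C, folded K_def]
  show ?thesis
    unfolding H_def
  proof (intro CollectI conjI allI impI)
    show "(\<lambda>x. complex_of_real (cutoff n x) * u x) \<in> HA A'" by (rule ch(1)[OF H_HA[OF u]])
    fix e :: real assume "0 < e"
    then have e: "0 < e / (\<bar>K\<bar> + 1)" by simp
    then obtain \<phi> where \<phi>: "\<phi> \<in> test_functions" "\<phi> \<in> HA A" "Q A (\<lambda>x. u x - \<phi> x) < e / (\<bar>K\<bar> + 1)"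
      using u unfolding H_def by blast
    have "Q A' (\<lambda>x. complex_of_real (cutoff n x) * u x - complex_of_real (cutoff n x) * \<phi> x)
        = Q A' (\<lambda>x. complex_of_real (cutoff n x) * (u x - \<phi> x))" by (simp add: right_diff_distrib)
    also have "\<dots> \<le> K * Q A (\<lambda>x. u x - \<phi> x)" by (rule ch(2)[OF HA_diff[OF H_HA[OF u] \<phi>(2)]])
    also have "\<dots> \<le> (\<bar>K\<bar> + 1) * Q A (\<lambda>x. u x - \<phi> x)" by (intro mult_right_mono Q_nonneg) auto
    also have "\<dots> < e" using \<phi>(3) by (simp add: field_simps)
    finally have "Q A' (\<lambda>x. complex_of_real (cutoff n x) * u x - complex_of_real (cutoff n x) * \<phi> x) < e" .
    moreover have "(\<lambda>x. complex_of_real (cutoff n x) * \<phi> x) \<in> test_functions"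
      by (rule test_function_mult[OF \<phi>(1) C_k_cutoff])
    ultimately show "\<exists>\<phi>\<in>test_functions. \<phi> \<in> HA A' \<and> Q A' (\<lambda>x. complex_of_real (cutoff n x) * u x - \<phi> x) < e"
      using ch(1)[OF \<phi>(2)] by blast
  qed
qed

section \<open>Weak limits and closedness\<close>

lemma B_tendsto:
  assumes h: "h \<in> HA A" and A: "A \<in> borel_measurable borel" and u: "\<And>n. u n \<in> HA A" "u0 \<in> HA A"
    and lim: "AE x in lborel. (\<lambda>n. u n x) \<longlonglongrightarrow> u0 x" and K: "\<And>n. Q A (u n) \<le> K"
  shows "(\<lambda>n. B A h (u n)) \<longlonglongrightarrow> B A h u0"
proof -
  have DK: "L2sq (D A (u n)) \<le> 2 / c_const s * K" for n
    by (rule quotient_integral_le[OF K])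
  have limD: "AE z in lborel. (\<lambda>n. D A (u n) z) \<longlonglongrightarrow> D A u0 z"
    using AE_lborel_fst_snd[OF lim] by eventually_elim (intro quotient_tendsto, auto)
  show ?thesis unfolding B_def
    by (intro tendsto_intros)
       (rule square_integrable_weak_limit[OF HA_L2(1)[OF h] HA_L2(1)[OF u(1)] HA_L2(1)[OF u(2)] order_trans[OF Q_bounds(1) K] lim]
             square_integrable_weak_limit[OF HA_D(1)[OF h] HA_D(1)[OF u(1)] HA_D(1)[OF u(2)] DK limD])+
qed

lemma B_self: "B A u u = Q A u"
  unfolding B_def Q_def cmod_power2 by (simp add: power2_eq_square)

text \<open>Weak closedness of the subspace \<open>H A\<close>: otherwise, moving from a near-minimizer \<open>w\<close> of the distance
  from \<open>u0\<close> to \<open>H A\<close> a little towards \<open>u n\<close> would decrease that distance.\<close>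

lemma H_weakly_closed:
  assumes A: "A \<in> borel_measurable borel" and u: "\<And>n. u n \<in> H A" "u0 \<in> HA A"
    and lim: "AE x in lborel. (\<lambda>n. u n x) \<longlonglongrightarrow> u0 x" and K: "\<And>n. Q A (u n) \<le> K"
  shows "u0 \<in> H A"
proof (rule ccontr)
  assume "u0 \<notin> H A"
  then obtain e where e: "0 < e" "\<And>w. w \<in> H A \<Longrightarrow> e \<le> Q A (\<lambda>x. u0 x - w x)"
    using H_closed[OF u(2)] by (meson not_le)
  define S where "S = (\<lambda>w. Q A (\<lambda>x. u0 x - w x)) ` H A"
  define d where "d = Inf S"
  have ne: "S \<noteq> {}" using u(1)[of 0] by (auto simp: S_def)
  have bdd: "bdd_below S" by (rule bdd_belowI[of _ 0]) (auto simp: S_def Q_nonneg)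
  have d1: "d \<le> Q A (\<lambda>x. u0 x - w x)" if "w \<in> H A" for w
    unfolding d_def by (rule cInf_lower[OF _ bdd]) (use that in \<open>auto simp: S_def\<close>)
  have "e \<le> d" unfolding d_def by (rule cInf_greatest[OF ne]) (use e in \<open>auto simp: S_def\<close>)
  then have d0: "0 < d" using e by simp
  \<comment> \<open>A bound for the energies of \<open>u n - w\<close> that serves every
    near-minimizer \<open>w\<close>, so that \<open>t\<close> can be fixed before \<open>w\<close>
    is chosen.\<close>
  define K' where "K' = 2 * K + 2 * (2 * Q A u0 + 2 * (d + 1))"
  have K0: "0 \<le> K" using order_trans[OF Q_nonneg K[of 0]] .
  then have K': "0 < K'" using d0 Q_nonneg[of A u0] by (simp add: K'_def)
  \<comment> \<open>A step of length \<open>t\<close> gains about \<open>2 * t * d\<close> in the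
    linear term and costs at most \<open>t^2 * K' \<le> t * d\<close> in the quadratic one. The net
    gain \<open>t * d\<close> exceeds the defect \<open>\<delta>\<close> of the
    near-minimizer.\<close>
  define t where "t = min (1/2) (d / K')"
  have t: "0 < t" "t \<le> 1/2" "t * K' \<le> d"
  proof -
    show "0 < t" using d0 K' by (auto simp: t_def)
    show "t \<le> 1/2" unfolding t_def by (rule min.cobounded1)
    have "t * K' \<le> d / K' * K'" unfolding t_def using K' by (intro mult_right_mono) auto
    then show "t * K' \<le> d" using K' by simp
  qed
  define \<delta> where "\<delta> = min 1 (t * d / 2)"
  have \<delta>: "0 < \<delta>" "\<delta> \<le> 1" "\<delta> < t * d" using t d0 by (auto simp: \<delta>_def min_def)
  have "\<exists>y\<in>S. y < d + \<delta>"
    using cInf_lessD[OF ne, of "d + \<delta>"] \<delta>(1) by (auto simp: d_def)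
  then obtain w where w: "w \<in> H A" "Q A (\<lambda>x. u0 x - w x) < d + \<delta>" by (auto simp: S_def)
  define h where "h = (\<lambda>x. u0 x - w x)"
  have h: "h \<in> HA A" unfolding h_def by (rule HA_diff[OF u(2) H_HA[OF w(1)]])
  define y where "y n = (\<lambda>x. u n x - w x)" for n
  have yH: "y n \<in> H A" for n unfolding y_def by (rule H_diff[OF u(1) w(1)])
  have yHA: "y n \<in> HA A" for n by (rule H_HA[OF yH])
  have "Q A w = Q A (\<lambda>x. u0 x - h x)" by (simp add: h_def)
  also have "\<dots> \<le> 2 * Q A u0 + 2 * Q A h" by (rule Q_diff_le[OF u(2) h])
  also have "\<dots> \<le> 2 * Q A u0 + 2 * (d + 1)" using w(2) \<delta> by (simp add: h_def)
  finally have Qw: "Q A w \<le> 2 * Q A u0 + 2 * (d + 1)" .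
  have yK: "Q A (y n) \<le> K'" for n
  proof -
    have "Q A (y n) \<le> 2 * Q A (u n) + 2 * Q A w"
      unfolding y_def by (rule Q_diff_le[OF H_HA[OF u(1)] H_HA[OF w(1)]])
    then show ?thesis using K[of n] Qw unfolding K'_def by argo
  qed
  have ylim: "AE x in lborel. (\<lambda>n. y n x) \<longlonglongrightarrow> h x"
    using lim by eventually_elim (auto simp: y_def h_def intro: tendsto_intros)
  have "(\<lambda>n. B A h (y n)) \<longlonglongrightarrow> Q A h"
    using B_tendsto[OF h A yHA h ylim yK] by (simp add: B_self)
  then have "(\<lambda>n. Q A h - 2 * t * B A h (y n) + t\<^sup>2 * K') \<longlonglongrightarrow> Q A h - 2 * t * Q A h + t\<^sup>2 * K'"
    by (intro tendsto_intros)
  moreover have "d \<le> Q A h - 2 * t * B A h (y n) + t\<^sup>2 * K'" for n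
  proof -
    have "d \<le> Q A (\<lambda>x. u0 x - (w x + complex_of_real t * y n x))"
      by (intro d1 H_add w(1) H_cmult yH)
    also have "\<dots> = Q A (\<lambda>x. h x - complex_of_real t * y n x)" by (simp add: h_def algebra_simps)
    also have "\<dots> = Q A h - 2 * t * B A h (y n) + t\<^sup>2 * Q A (y n)" by (rule Q_diff[OF h yHA])
    finally show ?thesis using mult_left_mono[OF yK[of n], of "t\<^sup>2"] by simp
  qed
  ultimately have "d \<le> Q A h - 2 * t * Q A h + t\<^sup>2 * K'"
    by (intro LIMSEQ_le_const[where X = "\<lambda>n. Q A h - 2 * t * B A h (y n) + t\<^sup>2 * K'"]) auto
  moreover have "t\<^sup>2 * K' \<le> t * d" using t mult_left_mono[OF t(3), of t] by (simp add: power2_eq_square)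
  moreover have "Q A h - 2 * t * Q A h \<le> (1 - 2 * t) * (d + \<delta>)"
  proof -
    have "(1 - 2 * t) * Q A h \<le> (1 - 2 * t) * (d + \<delta>)"
      using w(2) t by (intro mult_left_mono) (auto simp: h_def)
    then show ?thesis by (simp add: algebra_simps)
  qed
  moreover have "(1 - 2 * t) * (d + \<delta>) = d - 2 * (t * d) + \<delta> - 2 * (t * \<delta>)" by (simp add: algebra_simps)
  moreover have "0 \<le> t * \<delta>" using t \<delta> by simp
  ultimately show False using \<delta>(3) by linarith
qed

text \<open>The functions \<open>u n\<close> live in different spaces. Their truncations all lie in
  the one space \<open>H A0\<close>, with bounded energy since the potentials are uniformly bounded
  on balls, and weak closedness applies there. Afterwards the truncation of the limit is removed by
  \<open>Q_cutoff_tendsto\<close>.\<close>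

lemma H_limit:
  assumes A: "\<And>n. locally_bounded_potential (A n)" "locally_bounded_potential A0" "\<And>x. (\<lambda>n. A n x) \<longlonglongrightarrow> A0 x"
    and C: "\<And>R. \<exists>C. \<forall>n. \<forall>x\<in>cball 0 R. norm (A n x) \<le> C"
    and u: "\<And>n. u n \<in> H (A n)" "u0 \<in> borel_measurable borel" and lim: "AE x in lborel. (\<lambda>n. u n x) \<longlonglongrightarrow> u0 x"
    and K: "\<And>n. Q (A n) (u n) \<le> K"
  shows "u0 \<in> H A0"
proof -
  note Am = A(1)[THEN locally_bounded_potentialD(1)] A(2)[THEN locally_bounded_potentialD(1)]
  have u0: "u0 \<in> HA A0" by (rule Q_Fatou[OF A(3) Am(2) H_HA[OF u(1)] u(2) lim K])
  have "(\<lambda>x. complex_of_real (cutoff m x) * u0 x) \<in> H A0" for m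
  proof -
    obtain C1 where C1: "\<And>n x. x \<in> cball 0 (real m + 2) \<Longrightarrow> norm (A n x) \<le> C1" using C by blast
    have C2: "norm (A0 x - A n x) \<le> 2 * C1" if "x \<in> cball 0 (real m + 2)" for x n
      using limit_diff_bound[OF A(3) C1[OF that]] by (simp add: norm_minus_commute)
    define L where "L = (2 + c_const s * (max 2 (2 * C1))\<^sup>2 * \<kappa>mass) * K\<^sub>c"
    have L: "0 \<le> L" unfolding L_def K\<^sub>c_def using const_pos kernel_mass_nonneg
      by (intro mult_nonneg_nonneg add_nonneg_nonneg) auto
    show ?thesis
    proof (rule H_weakly_closed[OF Am(2)])
      show "(\<lambda>x. complex_of_real (cutoff m x) * u n x) \<in> H A0" for n by (rule H_cutoff[OF u(1) A(1,2)])
      show "(\<lambda>x. complex_of_real (cutoff m x) * u0 x) \<in> HA A0" by (rule cutoff_HA_mult[OF u0 Am(2)])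
      show "AE x in lborel. (\<lambda>n. complex_of_real (cutoff m x) * u n x) \<longlonglongrightarrow> complex_of_real (cutoff m x) * u0 x"
        using lim by eventually_elim (intro tendsto_intros)
      show "Q A0 (\<lambda>x. complex_of_real (cutoff m x) * u n x) \<le> L * K" for n
        using cutoff_HA_change(2)[OF H_HA[OF u(1)[of n]] Am(1) Am(2) C2] mult_left_mono[OF K[of n] L]
        unfolding L_def by (rule order_trans)
    qed
  qed
  moreover have "(\<lambda>n. Q A0 (\<lambda>x. u0 x - complex_of_real (cutoff n x) * u0 x)) \<longlonglongrightarrow> 0"
    by (rule Q_cutoff_tendsto[OF u0 Am(2) cutoff_measurable cutoff_bounds(3) cutoff_Lipschitz cutoff_tendsto])
  ultimately show ?thesis
  proof (intro H_closed u0)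
    fix e :: real assume "0 < e"
    assume *: "\<And>m. (\<lambda>x. complex_of_real (cutoff m x) * u0 x) \<in> H A0"
    assume "(\<lambda>n. Q A0 (\<lambda>x. u0 x - complex_of_real (cutoff n x) * u0 x)) \<longlonglongrightarrow> 0"
    from order_tendstoD(2)[OF this \<open>0 < e\<close>] obtain n where "Q A0 (\<lambda>x. u0 x - complex_of_real (cutoff n x) * u0 x) < e"
      by (auto simp: eventually_sequentially)
    then show "\<exists>w\<in>H A0. Q A0 (\<lambda>x. u0 x - w x) < e"
      by (intro bexI[of _ "\<lambda>x. complex_of_real (cutoff n x) * u0 x"] *)
  qed
qed

end

section \<open>Dyadic averages\<close>

definition dyadic_index :: "nat \<Rightarrow> real^3 \<Rightarrow> int \<times> int \<times> int" where
  "dyadic_index k x = (\<lfloor>2 ^ k * x $ 1\<rfloor>, \<lfloor>2 ^ k * x $ 2\<rfloor>, \<lfloor>2 ^ k * x $ 3\<rfloor>)"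

definition dyadic_cell :: "nat \<Rightarrow> int \<times> int \<times> int \<Rightarrow> (real^3) set" where
  "dyadic_cell k m = {y. dyadic_index k y = m}"

lemma vec_nth_measurable [measurable]: "(\<lambda>x. x $ i) \<in> borel_measurable (borel :: (real^3) measure)"
  by (intro borel_measurable_continuous_onI continuous_intros)

lemma dyadic_cell_sets [measurable]: "dyadic_cell k m \<in> sets borel"
proof -
  obtain a b c where m: "m = (a, b, c)" by (cases m)
  have "dyadic_cell k m = {y \<in> space borel. real_of_int \<lfloor>2 ^ k * y $ 1\<rfloor> = real_of_int a
      \<and> real_of_int \<lfloor>2 ^ k * y $ 2\<rfloor> = real_of_int b \<and> real_of_int \<lfloor>2 ^ k * y $ 3\<rfloor> = real_of_int c}"
    by (auto simp: dyadic_cell_def dyadic_index_def m)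
  also have "\<dots> \<in> sets borel" by measurable
  finally show ?thesis .
qed

lemma dyadic_pair_sets [measurable]:
  "Measurable.pred borel (\<lambda>z :: (real^3) \<times> (real^3). dyadic_index k (snd z) = dyadic_index k (fst z))"
proof -
  have "(\<lambda>z :: (real^3) \<times> (real^3). dyadic_index k (snd z) = dyadic_index k (fst z)) =
     (\<lambda>z. real_of_int \<lfloor>2 ^ k * snd z $ 1\<rfloor> = real_of_int \<lfloor>2 ^ k * fst z $ 1\<rfloor>
      \<and> real_of_int \<lfloor>2 ^ k * snd z $ 2\<rfloor> = real_of_int \<lfloor>2 ^ k * fst z $ 2\<rfloor>
      \<and> real_of_int \<lfloor>2 ^ k * snd z $ 3\<rfloor> = real_of_int \<lfloor>2 ^ k * fst z $ 3\<rfloor>)"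
    by (auto simp: dyadic_index_def)
  then show ?thesis by simp
qed

text \<open>The floor at level \<open>k\<close> is the floor at level \<open>k + 1\<close> divided
  by 2. This nesting makes the projection of generation \<open>k\<close> constant on the cells of
  generation \<open>k + 1\<close>.\<close>

lemma dyadic_index_Suc: "dyadic_index (Suc k) x = dyadic_index (Suc k) y \<Longrightarrow> dyadic_index k x = dyadic_index k y"
proof -
  have "\<lfloor>2 ^ k * t\<rfloor> = \<lfloor>2 ^ Suc k * t\<rfloor> div 2" for t :: real
    using floor_divide_of_int_eq[where 'a = real] 
    by (metis (no_types, lifting) floor_divide_real_eq_div mult.assoc mult.commute nonzero_mult_div_cancel_left of_int_numeral power_Suc zero_le_numeral zero_neq_numeral)
  then show "dyadic_index (Suc k) x = dyadic_index (Suc k) y \<Longrightarrow> dyadic_index k x = dyadic_index k y"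
    unfolding dyadic_index_def by simp
qed

text \<open>A cell is a half-open cube, caught between the open and the closed box with the same
  corners, which have equal volume.\<close>

lemma dyadic_cell_emeasure: "emeasure lborel (dyadic_cell k m) = ennreal (1 / 8 ^ k)"
proof -
  obtain a b c where m: "m = (a, b, c)" by (cases m)
  define l :: "real^3" where "l = vector [real_of_int a / 2 ^ k, real_of_int b / 2 ^ k, real_of_int c / 2 ^ k]"
  define u where "u = l + (1 / 2 ^ k) *\<^sub>R One"
  have One: "(One :: real^3) $ i = 1" for i
    by (simp add: cart_eq_inner_axis)
  have ul: "(u - l) \<bullet> b = 1 / 2 ^ k" if "b \<in> Basis" for b using that by (simp add: u_def)
  have le: "l \<bullet> b \<le> u \<bullet> b" if "b \<in> Basis" for b using ul[OF that] by (simp add: inner_diff_left) (smt (verit) zero_le_divide_1_iff zero_le_power)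
  have pr: "(\<Prod>b\<in>Basis. (u - l) \<bullet> b) = 1 / 8 ^ k"
  proof -
    have "(\<Prod>b\<in>Basis. (u - l) \<bullet> b) = (\<Prod>b\<in>(Basis :: (real^3) set). 1 / 2 ^ k)" by (rule prod.cong) (auto simp: ul)
    also have "\<dots> = (1 / 2 ^ k) ^ 3" by simp
    also have "\<dots> = 1 / 8 ^ k"
      using power_mult[of "2::real" 3 k] power_mult[of "2::real" k 3] by (simp add: power_divide mult.commute)
    finally show ?thesis .
  qed
  have mem: "y \<in> dyadic_cell k m \<longleftrightarrow> (\<forall>i. l $ i \<le> y $ i \<and> y $ i < u $ i)" for y
  proof -
    have fl: "\<lfloor>2 ^ k * t\<rfloor> = z \<longleftrightarrow> real_of_int z / 2 ^ k \<le> t \<and> t < real_of_int z / 2 ^ k + 1 / 2 ^ k" for t :: real and z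
      by (simp add: floor_eq_iff field_simps)
    show ?thesis
      unfolding forall_3 by (simp add: dyadic_cell_def dyadic_index_def m fl l_def u_def One vector_3 del: sum_component)
  qed
  have "box l u \<subseteq> dyadic_cell k m" "dyadic_cell k m \<subseteq> cbox l u"
    unfolding subset_iff mem mem_box_cart by (auto intro: less_imp_le)
  then have "emeasure lborel (box l u) \<le> emeasure lborel (dyadic_cell k m)" "emeasure lborel (dyadic_cell k m) \<le> emeasure lborel (cbox l u)"
    by (auto intro!: emeasure_mono)
  moreover have "emeasure lborel (box l u) = ennreal (1 / 8 ^ k)" "emeasure lborel (cbox l u) = ennreal (1 / 8 ^ k)"
    using emeasure_lborel_box[of l u] emeasure_lborel_cbox[of l u] le by (simp_all only: pr)
  ultimately show ?thesis by auto
qed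

text \<open>The norm is estimated by the sum of the three coordinate differences, hence the constant
  3; its exact value is immaterial and reappears only in \<open>c\<^sub>1\<close>.\<close>

lemma dyadic_diameter:
  assumes "dyadic_index k x = dyadic_index k y" shows "norm (x - y) \<le> 3 / 2 ^ k"
proof -
  have "\<bar>a - b\<bar> \<le> 1 / 2 ^ k" if "\<lfloor>2 ^ k * a\<rfloor> = \<lfloor>2 ^ k * b\<rfloor>" for a b :: real
  proof -
    have "\<bar>2 ^ k * a - 2 ^ k * b\<bar> < 1" using that by linarith
    then have "2 ^ k * \<bar>a - b\<bar> < 1" by (simp add: abs_mult flip: right_diff_distrib)
    then show ?thesis by (simp add: field_simps)
  qed
  then have "\<bar>x $ i - y $ i\<bar> \<le> 1 / 2 ^ k" for i
    using assms exhaust_3[of i] by (auto simp: dyadic_index_def)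
  note this[of 1] this[of 2] this[of 3]
  then have "(\<Sum>i\<in>UNIV. \<bar>(x - y) $ i\<bar>) \<le> 3 / 2 ^ k" by (simp add: sum_3)
  then show ?thesis using norm_le_l1_cart[of "x - y"] by simp
qed

definition dyadic_average :: "nat \<Rightarrow> (real^3 \<Rightarrow> complex) \<Rightarrow> int \<times> int \<times> int \<Rightarrow> complex" where
  "dyadic_average k f m = complex_of_real (8 ^ k) * (\<integral>y. indicator (dyadic_cell k m) y * f y \<partial>lborel)"

text \<open>The conditional expectation with respect to the partition into cells of generation
  \<open>k\<close>.\<close>

definition dyadic_projection :: "nat \<Rightarrow> (real^3 \<Rightarrow> complex) \<Rightarrow> real^3 \<Rightarrow> complex" where
  "dyadic_projection k f x = dyadic_average k f (dyadic_index k x)"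

lemma square_integrable_indicator_cell: "square_integrable lborel (\<lambda>y. indicator (dyadic_cell k m) y * a)"
proof -
  have "integrable lborel (\<lambda>y. indicator (dyadic_cell k m) y *\<^sub>R (cmod a)\<^sup>2)"
    by (intro integrable_scaleR_left integrable_real_indicator) (auto simp: dyadic_cell_emeasure)
  moreover have "(cmod (indicator (dyadic_cell k m) y * a))\<^sup>2 = indicator (dyadic_cell k m) y *\<^sub>R (cmod a)\<^sup>2" for y
    by (auto simp: indicator_def)
  ultimately show ?thesis unfolding square_integrable_def by simp
qed

lemma square_integrable_cell_integrable:
  assumes "square_integrable lborel (\<lambda>y. indicator (dyadic_cell k m) y * g y)"
  shows "integrable lborel (\<lambda>y. indicator (dyadic_cell k m) y * g y :: complex)"
proof (rule Bochner_Integration.integrable_bound)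
  show "integrable lborel (\<lambda>y. indicator (dyadic_cell k m) y *\<^sub>R 1 + (cmod (indicator (dyadic_cell k m) y * g y))\<^sup>2)"
    using assms by (intro Bochner_Integration.integrable_add integrable_scaleR_left integrable_real_indicator)
      (auto simp: dyadic_cell_emeasure square_integrable_def)
  have "c \<le> 1 + c\<^sup>2" for c :: real using sum_squares_bound[of 1 c] zero_le_power2[of c] by (simp add: power2_eq_square) (smt (verit) zero_le_square)
  then show "AE y in lborel. norm (indicator (dyadic_cell k m) y * g y) \<le> norm (indicator (dyadic_cell k m) y *\<^sub>R (1::real) + (cmod (indicator (dyadic_cell k m) y * g y))\<^sup>2)"
    by (intro AE_I2) (auto simp: indicator_def)
qed (use assms in \<open>simp add: square_integrable_def\<close>)

text \<open>Jensen's inequality, read off from the nonnegative squared distance on the cell between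
  \<open>g\<close> and its mean \<open>a\<close>: the pairing of \<open>g\<close> with
  \<open>a\<close> and the square of \<open>a\<close> both integrate to
  \<open>|a|^2 / 8^k\<close>.\<close>

lemma dyadic_average_square_le:
  assumes g: "square_integrable lborel (\<lambda>y. indicator (dyadic_cell k m) y * g y)"
  shows "(cmod (dyadic_average k g m))\<^sup>2 \<le> 8 ^ k * L2sq (\<lambda>y. indicator (dyadic_cell k m) y * g y)"
proof -
  define a where "a = dyadic_average k g m"
  let ?C = "dyadic_cell k m"
  note ia = square_integrable_indicator_cell[of k m a]
  have "0 \<le> L2sq (\<lambda>y. indicator ?C y * g y - complex_of_real 1 * (indicator ?C y * a))" by simp
  also have "\<dots> = L2sq (\<lambda>y. indicator ?C y * g y)
     - 2 * (\<integral>y. Re (cnj (indicator ?C y * g y) * (indicator ?C y * a)) \<partial>lborel) + L2sq (\<lambda>y. indicator ?C y * a)"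
    using integral_cmod_diff_squared[OF g ia, of 1] by simp
  also have "L2sq (\<lambda>y. indicator ?C y * a) = (cmod a)\<^sup>2 / 8 ^ k"
  proof -
    have "L2sq (\<lambda>y. indicator ?C y * a) = (\<integral>y. indicator ?C y *\<^sub>R (cmod a)\<^sup>2 \<partial>lborel)"
      by (rule Bochner_Integration.integral_cong) (auto simp: indicator_def)
    also have "\<dots> = measure lborel ?C * (cmod a)\<^sup>2" by simp
    finally show ?thesis by (simp add: measure_def dyadic_cell_emeasure)
  qed
  also have "(\<integral>y. Re (cnj (indicator ?C y * g y) * (indicator ?C y * a)) \<partial>lborel) = (cmod a)\<^sup>2 / 8 ^ k"
  proof -
    have int: "integrable lborel (\<lambda>y. indicator ?C y * g y)" by (rule square_integrable_cell_integrable[OF g])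
    have "(\<integral>y. Re (cnj (indicator ?C y * g y) * (indicator ?C y * a)) \<partial>lborel) = (\<integral>y. Re (cnj (indicator ?C y * g y) * a) \<partial>lborel)"
      by (rule Bochner_Integration.integral_cong) (auto simp: indicator_def)
    also have "\<dots> = Re (\<integral>y. cnj (indicator ?C y * g y) * a \<partial>lborel)"
      by (rule integral_Re) (intro integrable_mult_left integrable_cnj int)
    also have "\<dots> = Re (cnj (\<integral>y. indicator ?C y * g y \<partial>lborel) * a)"
      using int by (simp add: integral_cnj[symmetric] del: complex_cnj_mult)
    also have "(\<integral>y. indicator ?C y * g y \<partial>lborel) = a / complex_of_real (8 ^ k)"
      by (simp add: a_def dyadic_average_def)
    also have "Re (cnj (a / complex_of_real (8 ^ k)) * a) = (cmod a)\<^sup>2 / 8 ^ k"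
    proof -
      have "cnj (a / complex_of_real (8 ^ k)) * a = complex_of_real ((cmod a)\<^sup>2 / 8 ^ k)"
        using complex_norm_square[of a] by (simp add: mult.commute)
      then show ?thesis by (simp only: Re_complex_of_real)
    qed
    finally show ?thesis .
  qed
  finally have "(cmod a)\<^sup>2 / 8 ^ k \<le> L2sq (\<lambda>y. indicator ?C y * g y)" by simp
  then show ?thesis unfolding a_def[symmetric] by (simp add: field_simps)
qed

lemma square_integrable_cell_mult:
  assumes "square_integrable lborel f"
  shows "square_integrable lborel (\<lambda>y. indicator (dyadic_cell k m) y * f y)"
  by (rule square_integrable_bound[OF _ square_integrableD(2)[OF assms]])
     (use square_integrableD(1)[OF assms] in \<open>auto simp: indicator_def\<close>)

lemma dyadic_average_const_diff:
  assumes "square_integrable lborel f"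
  shows "dyadic_average k (\<lambda>y. f y - a) m = dyadic_average k f m - a"
proof -
  let ?C = "dyadic_cell k m"
  have "integrable lborel (\<lambda>y. indicator ?C y * f y)" "integrable lborel (\<lambda>y. indicator ?C y * a)"
    by (intro square_integrable_cell_integrable square_integrable_cell_mult assms square_integrable_indicator_cell)+
  then have "(\<integral>y. indicator ?C y * (f y - a) \<partial>lborel) = (\<integral>y. indicator ?C y * f y \<partial>lborel) - (\<integral>y. indicator ?C y * a \<partial>lborel)"
    by (simp add: right_diff_distrib)
  moreover have "(\<integral>y. indicator ?C y * a \<partial>lborel) = a / complex_of_real (8 ^ k)"
  proof -
    have "(\<integral>y. indicator ?C y * a \<partial>lborel) = (\<integral>y. indicator ?C y *\<^sub>R a \<partial>lborel)"
      by (rule Bochner_Integration.integral_cong) (auto simp: indicator_def)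
    also have "\<dots> = measure lborel ?C *\<^sub>R a"
      by (subst integral_scaleR_left) (auto simp: dyadic_cell_emeasure intro!: integrable_real_indicator)
    finally show ?thesis by (simp add: measure_def dyadic_cell_emeasure scaleR_conv_of_real)
  qed
  ultimately show ?thesis by (simp add: dyadic_average_def right_diff_distrib)
qed

lemma dyadic_average_cong:
  "(\<And>y. dyadic_index k y = m \<Longrightarrow> f y = g y) \<Longrightarrow> dyadic_average k f m = dyadic_average k g m"
proof -
  assume "\<And>y. dyadic_index k y = m \<Longrightarrow> f y = g y"
  then have "indicator (dyadic_cell k m) y * f y = indicator (dyadic_cell k m) y * g y" for y
    by (simp add: indicator_def dyadic_cell_def)
  then have "(\<lambda>y. indicator (dyadic_cell k m) y * f y) = (\<lambda>y. indicator (dyadic_cell k m) y * g y)" by (rule ext)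
  then show ?thesis unfolding dyadic_average_def by (rule arg_cong)
qed

text \<open>The projection is a parameter integral against the indicator that two points share a
  cell, which is jointly measurable.\<close>

lemma dyadic_projection_measurable [measurable]:
  assumes [measurable]: "f \<in> borel_measurable borel"
  shows "dyadic_projection k f \<in> borel_measurable borel"
proof -
  have "(\<lambda>z. (if dyadic_index k (snd z) = dyadic_index k (fst z) then 1 else 0) * f (snd z)) \<in> borel_measurable (borel :: ((real^3) \<times> (real^3)) measure)"
    by measurable
  then have "(\<lambda>(x, y). (if dyadic_index k y = dyadic_index k x then 1 else 0) * f y) \<in> borel_measurable ((borel :: (real^3) measure) \<Otimes>\<^sub>M lborel)"
    by (simp add: case_prod_beta' borel_prod[symmetric] cong: measurable_cong_sets)
  then have "(\<lambda>x. \<integral>y. (if dyadic_index k y = dyadic_index k x then 1 else 0) * f y \<partial>lborel) \<in> borel_measurable (borel :: (real^3) measure)"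
    by (rule lborel.borel_measurable_lebesgue_integral)
  moreover have "dyadic_projection k f = (\<lambda>x. complex_of_real (8 ^ k) * (\<integral>y. (if dyadic_index k y = dyadic_index k x then 1 else 0) * f y \<partial>lborel))"
    unfolding dyadic_projection_def dyadic_average_def indicator_def dyadic_cell_def by (auto simp: if_distrib[of of_bool] of_bool_def)
  ultimately show ?thesis by simp
qed

section \<open>Subcritical Sobolev estimates\<close>

lemma power_powr_commute:
  fixes x c :: real
  assumes "0 < x" shows "(x ^ k) powr c = (x powr c) ^ k"
proof -
  have "(x ^ k) powr c = (x powr real k) powr c" using assms by (simp add: powr_realpow)
  also have "\<dots> = (x powr c) powr real k" by (simp only: powr_powr mult.commute)
  also have "\<dots> = (x powr c) ^ k" using assms by (simp add: powr_realpow)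
  finally show ?thesis .
qed

context fractional_order
begin

abbreviation D0 :: "(real^3 \<Rightarrow> complex) \<Rightarrow> (real^3) \<times> (real^3) \<Rightarrow> complex" where "D0 \<equiv> D (\<lambda>x. 0)"
abbreviation HS :: "(real^3 \<Rightarrow> complex) set" where "HS \<equiv> HA (\<lambda>x. 0)"

definition N :: "(real^3 \<Rightarrow> complex) \<Rightarrow> real" where "N f = L2sq f"
definition E :: "(real^3 \<Rightarrow> complex) \<Rightarrow> real" where "E f = L2sq (D0 f)"
text \<open>The factor by which the bound for the squared \<open>L^2\<close> projection error drops
  per generation. The constant \<open>c\<^sub>1\<close> below is the cell diameter constant 3 raised
  to the exponent of the kernel.\<close>

definition \<omega> :: real where "\<omega> = 2 powr (- 2 * s)"
definition c\<^sub>1 :: real where "c\<^sub>1 = 3 powr (3 + 2 * s)"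

lemma \<omega>_bounds: "0 < \<omega>" "\<omega> < 1"
  using s powr_less_mono[of "- 2 * s" 0 2] by (auto simp: \<omega>_def)

lemma c1_pos: "0 < c\<^sub>1"
  by (simp add: c\<^sub>1_def)

lemma N_nonneg: "0 \<le> N f" and E_nonneg: "0 \<le> E f"
  by (simp_all add: N_def E_def)

text \<open>Averaging over a cell costs the inverse volume \<open>8^k\<close>, while the diameter
  contributes \<open>2 powr (- k * (3 + 2 * s))\<close>; the dimension cancels and
  \<open>\<omega>^k\<close> is left.\<close>

lemma scale_constant: "8 ^ k * (3 / 2 ^ k) powr (3 + 2 * s) = c\<^sub>1 * \<omega> ^ k"
proof -
  have "2 powr (3 + 2 * s) = 8 * 2 powr (2 * s)" by (simp add: powr_add)
  then have 2: "(2 ^ k :: real) powr (3 + 2 * s) = 8 ^ k * (2 powr (2 * s)) ^ k"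
    by (simp add: power_powr_commute power_mult_distrib)
  have 3: "\<omega> ^ k = 1 / (2 powr (2 * s)) ^ k"
    by (simp add: \<omega>_def powr_minus_divide power_divide)
  show ?thesis
    unfolding c\<^sub>1_def 3 by (simp add: powr_divide 2)
qed

lemma difference_le_quotient:
  assumes "norm (x - y) \<le> r"
  shows "(cmod (f y - f x))\<^sup>2 \<le> r powr (3 + 2 * s) * (cmod (D0 f (x, y)))\<^sup>2"
proof (cases "x = y")
  case False
  then have pos: "0 < norm (x - y) powr (3 + 2 * s)" by simp
  have "(cmod (f y - f x))\<^sup>2 = norm (x - y) powr (3 + 2 * s) * (cmod (D0 f (x, y)))\<^sup>2"
    unfolding cmod_quotient_squared using pos by (simp add: norm_minus_commute)
  also have "\<dots> \<le> r powr (3 + 2 * s) * (cmod (D0 f (x, y)))\<^sup>2"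
    using s assms by (intro mult_right_mono powr_mono2) auto
  finally show ?thesis .
qed simp

text \<open>A fractional Poincare inequality at one point: \<open>f x\<close> minus its cell average
  is an average of differences over points closer than the cell diameter, each paid for by the
  quotient. On the right the cell is enlarged to the whole space, so that integrating over
  \<open>x\<close> produces the energy.\<close>

lemma projection_error_pointwise:
  assumes f: "square_integrable lborel f"
  shows "ennreal ((cmod (f x - dyadic_projection k f x))\<^sup>2)
    \<le> (\<integral>\<^sup>+y. ennreal (c\<^sub>1 * \<omega> ^ k) * ennreal ((cmod (D0 f (x, y)))\<^sup>2) \<partial>lborel)"
proof -
  let ?I = "indicator (dyadic_cell k (dyadic_index k x)) :: real^3 \<Rightarrow> complex"
  have [measurable]: "f \<in> borel_measurable borel" using f by (simp add: square_integrable_def)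
  have sq: "square_integrable lborel (\<lambda>y. ?I y * (f y - f x))"
    unfolding right_diff_distrib
    by (intro square_integrable_diff square_integrable_cell_mult f square_integrable_indicator_cell)
  have "(cmod (f x - dyadic_projection k f x))\<^sup>2 = (cmod (dyadic_average k (\<lambda>y. f y - f x) (dyadic_index k x)))\<^sup>2"
    by (simp add: dyadic_average_const_diff[OF f] dyadic_projection_def norm_minus_commute)
  also have "\<dots> \<le> 8 ^ k * L2sq (\<lambda>y. ?I y * (f y - f x))"
    by (rule dyadic_average_square_le[OF sq])
  finally have "ennreal ((cmod (f x - dyadic_projection k f x))\<^sup>2)
    \<le> ennreal (8 ^ k * L2sq (\<lambda>y. ?I y * (f y - f x)))" by (rule ennreal_leI)
  also have "\<dots> = ennreal (8 ^ k) * (\<integral>\<^sup>+y. ennreal ((cmod (?I y * (f y - f x)))\<^sup>2) \<partial>lborel)"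
    by (simp add: nn_integral_square[OF sq] ennreal_mult)
  also have "\<dots> = (\<integral>\<^sup>+y. ennreal (8 ^ k * (cmod (?I y * (f y - f x)))\<^sup>2) \<partial>lborel)"
    using square_integrableD(1)[OF sq] by (subst nn_integral_cmult[symmetric]) (auto simp: ennreal_mult)
  also have "\<dots> \<le> (\<integral>\<^sup>+y. ennreal (c\<^sub>1 * \<omega> ^ k) * ennreal ((cmod (D0 f (x, y)))\<^sup>2) \<partial>lborel)"
  proof (rule nn_integral_mono)
    fix y
    have "8 ^ k * (cmod (?I y * (f y - f x)))\<^sup>2 \<le> (c\<^sub>1 * \<omega> ^ k) * (cmod (D0 f (x, y)))\<^sup>2"
    proof (cases "dyadic_index k y = dyadic_index k x")
      case True
      have "(cmod (f y - f x))\<^sup>2 \<le> (3 / 2 ^ k) powr (3 + 2 * s) * (cmod (D0 f (x, y)))\<^sup>2"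
        by (rule difference_le_quotient[OF dyadic_diameter]) (use True in simp)
      then have "8 ^ k * (cmod (f y - f x))\<^sup>2 \<le> 8 ^ k * ((3 / 2 ^ k) powr (3 + 2 * s) * (cmod (D0 f (x, y)))\<^sup>2)"
        by (intro mult_left_mono) auto
      then show ?thesis using True unfolding scale_constant[symmetric] by (simp add: dyadic_cell_def mult.assoc)
    qed (use c1_pos \<omega>_bounds in \<open>simp add: dyadic_cell_def\<close>)
    then show "ennreal (8 ^ k * (cmod (?I y * (f y - f x)))\<^sup>2) \<le> ennreal (c\<^sub>1 * \<omega> ^ k) * ennreal ((cmod (D0 f (x, y)))\<^sup>2)"
      using c1_pos \<omega>_bounds by (subst ennreal_mult[symmetric]) (auto intro: ennreal_leI)
  qed
  finally show ?thesis .
qed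

lemma projection_error:
  assumes f: "f \<in> HS"
  shows "square_integrable lborel (\<lambda>x. f x - dyadic_projection k f x)"
    and "N (\<lambda>x. f x - dyadic_projection k f x) \<le> c\<^sub>1 * \<omega> ^ k * E f"
proof -
  have fm[measurable]: "f \<in> borel_measurable borel" by (rule HA_measurable[OF f])
  have [measurable]: "D0 f \<in> borel_measurable borel" by (intro quotient_measurable) auto
  have c0: "0 \<le> c\<^sub>1 * \<omega> ^ k" using c1_pos \<omega>_bounds by simp
  have m: "(\<lambda>x. f x - dyadic_projection k f x) \<in> borel_measurable lborel" by measurable
  have "(\<integral>\<^sup>+x. ennreal ((cmod (f x - dyadic_projection k f x))\<^sup>2) \<partial>lborel)
      \<le> (\<integral>\<^sup>+x. (\<integral>\<^sup>+y. ennreal (c\<^sub>1 * \<omega> ^ k) * ennreal ((cmod (D0 f (x, y)))\<^sup>2) \<partial>lborel) \<partial>lborel)"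
    by (intro nn_integral_mono projection_error_pointwise HA_L2[OF f])
  also have "\<dots> = (\<integral>\<^sup>+z. ennreal (c\<^sub>1 * \<omega> ^ k) * ennreal ((cmod (D0 f z))\<^sup>2) \<partial>lborel)"
    unfolding lborel_prod[symmetric]
    by (rule lborel.nn_integral_fst) (simp add: lborel_prod)
  also have "\<dots> = ennreal (c\<^sub>1 * \<omega> ^ k * E f)"
    using c0 by (subst nn_integral_cmult) (auto simp: nn_integral_square[OF HA_D(1)[OF f]] E_def ennreal_mult)
  finally have le: "(\<integral>\<^sup>+x. ennreal ((cmod (f x - dyadic_projection k f x))\<^sup>2) \<partial>lborel) \<le> ennreal (c\<^sub>1 * \<omega> ^ k * E f)" .
  then show sq: "square_integrable lborel (\<lambda>x. f x - dyadic_projection k f x)"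
    by (subst square_integrable_nn[OF m]) (auto intro: le_less_trans)
  show "N (\<lambda>x. f x - dyadic_projection k f x) \<le> c\<^sub>1 * \<omega> ^ k * E f"
    using le c0 E_nonneg[of f] unfolding nn_integral_square[OF sq] N_def by simp
qed

lemma N_add_le:
  assumes "square_integrable lborel f" "square_integrable lborel g"
  shows "N (\<lambda>x. f x + g x) \<le> 2 * N f + 2 * N g"
proof -
  have "N (\<lambda>x. f x + g x) \<le> (\<integral>x. 2 * (cmod (f x))\<^sup>2 + 2 * (cmod (g x))\<^sup>2 \<partial>lborel)"
    unfolding N_def
    by (rule integral_mono) (use assms square_integrable_add[OF assms] in \<open>auto simp: square_integrable_def cmod_add_squared_le\<close>)
  also have "\<dots> = 2 * N f + 2 * N g" using assms by (simp add: N_def square_integrable_def)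
  finally show ?thesis .
qed

lemma N_diff_le:
  assumes "square_integrable lborel f" "square_integrable lborel g"
  shows "N (\<lambda>x. f x - g x) \<le> 2 * N f + 2 * N g"
  using N_add_le[OF assms(1) square_integrable_cmult[OF assms(2), of "-1"]] by (simp add: N_def)

lemma projection_square_integrable:
  assumes f: "f \<in> HS"
  shows "square_integrable lborel (dyadic_projection k f)" "N (dyadic_projection k f) \<le> 2 * N f + 2 * c\<^sub>1 * E f"
proof -
  let ?d = "\<lambda>x. f x - dyadic_projection k f x"
  have eq: "dyadic_projection k f = (\<lambda>x. f x - ?d x)" by simp
  have 1: "square_integrable lborel (\<lambda>x. f x - ?d x)"
    by (rule square_integrable_diff[OF HA_L2(1)[OF f] projection_error(1)[OF f]])
  then show "square_integrable lborel (dyadic_projection k f)" by simp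
  have "N (\<lambda>x. f x - ?d x) \<le> 2 * N f + 2 * N ?d"
    by (rule N_diff_le[OF HA_L2(1)[OF f] projection_error(1)[OF f]])
  also have "N ?d \<le> c\<^sub>1 * \<omega> ^ k * E f" by (rule projection_error[OF f])
  also have "\<dots> \<le> c\<^sub>1 * 1 * E f"
    using c1_pos \<omega>_bounds E_nonneg by (intro mult_right_mono mult_left_mono power_le_one) auto
  finally show "N (dyadic_projection k f) \<le> 2 * N f + 2 * c\<^sub>1 * E f" by simp
qed

lemma projection_sup:
  assumes f: "square_integrable lborel f" and \<delta>: "\<And>m. L2sq (\<lambda>y. indicator (dyadic_cell k m) y * f y) \<le> \<delta>"
  shows "(cmod (dyadic_projection k f x))\<^sup>2 \<le> 8 ^ k * \<delta>"
  unfolding dyadic_projection_def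
  by (rule order_trans[OF dyadic_average_square_le[OF square_integrable_cell_mult[OF f]]]) (simp add: \<delta>)

text \<open>The martingale differences of the dyadic projections.\<close>

definition increment :: "(real^3 \<Rightarrow> complex) \<Rightarrow> nat \<Rightarrow> real^3 \<Rightarrow> complex" where
  "increment f k x = dyadic_projection (Suc k) f x - dyadic_projection k f x"

text \<open>As the coarser projection is constant on finer cells, the increment is the average over
  a cell of generation \<open>k + 1\<close> of the projection error of generation \<open>k\<close>.
  Jensen costs \<open>8^(k+1)\<close>, and the error contributes \<open>\<omega>^k\<close>.\<close>

lemma increment_sup:
  assumes f: "f \<in> HS"
  shows "(cmod (increment f k x))\<^sup>2 \<le> 8 * c\<^sub>1 * E f * (8 * \<omega>) ^ k"
proof -
  let ?m = "dyadic_index (Suc k) x"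
  let ?I = "indicator (dyadic_cell (Suc k) ?m) :: real^3 \<Rightarrow> complex"
  let ?g = "\<lambda>y. f y - dyadic_projection k f y"
  have "increment f k x = dyadic_average (Suc k) (\<lambda>y. f y - dyadic_projection k f x) ?m"
    by (simp add: increment_def dyadic_projection_def dyadic_average_const_diff[OF HA_L2(1)[OF f]])
  also have "\<dots> = dyadic_average (Suc k) ?g ?m"
  proof (rule dyadic_average_cong)
    fix y assume "dyadic_index (Suc k) y = ?m"
    then have "dyadic_index k y = dyadic_index k x" by (rule dyadic_index_Suc)
    then show "f y - dyadic_projection k f x = ?g y" by (simp add: dyadic_projection_def)
  qed
  finally have "(cmod (increment f k x))\<^sup>2 \<le> 8 ^ Suc k * L2sq (\<lambda>y. ?I y * ?g y)"
    by (simp only:) (rule dyadic_average_square_le[OF square_integrable_cell_mult[OF projection_error(1)[OF f]]])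
  also have "\<dots> \<le> 8 ^ Suc k * (c\<^sub>1 * \<omega> ^ k * E f)"
  proof (rule mult_left_mono)
    have "L2sq (\<lambda>y. ?I y * ?g y) \<le> N ?g" unfolding N_def
      by (rule integral_mono)
         (use square_integrable_cell_mult[OF projection_error(1)[OF f]] projection_error(1)[OF f] in
           \<open>auto simp: square_integrable_def indicator_def\<close>)
    also have "\<dots> \<le> c\<^sub>1 * \<omega> ^ k * E f" by (rule projection_error(2)[OF f])
    finally show "L2sq (\<lambda>y. ?I y * ?g y) \<le> c\<^sub>1 * \<omega> ^ k * E f" .
  qed simp
  finally show ?thesis by (simp add: power_mult_distrib mult_ac)
qed

lemma increment_L2:
  assumes f: "f \<in> HS"
  shows "square_integrable lborel (increment f k)" "N (increment f k) \<le> 4 * c\<^sub>1 * E f * \<omega> ^ k"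
proof -
  let ?d = "\<lambda>k x. f x - dyadic_projection k f x"
  have eq: "increment f k = (\<lambda>x. ?d k x - ?d (Suc k) x)" by (auto simp: increment_def)
  show "square_integrable lborel (increment f k)"
    unfolding eq by (rule square_integrable_diff[OF projection_error(1)[OF f] projection_error(1)[OF f]])
  have "N (increment f k) \<le> 2 * N (?d k) + 2 * N (?d (Suc k))"
    unfolding eq by (rule N_diff_le[OF projection_error(1)[OF f] projection_error(1)[OF f]])
  also have "\<dots> \<le> 2 * (c\<^sub>1 * \<omega> ^ k * E f) + 2 * (c\<^sub>1 * \<omega> ^ Suc k * E f)"
    by (intro add_mono mult_left_mono projection_error f) auto
  also have "\<dots> \<le> 2 * (c\<^sub>1 * \<omega> ^ k * E f) + 2 * (c\<^sub>1 * \<omega> ^ k * E f)"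
    using c1_pos \<omega>_bounds E_nonneg[of f]
    by (intro add_mono mult_left_mono mult_right_mono power_decreasing) auto
  finally show "N (increment f k) \<le> 4 * c\<^sub>1 * E f * \<omega> ^ k" by simp
qed

text \<open>The squared errors have geometrically decaying integrals, so their sum is finite almost
  everywhere and the whole sequence of errors tends to 0 there.\<close>

lemma projection_tendsto:
  assumes f: "f \<in> HS"
  shows "AE x in lborel. (\<lambda>k. dyadic_projection k f x) \<longlonglongrightarrow> f x"
proof -
  let ?d = "\<lambda>k x. f x - dyadic_projection k f x"
  have [measurable]: "f \<in> borel_measurable borel" by (rule HA_measurable[OF f])
  have "(\<integral>\<^sup>+x. (\<Sum>k. ennreal ((cmod (?d k x))\<^sup>2)) \<partial>lborel) = (\<Sum>k. ennreal (N (?d k)))"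
    by (subst nn_integral_suminf) (auto simp: nn_integral_square[OF projection_error(1)[OF f]] N_def)
  also have "\<dots> \<le> (\<Sum>k. ennreal (c\<^sub>1 * E f * \<omega> ^ k))"
    by (intro suminf_le ennreal_leI) (use projection_error(2)[OF f] in \<open>auto simp: mult_ac\<close>)
  also have "\<dots> = ennreal (\<Sum>k. c\<^sub>1 * E f * \<omega> ^ k)"
    using c1_pos \<omega>_bounds E_nonneg[of f] by (intro suminf_ennreal2 summable_mult summable_geometric) auto
  finally have "(\<integral>\<^sup>+x. (\<Sum>k. ennreal ((cmod (?d k x))\<^sup>2)) \<partial>lborel) \<noteq> \<infinity>"
    by (auto simp: top_unique)
  then have "AE x in lborel. (\<Sum>k. ennreal ((cmod (?d k x))\<^sup>2)) \<noteq> \<infinity>"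
    by (intro nn_integral_noteq_infinite) auto
  then show ?thesis
  proof eventually_elim
    case (elim x)
    have "summable (\<lambda>k. (cmod (?d k x))\<^sup>2)"
      by (rule summable_suminf_not_top) (use elim in auto)
    then have "(\<lambda>k. (cmod (?d k x))\<^sup>2) \<longlonglongrightarrow> 0" by (rule summable_LIMSEQ_zero)
    then have "(\<lambda>k. sqrt ((cmod (?d k x))\<^sup>2)) \<longlonglongrightarrow> sqrt 0" by (rule tendsto_real_sqrt)
    then have "(\<lambda>k. ?d k x) \<longlonglongrightarrow> 0" by (simp add: tendsto_norm_zero_iff)
    then have "(\<lambda>k. f x - ?d k x) \<longlonglongrightarrow> f x - 0" by (intro tendsto_intros)
    then show ?case by simp
  qed
qed

end

section \<open>From dyadic increments to L^p integrals\<close>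

lemma ennreal_le_suminf:
  fixes f :: "nat \<Rightarrow> ennreal" shows "f i \<le> (\<Sum>i. f i)"
proof -
  have "sum f {i} \<le> (\<Sum>i. f i)" by (rule sum_le_suminf) auto
  then show ?thesis by simp
qed

text \<open>If the increments of a sequence sum up to at least \<open>T\<close>, one of them must exceed its share of \<open>T\<close>;
  this replaces the triangle inequality for infinite sums in \<open>L^p\<close>.\<close>

lemma powr_le_weighted_suminf:
  fixes g :: "nat \<Rightarrow> complex" and a :: "nat \<Rightarrow> real"
  assumes lim: "g \<longlonglongrightarrow> l" and a: "\<And>i. 0 < a i" "\<And>n. (\<Sum>i<n. a i) \<le> 1 / 2" and p: "0 < p"
  shows "ennreal (cmod (l - g 0) powr p) \<le> (\<Sum>i. ennreal (cmod (g (Suc i) - g i) powr p / a i powr p))"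
proof (cases "l = g 0")
  case False
  define T where "T = cmod (l - g 0)"
  have T: "0 < T" using False by (simp add: T_def)
  have "\<exists>i. a i * T \<le> cmod (g (Suc i) - g i)"
  proof (rule ccontr)
    assume "\<not> ?thesis"
    then have lt: "cmod (g (Suc i) - g i) \<le> a i * T" for i by (auto simp: not_le less_imp_le)
    have "cmod (g n - g 0) \<le> T / 2" for n
    proof -
      have "cmod (g n - g 0) = cmod (\<Sum>i<n. g (Suc i) - g i)" by (simp add: sum_lessThan_telescope)
      also have "\<dots> \<le> (\<Sum>i<n. a i * T)" by (rule sum_norm_le) (use lt in auto)
      also have "\<dots> = (\<Sum>i<n. a i) * T" by (simp add: sum_distrib_right)
      also have "\<dots> \<le> 1 / 2 * T" using a(2)[of n] T by (intro mult_right_mono) auto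
      finally show ?thesis by simp
    qed
    moreover have "(\<lambda>n. cmod (g n - g 0)) \<longlonglongrightarrow> T" unfolding T_def by (intro tendsto_intros lim)
    ultimately have "T \<le> T / 2" by (intro LIMSEQ_le_const2[of _ T]) auto
    then show False using T by simp
  qed
  then obtain i where i: "a i * T \<le> cmod (g (Suc i) - g i)" by blast
  have "(a i * T) powr p \<le> cmod (g (Suc i) - g i) powr p"
    using i a(1)[of i] T p by (intro powr_mono2) auto
  then have "T powr p \<le> cmod (g (Suc i) - g i) powr p / a i powr p"
    using a(1)[of i] T by (simp add: powr_mult field_simps)
  then have "ennreal (T powr p) \<le> ennreal (cmod (g (Suc i) - g i) powr p / a i powr p)" by (rule ennreal_leI)
  also have "\<dots> \<le> (\<Sum>i. ennreal (cmod (g (Suc i) - g i) powr p / a i powr p))"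
    by (rule ennreal_le_suminf)
  finally show ?thesis by (simp add: T_def)
qed (use p in simp)

text \<open>Interpolation of \<open>L^p\<close> between \<open>L^2\<close> and the supremum norm, in
  pointwise form.\<close>

lemma powr_le_of_square_le:
  fixes z b p :: real
  assumes "0 \<le> z" "z\<^sup>2 \<le> b" "2 < p"
  shows "z powr p \<le> b powr ((p - 2) / 2) * z\<^sup>2"
proof (cases "z = 0")
  case False
  then have z: "0 < z" using assms by simp
  have "z powr p = z powr (p - 2) * z powr 2" by (simp add: powr_add[symmetric])
  also have "z powr (p - 2) = (z powr 2) powr ((p - 2) / 2)"
  proof -
    have "2 * ((p - 2) / 2) = p - 2" by simp
    then show ?thesis by (simp only: powr_powr)
  qed
  also have "z powr 2 = z\<^sup>2" using z by simp
  also have "(z\<^sup>2) powr ((p - 2) / 2) * z\<^sup>2 \<le> b powr ((p - 2) / 2) * z\<^sup>2"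
    using assms by (intro mult_right_mono powr_mono2) auto
  finally show ?thesis .
qed (use assms in auto)

locale fractional_subcritical = fractional_order +
  fixes p :: real
  assumes p: "2 < p" "p < 6 / (3 - 2 * s)"
begin

abbreviation nnLp :: "(real^3 \<Rightarrow> complex) \<Rightarrow> ennreal" where
  "nnLp u \<equiv> \<integral>\<^sup>+x. ennreal (cmod (u x) powr p) \<partial>lborel"

definition \<rho> :: real where "\<rho> = (8 * \<omega>) powr ((p - 2) / 2) * \<omega>"

text \<open>By interpolation an increment has \<open>L^p\<close> integral at most its supremum to
  the power \<open>p - 2\<close> times its squared \<open>L^2\<close> norm, whence the ratio
  \<open>\<rho>\<close>. Since \<open>8 * \<omega> = 2 powr (3 - 2 * s)\<close>, it is 2 to the
  power \<open>(3 - 2 * s) * (p - 2) / 2 - 2 * s\<close>, which is negative exactly for subcritical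
  \<open>p\<close>.\<close>

lemma \<rho>_bounds: "0 < \<rho>" "\<rho> < 1"
proof -
  have "(8::real) = 2 powr 3" by simp
  then have "8 * \<omega> = 2 powr (3 - 2 * s)" by (simp add: \<omega>_def powr_diff powr_minus field_simps)
  then have "\<rho> = 2 powr ((3 - 2 * s) * ((p - 2) / 2) - 2 * s)"
    by (simp add: \<rho>_def powr_powr \<omega>_def powr_add[symmetric])
  moreover have "(3 - 2 * s) * ((p - 2) / 2) - 2 * s < 0"
    using p s by (simp add: field_simps)
  ultimately show "0 < \<rho>" "\<rho> < 1" using powr_less_mono[of "(3 - 2 * s) * ((p - 2) / 2) - 2 * s" 0 2] by auto
qed

definition c\<^sub>2 :: real where "c\<^sub>2 = 4 * c\<^sub>1 * (8 * c\<^sub>1) powr ((p - 2) / 2)"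

lemma increment_Lp:
  assumes f: "f \<in> HS"
  shows "nnLp (increment f k) \<le> ennreal (c\<^sub>2 * E f powr (p / 2) * \<rho> ^ k)"
proof -
  define b where "b = (8 * c\<^sub>1 * E f * (8 * \<omega>) ^ k) powr ((p - 2) / 2)"
  have b: "0 \<le> b" by (simp add: b_def)
  have [measurable]: "increment f k \<in> borel_measurable borel"
    using square_integrableD(1)[OF increment_L2(1)[OF f]] by simp
  have "nnLp (increment f k) \<le> (\<integral>\<^sup>+x. ennreal b * ennreal ((cmod (increment f k x))\<^sup>2) \<partial>lborel)"
    using powr_le_of_square_le[OF _ increment_sup[OF f] p(1)]
    by (intro nn_integral_mono) (auto simp: b_def ennreal_mult[symmetric] intro!: ennreal_leI)
  also have "\<dots> = ennreal (b * N (increment f k))"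
    using b by (subst nn_integral_cmult) (auto simp: nn_integral_square[OF increment_L2(1)[OF f]] N_def ennreal_mult)
  also have "\<dots> \<le> ennreal (b * (4 * c\<^sub>1 * E f * \<omega> ^ k))"
    using b by (intro ennreal_leI mult_left_mono increment_L2 f)
  also have "b * (4 * c\<^sub>1 * E f * \<omega> ^ k) = c\<^sub>2 * E f powr (p / 2) * \<rho> ^ k"
  proof -
    have "((8 * \<omega>) ^ k) powr ((p - 2) / 2) = ((8 * \<omega>) powr ((p - 2) / 2)) ^ k"
      using \<omega>_bounds by (intro power_powr_commute) simp
    moreover have "E f powr ((p - 2) / 2) * E f = E f powr (p / 2)"
    proof (cases "E f = 0")
      case False
      then have "0 < E f" using E_nonneg[of f] by simp
      then have "E f powr ((p - 2) / 2) * E f powr 1 = E f powr ((p - 2) / 2 + 1)" by (simp only: powr_add)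
      then show ?thesis using \<open>0 < E f\<close> by (simp add: diff_divide_distrib)
    qed simp
    ultimately show ?thesis
      using c1_pos \<omega>_bounds E_nonneg[of f]
      by (simp add: b_def c\<^sub>2_def \<rho>_def powr_mult power_mult_distrib algebra_simps)
  qed
  finally show ?thesis .
qed

definition c\<^sub>3 :: real where
  "c\<^sub>3 = c\<^sub>2 * ((1 - \<rho> powr (1 / (2 * p))) / 2) powr (- p) / (1 - sqrt \<rho>)"

text \<open>Generation \<open>k\<close> separates two effects: the projection is bounded by the
  local mass \<open>\<delta>\<close>, and the tail of increments is of order
  \<open>\<rho>^k\<close>. Choosing \<open>k\<close> large and then \<open>\<delta>\<close> small
  makes both small; \<open>k = 0\<close> gives the Sobolev inequality.\<close>

lemma Lp_estimate:
  assumes f: "f \<in> HS" and \<delta>: "\<And>m. L2sq (\<lambda>y. indicator (dyadic_cell k m) y * f y) \<le> \<delta>"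
  shows "nnLp f \<le>
    ennreal (2 powr p * ((8 ^ k * \<delta>) powr ((p - 2) / 2) * (2 * N f + 2 * c\<^sub>1 * E f) + c\<^sub>3 * E f powr (p / 2) * \<rho> ^ k))"
proof -
  let ?P = "\<lambda>k. dyadic_projection k f"
  have [measurable]: "f \<in> borel_measurable borel" by (rule HA_measurable[OF f])
  have [measurable]: "increment f k \<in> borel_measurable borel" for k
    using square_integrableD(1)[OF increment_L2(1)[OF f]] by simp
  \<comment> \<open>Here \<open>r powr p = sqrt \<rho>\<close>. The weights \<open>a i\<close> sum
    to at most 1/2, and dividing by \<open>a i powr p\<close> costs
    \<open>(1 / sqrt \<rho>)^i\<close> against the decay \<open>\<rho>^i\<close> of the increments;
    what remains is a geometric series in \<open>sqrt \<rho>\<close>, whose sum is visible in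
    \<open>c\<^sub>3\<close>.\<close>
  define r where "r = \<rho> powr (1 / (2 * p))"
  have r: "0 < r" "r < 1" using \<rho>_bounds p powr_less_mono2[of "1 / (2 * p)" \<rho> 1] by (auto simp: r_def)
  define a where "a i = (1 - r) / 2 * r ^ i" for i :: nat
  have a0: "0 < a i" for i using r by (simp add: a_def)
  have asum: "(\<Sum>i<n. a i) \<le> 1 / 2" for n
  proof -
    have "(\<Sum>i<n. a i) = (1 - r) / 2 * (\<Sum>i<n. r ^ i)" by (simp add: a_def sum_distrib_left)
    also have "(\<Sum>i<n. r ^ i) = (1 - r ^ n) / (1 - r)" using r by (simp add: sum_gp_strict)
    also have "(1 - r) / 2 * ((1 - r ^ n) / (1 - r)) = (1 - r ^ n) / 2"
    proof -
      have "1 - r \<noteq> 0" using r by simp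
      then show ?thesis by (simp add: field_simps)
    qed
    also have "\<dots> \<le> 1 / 2" using r by simp
    finally show ?thesis .
  qed
  have ap: "1 / a i powr p = ((1 - r) / 2) powr (- p) * (1 / sqrt \<rho>) ^ i" for i
  proof -
    have "a i powr p = ((1 - r) / 2) powr p * (r ^ i) powr p"
      unfolding a_def by (rule powr_mult)
    also have "(r ^ i) powr p = (r powr p) ^ i" by (rule power_powr_commute[OF r(1)])
    also have "r powr p = sqrt \<rho>"
      using p \<rho>_bounds by (simp add: r_def powr_powr powr_half_sqrt)
    finally show ?thesis by (simp add: powr_minus_divide power_divide)
  qed
  define S where "S x = (\<Sum>i. ennreal (cmod (increment f (k + i) x) powr p / a i powr p))" for x
  have "AE x in lborel. ennreal (cmod (f x) powr p) \<le> ennreal (2 powr p) * (ennreal (cmod (?P k x) powr p) + S x)"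
    using projection_tendsto[OF f]
  proof eventually_elim
    case (elim x)
    have lim: "(\<lambda>i. ?P (k + i) x) \<longlonglongrightarrow> f x" using LIMSEQ_ignore_initial_segment[OF elim, of k] by (simp add: add.commute)
    have *: "ennreal (cmod (f x - ?P k x) powr p) \<le> S x"
    proof -
      have "0 < p" using p by simp
      from powr_le_weighted_suminf[OF lim a0 asum this] show ?thesis
        by (simp only: S_def increment_def add_Suc_right add_0_right)
    qed
    have "cmod (f x) \<le> cmod (?P k x) + cmod (f x - ?P k x)" by (rule norm_triangle_sub)
    then have "cmod (f x) powr p \<le> (1 + 1) powr p * cmod (?P k x) powr p + (1 + 1 / 1) powr p * cmod (f x - ?P k x) powr p"
      using p by (intro powr_le_of_le_add) auto
    then have "ennreal (cmod (f x) powr p) \<le> ennreal (2 powr p * (cmod (?P k x) powr p + cmod (f x - ?P k x) powr p))"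
      by (intro ennreal_leI) (simp add: algebra_simps)
    also have "\<dots> = ennreal (2 powr p) * (ennreal (cmod (?P k x) powr p) + ennreal (cmod (f x - ?P k x) powr p))"
      by (simp add: ennreal_mult)
    also have "\<dots> \<le> ennreal (2 powr p) * (ennreal (cmod (?P k x) powr p) + S x)"
      by (intro mult_left_mono add_left_mono *) auto
    finally show ?case .
  qed
  then have "nnLp f \<le> (\<integral>\<^sup>+x. ennreal (2 powr p) * (ennreal (cmod (?P k x) powr p) + S x) \<partial>lborel)"
    by (rule nn_integral_mono_AE)
  also have "\<dots> = ennreal (2 powr p) * (nnLp (?P k) + (\<integral>\<^sup>+x. S x \<partial>lborel))"
    unfolding S_def by (subst nn_integral_cmult, measurable, subst nn_integral_add) auto
  finally have split: "nnLp f
    \<le> ennreal (2 powr p) * (nnLp (?P k) + (\<integral>\<^sup>+x. S x \<partial>lborel))" .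
  have part1: "nnLp (?P k) \<le> ennreal ((8 ^ k * \<delta>) powr ((p - 2) / 2) * (2 * N f + 2 * c\<^sub>1 * E f))"
  proof -
    define b where "b = (8 ^ k * \<delta>) powr ((p - 2) / 2)"
    have b: "0 \<le> b" by (simp add: b_def)
    have "nnLp (?P k) \<le> (\<integral>\<^sup>+x. ennreal b * ennreal ((cmod (?P k x))\<^sup>2) \<partial>lborel)"
      using powr_le_of_square_le[OF _ projection_sup[OF HA_L2(1)[OF f] \<delta>] p(1)]
      by (intro nn_integral_mono) (auto simp: b_def ennreal_mult[symmetric] intro!: ennreal_leI)
    also have "\<dots> = ennreal (b * N (?P k))"
      using b by (subst nn_integral_cmult)
        (auto simp: nn_integral_square[OF projection_square_integrable(1)[OF f]] N_def ennreal_mult)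
    also have "\<dots> \<le> ennreal (b * (2 * N f + 2 * c\<^sub>1 * E f))"
      using b by (intro ennreal_leI mult_left_mono projection_square_integrable f)
    finally show ?thesis unfolding b_def .
  qed
  have part2: "(\<integral>\<^sup>+x. S x \<partial>lborel) \<le> ennreal (c\<^sub>3 * E f powr (p / 2) * \<rho> ^ k)"
  proof -
    define d where "d = c\<^sub>2 * ((1 - r) / 2) powr (- p) * E f powr (p / 2) * \<rho> ^ k"
    have c2: "0 \<le> c\<^sub>2" using c1_pos by (simp add: c\<^sub>2_def)
    have d: "0 \<le> d" using c2 \<rho>_bounds by (simp add: d_def)
    have sq: "0 < sqrt \<rho>" "sqrt \<rho> < 1" "sqrt \<rho> * sqrt \<rho> = \<rho>" using \<rho>_bounds by auto
    have "(\<integral>\<^sup>+x. S x \<partial>lborel) = (\<Sum>i. \<integral>\<^sup>+x. ennreal (cmod (increment f (k + i) x) powr p / a i powr p) \<partial>lborel)"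
      unfolding S_def by (rule nn_integral_suminf) simp
    also have "\<dots> \<le> (\<Sum>i. ennreal (d * sqrt \<rho> ^ i))"
    proof (intro suminf_le)
      fix i
      have "(\<integral>\<^sup>+x. ennreal (cmod (increment f (k + i) x) powr p / a i powr p) \<partial>lborel)
          = ennreal (1 / a i powr p) * nnLp (increment f (k + i))"
        by (subst nn_integral_cmult[symmetric]) (auto simp: ennreal_mult'[symmetric])
      also have "\<dots> \<le> ennreal (1 / a i powr p) * ennreal (c\<^sub>2 * E f powr (p / 2) * \<rho> ^ (k + i))"
        by (intro mult_left_mono increment_Lp f) auto
      also have "\<dots> = ennreal (1 / a i powr p * (c\<^sub>2 * E f powr (p / 2) * \<rho> ^ (k + i)))"
        by (rule ennreal_mult'[symmetric]) simp
      also have "1 / a i powr p * (c\<^sub>2 * E f powr (p / 2) * \<rho> ^ (k + i)) = d * ((1 / sqrt \<rho>) ^ i * \<rho> ^ i)"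
        unfolding ap d_def by (simp add: power_add)
      also have "(1 / sqrt \<rho>) ^ i * \<rho> ^ i = sqrt \<rho> ^ i"
        unfolding power_mult_distrib[symmetric] using real_div_sqrt[of \<rho>] \<rho>_bounds by simp
      finally show "(\<integral>\<^sup>+x. ennreal (cmod (increment f (k + i) x) powr p / a i powr p) \<partial>lborel) \<le> ennreal (d * sqrt \<rho> ^ i)" .
    qed auto
    also have "\<dots> = ennreal (\<Sum>i. d * sqrt \<rho> ^ i)"
      using d sq by (intro suminf_ennreal2 summable_mult summable_geometric) auto
    also have "(\<Sum>i. d * sqrt \<rho> ^ i) = d * (1 / (1 - sqrt \<rho>))"
      using sq by (subst suminf_mult) (auto simp: suminf_geometric)
    also have "\<dots> = c\<^sub>3 * E f powr (p / 2) * \<rho> ^ k"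
      by (simp add: d_def c\<^sub>3_def r_def)
    finally show ?thesis .
  qed
  have *: "nnLp f \<le> ennreal (2 powr p) *
        (ennreal ((8 ^ k * \<delta>) powr ((p - 2) / 2) * (2 * N f + 2 * c\<^sub>1 * E f)) + ennreal (c\<^sub>3 * E f powr (p / 2) * \<rho> ^ k))"
    by (rule order_trans[OF split]) (intro mult_left_mono add_mono part1 part2; simp)
  have "0 \<le> c\<^sub>3 * E f powr (p / 2) * \<rho> ^ k" "0 \<le> (8 ^ k * \<delta>) powr ((p - 2) / 2) * (2 * N f + 2 * c\<^sub>1 * E f)"
      using c1_pos \<rho>_bounds N_nonneg[of f] E_nonneg[of f] by (auto simp: c\<^sub>3_def c\<^sub>2_def)
  with * show ?thesis by (simp add: ennreal_mult ennreal_plus[symmetric] del: ennreal_plus)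
qed

end

section \<open>Compactness\<close>

context fractional_order
begin

text \<open>The phase has modulus 1, so the reverse triangle inequality compares the quotients
  pointwise. Estimates proved for the zero potential thereby hold for every potential with the same
  constants.\<close>

lemma diamagnetic:
  assumes u: "u \<in> HA A"
  shows "(\<lambda>x. complex_of_real (cmod (u x))) \<in> HS" "N (\<lambda>x. complex_of_real (cmod (u x))) \<le> Q A u"
    "E (\<lambda>x. complex_of_real (cmod (u x))) \<le> 2 / c_const s * Q A u"
proof -
  let ?a = "\<lambda>x. complex_of_real (cmod (u x))"
  have [measurable]: "u \<in> borel_measurable borel" by (rule HA_measurable[OF u])
  have le: "(cmod (D0 ?a z))\<^sup>2 \<le> (cmod (D A u z))\<^sup>2" for z
    unfolding cmod_quotient_squared
  proof (rule divide_right_mono)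
    define e where "e = exp (- \<i> * complex_of_real ((fst z - snd z) \<bullet> A ((1/2) *\<^sub>R (fst z + snd z))))"
    have ne: "cmod e = 1" unfolding e_def by (simp add: norm_exp_eq_Re)
    have "cmod (?a (fst z) - ?a (snd z)) = \<bar>cmod (e * u (fst z)) - cmod (u (snd z))\<bar>"
      by (simp add: norm_mult ne flip: of_real_diff)
    also have "\<dots> \<le> cmod (e * u (fst z) - u (snd z))" by (rule norm_triangle_ineq3)
    finally have "(cmod (?a (fst z) - ?a (snd z)))\<^sup>2 \<le> (cmod (e * u (fst z) - u (snd z)))\<^sup>2"
      by (rule power_mono) simp
    then show "(cmod (exp (- \<i> * complex_of_real ((fst z - snd z) \<bullet> 0)) * ?a (fst z) - ?a (snd z)))\<^sup>2
      \<le> (cmod (exp (- \<i> * complex_of_real ((fst z - snd z) \<bullet> A ((1 / 2) *\<^sub>R (fst z + snd z)))) * u (fst z) - u (snd z)))\<^sup>2"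
      unfolding e_def[symmetric] by simp
  qed simp
  have m: "?a \<in> borel_measurable borel" by measurable
  have 1: "square_integrable lborel ?a"
    using HA_L2[OF u] m by (simp add: square_integrable_def)
  have 2: "square_integrable lborel (D0 ?a)"
    by (rule square_integrable_bound[OF _ HA_D(2)[OF u]]) (use le quotient_measurable[OF _ m, of "\<lambda>x. 0"] in auto)
  show HS: "?a \<in> HS" using 1 2 by (simp add: HA_def)
  show "N ?a \<le> Q A u" using Q_bounds(1)[of u A] by (simp add: N_def)
  have "E ?a \<le> L2sq (D A u)"
    unfolding E_def by (rule integral_mono[OF HA_D(2)[OF HS] HA_D(2)[OF u]]) (rule le)
  also have "\<dots> \<le> 2 / c_const s * Q A u"
    using Q_bounds(2)[of A u] const_pos by (simp add: field_simps)
  finally show "E ?a \<le> 2 / c_const s * Q A u" .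
qed

lemma E_le_Q: "E u \<le> 2 / c_const s * Q (\<lambda>x. 0) u" and N_le_Q: "N u \<le> Q A u"
  using Q_bounds(2)[of "\<lambda>x. 0" u] Q_bounds(1)[of u A] const_pos by (simp_all add: field_simps E_def N_def)

lemma cell_integral_le_N:
  assumes f: "square_integrable lborel f"
  shows "L2sq (\<lambda>y. indicator (dyadic_cell k m) y * f y) \<le> N f"
  unfolding N_def
  by (rule integral_mono)
     (use square_integrable_cell_mult[OF f, of k m] f in \<open>auto simp: square_integrable_def indicator_def\<close>)

text \<open>A function in \<open>HS\<close> is determined up to a uniformly small error
  by its averages over the cells of a fixed generation.\<close>

lemma averages_imp_local_Cauchy:
  assumes g: "\<And>n. g n \<in> HS" and K: "\<And>n. N (g n) \<le> K" "\<And>n. E (g n) \<le> L"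
    and conv: "\<And>k m. convergent (\<lambda>n. dyadic_average k (g n) m)" and e: "0 < e" and b: "integrable lborel b" "\<And>x. 0 \<le> b x" "\<And>x. b x \<le> 1"
  shows "\<exists>M. \<forall>i\<ge>M. \<forall>j\<ge>M. (\<integral>x. b x * (cmod (g i x - g j x))\<^sup>2 \<partial>lborel) < e"
proof -
  have [measurable]: "g n \<in> borel_measurable borel" "b \<in> borel_measurable borel" for n
    using HA_measurable[OF g] b(1) by auto
  have K0: "0 \<le> K" and L0: "0 \<le> L" using K[of 0] N_nonneg[of "g 0"] E_nonneg[of "g 0"] by linarith+
  \<comment> \<open>The projection errors of \<open>g i\<close> and \<open>g j\<close> each enter
    with a factor 4, so together they cost less than \<open>e / 2\<close>. The two projected parts
    enter in the same way, hence the threshold \<open>e / 16\<close> below.\<close>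
  have "(\<lambda>k. 8 * (c\<^sub>1 * L * \<omega> ^ k)) \<longlonglongrightarrow> 8 * (c\<^sub>1 * L * 0)"
    using \<omega>_bounds by (intro tendsto_intros LIMSEQ_power_zero) auto
  then have "eventually (\<lambda>k. 8 * (c\<^sub>1 * L * \<omega> ^ k) < e / 2) sequentially"
    by (rule order_tendstoD) (use e in simp)
  then obtain k where k: "8 * (c\<^sub>1 * L * \<omega> ^ k) < e / 2" by (auto simp: eventually_sequentially)
  let ?P = "\<lambda>n. dyadic_projection k (g n)"
  define l where "l x = lim (\<lambda>n. ?P n x)" for x
  have lm[measurable]: "l \<in> borel_measurable borel"
    unfolding l_def by (rule borel_measurable_lim_metric) measurable
  have Pl: "(\<lambda>n. ?P n x) \<longlonglongrightarrow> l x" for x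
    using conv[of k "dyadic_index k x"] unfolding l_def dyadic_projection_def convergent_LIMSEQ_iff .
  have PK: "(cmod (?P n x))\<^sup>2 \<le> 8 ^ k * K" for n x
    by (rule projection_sup[OF HA_L2(1)[OF g]]) (use cell_integral_le_N[OF HA_L2(1)[OF g]] K(1) order_trans in blast)
  have lK: "(cmod (l x))\<^sup>2 \<le> 8 ^ k * K" for x
    by (rule LIMSEQ_le_const2[OF tendsto_power[OF tendsto_norm[OF Pl]]]) (use PK in auto)
  have PlK: "(cmod (?P n x - l x))\<^sup>2 \<le> 4 * (8 ^ k * K)" for n x
    using cmod_diff_squared_le[of "?P n x" "l x"] PK[of n x] lK[of x] by linarith
  define t where "t n = (\<integral>x. b x * (cmod (?P n x - l x))\<^sup>2 \<partial>lborel)" for n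
  have ti: "integrable lborel (\<lambda>x. b x * (cmod (?P n x - l x))\<^sup>2)" for n
  proof (rule Bochner_Integration.integrable_bound)
    show "integrable lborel (\<lambda>x. b x * (4 * (8 ^ k * K)))" using b(1) by simp
    show "AE x in lborel. norm (b x * (cmod (?P n x - l x))\<^sup>2) \<le> norm (b x * (4 * (8 ^ k * K)))"
      using PlK b(2) K0 by (intro AE_I2) (auto simp: abs_mult intro!: mult_left_mono)
  qed auto
  have "t \<longlonglongrightarrow> (\<integral>x. 0 \<partial>(lborel :: (real^3) measure))"
    unfolding t_def
  proof (rule integral_dominated_convergence[where w = "\<lambda>x. b x * (4 * (8 ^ k * K))"])
    have "(\<lambda>n. b x * (cmod (?P n x - l x))\<^sup>2) \<longlonglongrightarrow> b x * (cmod (l x - l x))\<^sup>2" for x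
      by (intro tendsto_intros Pl)
    then show "AE x in lborel. (\<lambda>n. b x * (cmod (?P n x - l x))\<^sup>2) \<longlonglongrightarrow> 0" by simp
    show "AE x in lborel. norm (b x * (cmod (?P n x - l x))\<^sup>2) \<le> b x * (4 * (8 ^ k * K))" for n
      using PlK b(2) K0 by (intro AE_I2) (auto simp: abs_mult intro!: mult_left_mono)
  qed (use b(1) in auto)
  then have "eventually (\<lambda>n. t n < e / 16) sequentially"
    by (intro order_tendstoD) (use e in auto)
  then obtain M where M: "\<And>n. n \<ge> M \<Longrightarrow> t n < e / 16" by (auto simp: eventually_sequentially)
  let ?d = "\<lambda>n x. g n x - ?P n x"
  have di: "integrable lborel (\<lambda>x. (cmod (?d n x))\<^sup>2)" for n
    using projection_error(1)[OF g] by (simp add: square_integrable_def)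
  have dN: "L2sq (?d n) \<le> c\<^sub>1 * L * \<omega> ^ k" for n
  proof -
    have "N (?d n) \<le> c\<^sub>1 * \<omega> ^ k * E (g n)" by (rule projection_error(2)[OF g])
    also have "\<dots> \<le> c\<^sub>1 * \<omega> ^ k * L" using c1_pos \<omega>_bounds K(2) by (intro mult_left_mono) auto
    finally show ?thesis by (simp add: N_def mult_ac)
  qed
  show ?thesis
  proof (intro exI[of _ M] allI impI)
    fix i j assume ij: "M \<le> i" "M \<le> j"
    let ?r = "\<lambda>x. 4 * (cmod (?d i x))\<^sup>2 + 4 * (b x * (cmod (?P i x - l x))\<^sup>2) + (4 * (cmod (?d j x))\<^sup>2 + 4 * (b x * (cmod (?P j x - l x))\<^sup>2))"
    have pw: "b x * (cmod (g i x - g j x))\<^sup>2 \<le> ?r x" for x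
    proof -
      have "g i x - g j x = (?d i x + (?P i x - l x)) - (?d j x + (?P j x - l x))" by simp
      then have "(cmod (g i x - g j x))\<^sup>2 \<le> 2 * (cmod (?d i x + (?P i x - l x)))\<^sup>2 + 2 * (cmod (?d j x + (?P j x - l x)))\<^sup>2"
        by (simp only: cmod_diff_squared_le)
      also have "\<dots> \<le> 4 * (cmod (?d i x))\<^sup>2 + 4 * (cmod (?P i x - l x))\<^sup>2 + (4 * (cmod (?d j x))\<^sup>2 + 4 * (cmod (?P j x - l x))\<^sup>2)"
        using cmod_add_squared_le[of "?d i x" "?P i x - l x"] cmod_add_squared_le[of "?d j x" "?P j x - l x"] by linarith
      finally have "b x * (cmod (g i x - g j x))\<^sup>2 \<le> b x * (4 * (cmod (?d i x))\<^sup>2 + 4 * (cmod (?P i x - l x))\<^sup>2 + (4 * (cmod (?d j x))\<^sup>2 + 4 * (cmod (?P j x - l x))\<^sup>2))"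
        using b(2) by (intro mult_left_mono)
      moreover have "b x * (cmod (?d i x))\<^sup>2 \<le> 1 * (cmod (?d i x))\<^sup>2" "b x * (cmod (?d j x))\<^sup>2 \<le> 1 * (cmod (?d j x))\<^sup>2"
        using b(3) by (intro mult_right_mono; simp)+
      ultimately show ?thesis by (simp add: distrib_left)
    qed
    have ri: "integrable lborel ?r" using di ti by simp
    have "(\<integral>x. b x * (cmod (g i x - g j x))\<^sup>2 \<partial>lborel) \<le> (\<integral>x. ?r x \<partial>lborel)"
      using pw b(2) by (intro integral_mono' ri) auto
    also have "\<dots> = 4 * L2sq (?d i) + 4 * t i + (4 * L2sq (?d j) + 4 * t j)"
      using di ti by (simp add: t_def)
    also have "\<dots> < e" using dN[of i] dN[of j] M[OF ij(1)] M[OF ij(2)] k by linarith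
    finally show "(\<integral>x. b x * (cmod (g i x - g j x))\<^sup>2 \<partial>lborel) < e" .
  qed
qed

lemma square_integrable_weight:
  assumes f: "square_integrable lborel f" and b: "b \<in> borel_measurable lborel" "\<And>x. 0 \<le> b x" "\<And>x. b x \<le> (1::real)"
  shows "integrable lborel (\<lambda>x. b x * (cmod (f x))\<^sup>2)" "(\<integral>x. b x * (cmod (f x))\<^sup>2 \<partial>lborel) \<le> N f"
proof -
  have le: "b x * (cmod (f x))\<^sup>2 \<le> (cmod (f x))\<^sup>2" for x using b(2,3)[of x] by (simp add: mult_left_le_one_le)
  show 1: "integrable lborel (\<lambda>x. b x * (cmod (f x))\<^sup>2)"
    by (rule Bochner_Integration.integrable_bound[OF square_integrableD(2)[OF f]])
       (use f b le in \<open>auto simp: square_integrable_def abs_mult\<close>)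
  show "(\<integral>x. b x * (cmod (f x))\<^sup>2 \<partial>lborel) \<le> N f"
    unfolding N_def by (rule integral_mono[OF 1 square_integrableD(2)[OF f] le])
qed

text \<open>Truncation reduces varying potentials to the zero potential with bounded energy on each
  ball. There are countably many cells, generations and radii, so one diagonal subsequence makes all
  averages converge and hence the truncations locally Cauchy in \<open>L^2\<close>. A weighted
  \<open>L^1\<close> norm then yields a further subsequence that converges almost
  everywhere.\<close>

lemma rellich:
  fixes u :: "nat \<Rightarrow> real^3 \<Rightarrow> complex"
  assumes u: "\<And>n. u n \<in> HA (A n)" and A: "\<And>n. A n \<in> borel_measurable borel"
    and C: "\<And>R. \<exists>C. \<forall>n. \<forall>x\<in>cball 0 R. norm (A n x) \<le> C" and K: "\<And>n. Q (A n) (u n) \<le> K"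
  obtains r :: "nat \<Rightarrow> nat" and u0 where "strict_mono r" "u0 \<in> borel_measurable borel" "AE x in lborel. (\<lambda>n. u (r n) x) \<longlonglongrightarrow> u0 x"
    "\<And>R. (\<lambda>n. \<integral>\<^sup>+x. indicator (cball 0 R) x * ennreal ((cmod (u (r n) x - u0 x))\<^sup>2) \<partial>lborel) \<longlonglongrightarrow> 0"
proof -
  have um[measurable]: "u n \<in> borel_measurable borel" for n by (rule HA_measurable[OF u])
  have uN: "N (u n) \<le> K" for n using N_le_Q K order_trans by blast
  have usq: "square_integrable lborel (u n)" for n by (rule HA_L2[OF u])
  have K0: "0 \<le> K" using uN[of 0] N_nonneg[of "u 0"] by simp
  define g where "g R n x = complex_of_real (cutoff R x) * u n x" for R n x
  have gN: "N (g R n) \<le> K" for R n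
  proof -
    have "N (g R n) \<le> N (u n)"
      unfolding N_def
    proof (rule integral_mono')
      show "(cmod (g R n x))\<^sup>2 \<le> (cmod (u n x))\<^sup>2" for x
        using cutoff_bounds[of R x] by (intro power_mono) (auto simp: g_def norm_mult mult_left_le_one_le)
    qed (use usq in \<open>auto simp: square_integrable_def\<close>)
    then show ?thesis using uN order_trans by blast
  qed
  have gHS: "g R n \<in> HS" and "\<exists>L. \<forall>n. E (g R n) \<le> L" for R n
  proof -
    obtain C' where "\<forall>n. \<forall>x\<in>cball 0 (real R + 2). norm (A n x) \<le> C'" using C by blast
    then have C': "\<And>n x. x \<in> cball 0 (real R + 2) \<Longrightarrow> norm (0 - A n x) \<le> C'" by auto
    have c: "g R n \<in> HS"
      "Q (\<lambda>x. 0) (g R n) \<le> (2 + c_const s * (max 2 C')\<^sup>2 * \<kappa>mass) * K\<^sub>c * Q (A n) (u n)" for n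
      unfolding g_def[abs_def] by (rule cutoff_HA_change[OF u A borel_measurable_const C'], assumption)+
    show "g R n \<in> HS" by (rule c)
    have "E (g R n) \<le> 2 / c_const s * ((2 + c_const s * (max 2 C')\<^sup>2 * \<kappa>mass) * K\<^sub>c * K)" for n
    proof -
      have "0 \<le> (2 + c_const s * (max 2 C')\<^sup>2 * \<kappa>mass) * K\<^sub>c"
        unfolding K\<^sub>c_def using const_pos kernel_mass_nonneg
        by (intro mult_nonneg_nonneg add_nonneg_nonneg) auto
      then have "Q (\<lambda>x. 0) (g R n) \<le> (2 + c_const s * (max 2 C')\<^sup>2 * \<kappa>mass) * K\<^sub>c * K"
        using c(2)[of n] mult_left_mono[OF K[of n]] order_trans by blast
      then show ?thesis using const_pos by (intro order_trans[OF E_le_Q] mult_left_mono) auto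
    qed
    then show "\<exists>L. \<forall>n. E (g R n) \<le> L" by blast
  qed
  then obtain L where L: "\<And>R n. E (g R n) \<le> L R" by metis
  \<comment> \<open>The averages of generation \<open>k\<close> are bounded by a multiple of
    \<open>sqrt (8^k)\<close> only; dividing by \<open>8^k\<close> makes all of them bounded by the
    single constant \<open>sqrt K\<close>, as the diagonal extraction requires.\<close>
  define F where "F n z = (case z of (R, k, m) \<Rightarrow> dyadic_average k (g R n) m / complex_of_real (8 ^ k))" for n z
  have FK: "cmod (F n z) \<le> sqrt K" for n z
  proof -
    obtain R k m where fields: "z = (R, k, m)" by (metis prod.exhaust)
    have "(cmod (dyadic_average k (g R n) m))\<^sup>2 \<le> 8 ^ k * K"
      by (rule order_trans[OF dyadic_average_square_le[OF square_integrable_cell_mult[OF HA_L2(1)[OF gHS]]]],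
          rule mult_left_mono[OF order_trans[OF cell_integral_le_N[OF HA_L2(1)[OF gHS]] gN]]) simp
    then have "(cmod (F n z))\<^sup>2 \<le> 8 ^ k * K / (8 ^ k)\<^sup>2"
      unfolding F_def fields by (simp add: norm_divide power_divide divide_right_mono norm_power)
    also have "\<dots> = K / 8 ^ k" by (simp add: power2_eq_square)
    also have "\<dots> \<le> K / 1" using K0 by (intro divide_left_mono) auto
    finally show ?thesis using real_le_rsqrt by simp
  qed
  obtain r1 where r1: "strict_mono r1" "\<And>z. \<exists>l. (\<lambda>n. F (r1 n) z) \<longlonglongrightarrow> l"
    using function_convergent_subsequence[of UNIV F "sqrt K", OF _ FK] by (metis UNIV_I countableI_type)
  have conv: "convergent (\<lambda>n. dyadic_average k (g R (r1 n)) m)" for R k m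
  proof -
    obtain l where "(\<lambda>n. F (r1 n) (R, k, m)) \<longlonglongrightarrow> l" using r1(2) by blast
    then have "(\<lambda>n. complex_of_real (8 ^ k) * F (r1 n) (R, k, m)) \<longlonglongrightarrow> complex_of_real (8 ^ k) * l" by (intro tendsto_intros)
    then show ?thesis unfolding F_def by (auto simp: convergent_def)
  qed
  define I where "I R x = (indicator (cball 0 (real R)) x :: real)" for R :: nat and x :: "real^3"
  have Im[measurable]: "I R \<in> borel_measurable borel" for R
    unfolding I_def by (intro borel_measurable_indicator borel_closed closed_cball)
  have Ib: "0 \<le> I R x" "I R x \<le> 1" for R x by (auto simp: I_def indicator_def)
  have Ii: "integrable lborel (I R)" for R
    unfolding I_def using emeasure_lborel_cball_finite[of "0 :: real^3" "real R"] by (intro integrable_real_indicator) auto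
  define w where "w i j x = u (r1 i) x - u (r1 j) x" for i j x
  have [measurable]: "w i j \<in> borel_measurable borel" for i j unfolding w_def by measurable
  have wsq: "square_integrable lborel (w i j)" for i j unfolding w_def by (intro square_integrable_diff usq)
  have wN: "N (w i j) \<le> 4 * K" for i j
    using N_diff_le[OF usq[of "r1 i"] usq[of "r1 j"]] uN[of "r1 i"] uN[of "r1 j"] unfolding w_def by linarith
  have local_Cauchy: "\<exists>M. \<forall>i\<ge>M. \<forall>j\<ge>M. (\<integral>x. I R x * (cmod (w i j x))\<^sup>2 \<partial>lborel) < e" if "0 < e" for R and e :: real
  proof -
    obtain M where M: "\<And>i j. i \<ge> M \<Longrightarrow> j \<ge> M \<Longrightarrow> (\<integral>x. I R x * (cmod (g (2 * R) (r1 i) x - g (2 * R) (r1 j) x))\<^sup>2 \<partial>lborel) < e / 4"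
      using averages_imp_local_Cauchy[of "\<lambda>n. g (2 * R) (r1 n)" K "L (2 * R)" "e / 4" "I R", OF gHS gN L conv _ Ii Ib] \<open>0 < e\<close> by auto
    show ?thesis
    proof (intro exI[of _ M] allI impI)
      fix i j assume ij: "M \<le> i" "M \<le> j"
      let ?h = "\<lambda>x. g (2 * R) (r1 i) x - g (2 * R) (r1 j) x"
      have hs: "square_integrable lborel ?h" by (intro square_integrable_diff HA_L2[OF gHS])
      have "(\<integral>x. I R x * (cmod (w i j x))\<^sup>2 \<partial>lborel) \<le> (\<integral>x. 4 * (I R x * (cmod (?h x))\<^sup>2) \<partial>lborel)"
      proof (rule integral_mono')
        show "integrable lborel (\<lambda>x. 4 * (I R x * (cmod (?h x))\<^sup>2))"
          using square_integrable_weight(1)[OF hs _ Ib] by simp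
        show "I R x * (cmod (w i j x))\<^sup>2 \<le> 4 * (I R x * (cmod (?h x))\<^sup>2)" for x
        proof (cases "norm x \<le> real R")
          case True
          \<comment> \<open>On the ball of radius \<open>R\<close> the cutoff of index
            \<open>2 * R\<close> is at least 1/2, so the truncated differences control the
            differences of the \<open>u n\<close> up to a factor 2.\<close>
          then have "1 / 2 \<le> cutoff (2 * R) x" by (intro cutoff_lower) simp
          then have "1 / 2 * cmod (w i j x) \<le> cutoff (2 * R) x * cmod (w i j x)" by (intro mult_right_mono) auto
          also have "\<dots> = cmod (?h x)"
            using cutoff_bounds(1)[of "2 * R" x] by (simp add: g_def w_def norm_mult flip: right_diff_distrib)
          finally have "(1 / 2 * cmod (w i j x))\<^sup>2 \<le> (cmod (?h x))\<^sup>2" by (rule power_mono) simp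
          then have "(cmod (w i j x))\<^sup>2 \<le> 4 * (cmod (?h x))\<^sup>2" by (simp add: power_mult_distrib power_divide)
          then show ?thesis using Ib(1)[of R x] mult_left_mono by fastforce
        qed (simp add: I_def)
      qed (use Ib in auto)
      also have "\<dots> < e" using M[OF ij] by simp
      finally show "(\<integral>x. I R x * (cmod (w i j x))\<^sup>2 \<partial>lborel) < e" .
    qed
  qed
  obtain h2 :: "real^3 \<Rightarrow> real" where h2: "h2 \<in> borel_measurable lborel" "\<And>x. 0 < h2 x" "\<And>x. h2 x \<le> 1" "integrable lborel h2"
    by (rule sigma_finite_measure.obtain_positive_integrable_function[OF sigma_finite_lborel]) blast
  \<comment> \<open>Two weights: \<open>h1\<close> decays, so the uniform \<open>L^2\<close> bound
    takes care of the exterior of a large ball; \<open>h2\<close> is square integrable, which turns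
    a weighted \<open>L^2\<close> bound into an \<open>L^1\<close> bound. Both are positive and can
    be divided out of a pointwise limit.\<close>
  define h1 where "h1 x = 1 / (1 + norm x)" for x :: "real^3"
  have h1: "0 < h1 x" "h1 x \<le> 1" for x by (auto simp: h1_def add_pos_nonneg)
  have [measurable]: "h1 \<in> borel_measurable borel" "h2 \<in> borel_measurable borel" unfolding h1_def using h2(1) by auto
  have h22: "(h2 x)\<^sup>2 \<le> h2 x" for x using h2(2,3)[of x] by (simp add: power2_eq_square mult_left_le_one_le)
  have h22i: "integrable lborel (\<lambda>x. (h2 x)\<^sup>2)"
    by (rule Bochner_Integration.integrable_bound[OF h2(4)]) (use h22 h2(2) in \<open>auto simp: less_imp_le\<close>)
  define s' where "s' n x = complex_of_real (h1 x * h2 x) * u (r1 n) x" for n x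
  have prod_le: "h1 x * h2 x * z \<le> \<eta> * (h2 x)\<^sup>2 + (h1 x)\<^sup>2 * z\<^sup>2 / \<eta>" if "0 < \<eta>" "0 \<le> z" for x z \<eta>
  proof -
    have "0 \<le> h1 x * h2 x * z" using h1(1)[of x] h2(2)[of x] that by simp
    then show ?thesis
      using two_mult_le_weighted_squares[OF that(1), of "h2 x" "h1 x * z"] by (simp add: power_mult_distrib mult_ac)
  qed
  have h12: "(h1 x)\<^sup>2 \<le> 1" for x using h1[of x] by (simp add: power_le_one)
  have h1w: "integrable lborel (\<lambda>x. (h1 x)\<^sup>2 * (cmod (f x))\<^sup>2)" if "square_integrable lborel f" for f
    using square_integrable_weight(1)[OF that, of "\<lambda>x. (h1 x)\<^sup>2"] h12 by simp
  have h12i: "integrable lborel (\<lambda>x. h1 x * h2 x * cmod (f x))" if f: "square_integrable lborel f" for f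
  proof (rule Bochner_Integration.integrable_bound)
    show "integrable lborel (\<lambda>x. 1 * (h2 x)\<^sup>2 + (h1 x)\<^sup>2 * (cmod (f x))\<^sup>2 / 1)" using h22i h1w[OF f] by simp
    have [measurable]: "f \<in> borel_measurable borel" using f by (simp add: square_integrable_def)
    show "(\<lambda>x. h1 x * h2 x * cmod (f x)) \<in> borel_measurable lborel" by measurable
    show "AE x in lborel. norm (h1 x * h2 x * cmod (f x)) \<le> norm (1 * (h2 x)\<^sup>2 + (h1 x)\<^sup>2 * (cmod (f x))\<^sup>2 / 1)"
    proof (intro AE_I2)
      fix x
      have "0 \<le> h1 x * h2 x * cmod (f x)" using h1(1)[of x] h2(2)[of x] by simp
      then show "norm (h1 x * h2 x * cmod (f x)) \<le> norm (1 * (h2 x)\<^sup>2 + (h1 x)\<^sup>2 * (cmod (f x))\<^sup>2 / 1)"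
        using prod_le[of 1 "cmod (f x)" x] by simp
    qed
  qed
  have s'i: "integrable lborel (s' n)" for n
  proof (rule Bochner_Integration.integrable_bound[OF h12i[OF usq]])
    show "s' n \<in> borel_measurable lborel" unfolding s'_def by measurable
    show "AE x in lborel. norm (s' n x) \<le> norm (h1 x * h2 x * cmod (u (r1 n) x))"
      using h1 h2 by (intro AE_I2) (simp add: s'_def norm_mult abs_mult)
  qed
  have s'C: "\<exists>M. \<forall>i\<ge>M. \<forall>j\<ge>M. (LINT x|lborel. norm (s' i x - s' j x)) < e" if e: "0 < e" for e :: real
  proof -
    define H2 where "H2 = (\<integral>x. (h2 x)\<^sup>2 \<partial>lborel)"
    have H2: "0 \<le> H2" by (simp add: H2_def)
    \<comment> \<open>The weighted squares split \<open>e\<close>: the part with \<open>h2\<close>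
      costs at most \<open>e / 2\<close>, and the part with \<open>h1\<close> is divided by
      \<open>\<eta>\<close>, hence the thresholds \<open>e * \<eta> / 4\<close> for the ball of
      radius \<open>R\<close> and for its exterior.\<close>
    define \<eta> where "\<eta> = e / (2 * (H2 + 1))"
    have \<eta>: "0 < \<eta>" "\<eta> * H2 \<le> e / 2" using e H2 by (auto simp: \<eta>_def field_simps)
    have "(\<lambda>R. 4 * K / (1 + real R)) \<longlonglongrightarrow> 0" by real_asymp
    then have "eventually (\<lambda>R. 4 * K / (1 + real R) < e * \<eta> / 4) sequentially"
      by (rule order_tendstoD) (use e \<eta> in simp)
    then obtain R :: nat where R: "4 * K / (1 + real R) < e * \<eta> / 4" by (auto simp: eventually_sequentially)
    obtain M where M: "\<And>i j. i \<ge> M \<Longrightarrow> j \<ge> M \<Longrightarrow> (\<integral>x. I R x * (cmod (w i j x))\<^sup>2 \<partial>lborel) < e * \<eta> / 4"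
      using local_Cauchy[of "e * \<eta> / 4" R] e \<eta> by auto
    show ?thesis
    proof (intro exI[of _ M] allI impI)
      fix i j assume ij: "M \<le> i" "M \<le> j"
      have wi: "integrable lborel (\<lambda>x. (cmod (w i j x))\<^sup>2)" using wsq by (simp add: square_integrable_def)
      have Iwi: "integrable lborel (\<lambda>x. I R x * (cmod (w i j x))\<^sup>2)" by (rule square_integrable_weight(1)[OF wsq _ Ib]) simp
      have "(LINT x|lborel. (h1 x)\<^sup>2 * (cmod (w i j x))\<^sup>2) \<le> (LINT x|lborel. I R x * (cmod (w i j x))\<^sup>2 + 1 / (1 + real R) * (cmod (w i j x))\<^sup>2)"
      proof (rule integral_mono[OF h1w[OF wsq]])
        show "integrable lborel (\<lambda>x. I R x * (cmod (w i j x))\<^sup>2 + 1 / (1 + real R) * (cmod (w i j x))\<^sup>2)" using wi Iwi by simp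
        fix x
        have "(h1 x)\<^sup>2 \<le> I R x + 1 / (1 + real R)"
        proof (cases "norm x \<le> real R")
          case True
          then show ?thesis using h12[of x] by (simp add: I_def add_increasing2)
        next
          case False
          have "(h1 x)\<^sup>2 \<le> h1 x" using h1[of x] by (simp add: power2_eq_square mult_left_le_one_le)
          also have "\<dots> \<le> 1 / (1 + real R)" unfolding h1_def using False by (intro divide_left_mono) (auto intro!: add_pos_nonneg mult_pos_pos)
          finally show ?thesis using Ib(1)[of R x] by simp
        qed
        then have "(h1 x)\<^sup>2 * (cmod (w i j x))\<^sup>2 \<le> (I R x + 1 / (1 + real R)) * (cmod (w i j x))\<^sup>2" by (rule mult_right_mono) simp
        then show "(h1 x)\<^sup>2 * (cmod (w i j x))\<^sup>2 \<le> I R x * (cmod (w i j x))\<^sup>2 + 1 / (1 + real R) * (cmod (w i j x))\<^sup>2"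
          by (simp only: distrib_right)
      qed
      also have "\<dots> = (LINT x|lborel. I R x * (cmod (w i j x))\<^sup>2) + 1 / (1 + real R) * N (w i j)"
        unfolding N_def using wi Iwi by simp
      also have "1 / (1 + real R) * N (w i j) \<le> 1 / (1 + real R) * (4 * K)" by (intro mult_left_mono wN) auto
      also have "1 / (1 + real R) * (4 * K) = 4 * K / (1 + real R)" by simp
      finally have small: "(LINT x|lborel. (h1 x)\<^sup>2 * (cmod (w i j x))\<^sup>2) < e * \<eta> / 2" using M[OF ij] R by linarith
      have "(LINT x|lborel. norm (s' i x - s' j x)) = (LINT x|lborel. h1 x * h2 x * cmod (w i j x))"
      proof (rule Bochner_Integration.integral_cong[OF refl])
        fix x
        have "s' i x - s' j x = complex_of_real (h1 x * h2 x) * w i j x" by (simp only: s'_def w_def right_diff_distrib)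
        then show "norm (s' i x - s' j x) = h1 x * h2 x * cmod (w i j x)"
          using h1(1)[of x] h2(2)[of x] by (simp add: norm_mult)
      qed
      also have "\<dots> \<le> (LINT x|lborel. \<eta> * (h2 x)\<^sup>2 + (h1 x)\<^sup>2 * (cmod (w i j x))\<^sup>2 / \<eta>)"
        by (rule integral_mono[OF h12i[OF wsq]]) (use h22i h1w[OF wsq] prod_le[OF \<eta>(1)] in auto)
      also have "\<dots> = \<eta> * H2 + (LINT x|lborel. (h1 x)\<^sup>2 * (cmod (w i j x))\<^sup>2) / \<eta>"
        unfolding H2_def using h22i h1w[OF wsq] by simp
      also have "\<dots> < e / 2 + e / 2"
        using \<eta> small by (intro add_le_less_mono) (auto simp: field_simps)
      finally show "(LINT x|lborel. norm (s' i x - s' j x)) < e" by simp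
    qed
  qed
  obtain r2 where r2: "strict_mono r2" "AE x in lborel. Cauchy (\<lambda>n. s' (r2 n) x)"
    using cauchy_L1_AE_cauchy_subseq[OF s'i s'C] by blast
  define r where "r = r1 \<circ> r2"
  define u0 where "u0 x = lim (\<lambda>n. u (r n) x)" for x
  have u0m[measurable]: "u0 \<in> borel_measurable borel"
    unfolding u0_def by (rule borel_measurable_lim_metric) measurable
  have lim: "AE x in lborel. (\<lambda>n. u (r n) x) \<longlonglongrightarrow> u0 x"
    using r2(2)
  proof eventually_elim
    case (elim x)
    have nz: "complex_of_real (h1 x * h2 x) \<noteq> 0" using h1(1)[of x] h2(2)[of x] by simp
    obtain l where "(\<lambda>n. s' (r2 n) x) \<longlonglongrightarrow> l" using elim Cauchy_convergent convergent_def by blast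
    then have "(\<lambda>n. s' (r2 n) x / complex_of_real (h1 x * h2 x)) \<longlonglongrightarrow> l / complex_of_real (h1 x * h2 x)"
      by (intro tendsto_intros nz)
    then have "convergent (\<lambda>n. u (r n) x)" using nz by (auto simp: s'_def r_def convergent_def)
    then show ?case unfolding u0_def convergent_LIMSEQ_iff .
  qed
  show thesis
  proof
    show "strict_mono r" unfolding r_def using r1(1) r2(1) by (rule strict_mono_o)
    show "(\<lambda>n. \<integral>\<^sup>+x. indicator (cball 0 R) x * ennreal ((cmod (u (r n) x - u0 x))\<^sup>2) \<partial>lborel) \<longlonglongrightarrow> 0" for R
    proof (rule tendsto_zero_ennreal)
      fix e :: real assume e: "0 < e"
      define S where "S = nat \<lceil>R\<rceil>"
      have S: "R \<le> real S" unfolding S_def by linarith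
      obtain M where M: "\<And>i j. i \<ge> M \<Longrightarrow> j \<ge> M \<Longrightarrow> (\<integral>x. I S x * (cmod (w i j x))\<^sup>2 \<partial>lborel) < e / 2"
        using local_Cauchy[of "e / 2" S] e by auto
      have r2ge: "n \<le> r2 n" for n by (rule seq_suble[OF r2(1)])
      have "ball_mass 0 R (\<lambda>x. u (r n) x - u0 x) < ennreal e" if n: "n \<ge> M" for n
      proof -
        \<comment> \<open>Fatou's lemma in \<open>j\<close>: the Cauchy bound for the pair
          \<open>n\<close>, \<open>j\<close> survives when \<open>u (r j)\<close> is replaced by its
          pointwise limit.\<close>
        have "ball_mass 0 R (\<lambda>x. u (r n) x - u0 x)
           \<le> (\<integral>\<^sup>+x. liminf (\<lambda>j. ennreal (I S x * (cmod (w (r2 n) (r2 j) x))\<^sup>2)) \<partial>lborel)"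
        proof (rule nn_integral_mono_AE)
          show "AE x in lborel. indicator (cball 0 R) x * ennreal ((cmod (u (r n) x - u0 x))\<^sup>2)
             \<le> liminf (\<lambda>j. ennreal (I S x * (cmod (w (r2 n) (r2 j) x))\<^sup>2))"
            using lim
          proof eventually_elim
            case (elim x)
            have "(\<lambda>j. ennreal (I S x * (cmod (u (r n) x - u (r j) x))\<^sup>2)) \<longlonglongrightarrow> ennreal (I S x * (cmod (u (r n) x - u0 x))\<^sup>2)"
              by (intro tendsto_intros elim)
            then have "liminf (\<lambda>j. ennreal (I S x * (cmod (w (r2 n) (r2 j) x))\<^sup>2)) = ennreal (I S x * (cmod (u (r n) x - u0 x))\<^sup>2)"
              by (intro lim_imp_Liminf) (simp_all add: w_def r_def)
            then show ?case using S by (auto simp: I_def indicator_def)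
          qed
        qed
        also have "\<dots> \<le> liminf (\<lambda>j. \<integral>\<^sup>+x. ennreal (I S x * (cmod (w (r2 n) (r2 j) x))\<^sup>2) \<partial>lborel)"
          by (rule nn_integral_liminf) simp
        also have "\<dots> \<le> limsup (\<lambda>j. \<integral>\<^sup>+x. ennreal (I S x * (cmod (w (r2 n) (r2 j) x))\<^sup>2) \<partial>lborel)"
          by (rule Liminf_le_Limsup) simp
        also have "\<dots> \<le> ennreal (e / 2)"
        proof (rule Limsup_bounded, rule eventually_sequentiallyI[of M])
          fix j assume j: "M \<le> j"
          have "(\<integral>\<^sup>+x. ennreal (I S x * (cmod (w (r2 n) (r2 j) x))\<^sup>2) \<partial>lborel) = ennreal (\<integral>x. I S x * (cmod (w (r2 n) (r2 j) x))\<^sup>2 \<partial>lborel)"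
            by (rule nn_integral_eq_integral) (use square_integrable_weight(1)[OF wsq _ Ib] Ib in auto)
          also have "\<dots> \<le> ennreal (e / 2)"
            using M[of "r2 n" "r2 j"] r2ge[of n] r2ge[of j] n j by (intro ennreal_leI) auto
          finally show "(\<integral>\<^sup>+x. ennreal (I S x * (cmod (w (r2 n) (r2 j) x))\<^sup>2) \<partial>lborel) \<le> ennreal (e / 2)" .
        qed
        also have "\<dots> < ennreal e" using e by (simp add: ennreal_less_iff)
        finally show ?thesis .
      qed
      then show "\<forall>\<^sub>F n in sequentially. ball_mass 0 R (\<lambda>x. u (r n) x - u0 x) < ennreal e"
        by (auto simp: eventually_sequentially)
    qed
  qed (use u0m lim in auto)
qed

end

context fractional_subcritical
begin

section \<open>The Sobolev inequality and vanishing\<close>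

lemma c3_nonneg: "0 \<le> c\<^sub>3"
  using c1_pos \<rho>_bounds by (auto simp: c\<^sub>3_def c\<^sub>2_def)

text \<open>\<open>Lp_estimate\<close> at generation 0 with the total mass as
  \<open>\<delta>\<close>; the two sides then have the same degree of homogeneity.\<close>

lemma sobolev:
  "\<exists>C>0. \<forall>f\<in>HS. nnLp f \<le> ennreal (C * (N f + E f) powr (p / 2))"
proof (intro exI[of _ "2 powr p * (2 + 2 * c\<^sub>1 + c\<^sub>3)"] conjI ballI)
  show "0 < 2 powr p * (2 + 2 * c\<^sub>1 + c\<^sub>3)" using c1_pos c3_nonneg by (intro mult_pos_pos add_pos_nonneg) auto
  fix f assume f: "f \<in> HS"
  define X where "X = N f + E f"
  have NX: "N f \<le> X" "E f \<le> X" "0 \<le> X" using N_nonneg[of f] E_nonneg[of f] by (auto simp: X_def)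
  have "nnLp f \<le>
     ennreal (2 powr p * ((8 ^ 0 * N f) powr ((p - 2) / 2) * (2 * N f + 2 * c\<^sub>1 * E f) + c\<^sub>3 * E f powr (p / 2) * \<rho> ^ 0))"
    by (rule Lp_estimate[OF f cell_integral_le_N[OF HA_L2(1)[OF f]]])
  also have "\<dots> \<le> ennreal (2 powr p * ((2 + 2 * c\<^sub>1 + c\<^sub>3) * X powr (p / 2)))"
  proof (intro ennreal_leI mult_left_mono)
    have 1: "N f powr ((p - 2) / 2) * (2 * N f + 2 * c\<^sub>1 * E f) \<le> X powr ((p - 2) / 2) * ((2 + 2 * c\<^sub>1) * X)"
    proof (rule mult_mono)
      show "N f powr ((p - 2) / 2) \<le> X powr ((p - 2) / 2)" using NX p N_nonneg by (intro powr_mono2) auto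
      have "c\<^sub>1 * E f \<le> c\<^sub>1 * X" using NX c1_pos by (intro mult_left_mono) auto
      then show "2 * N f + 2 * c\<^sub>1 * E f \<le> (2 + 2 * c\<^sub>1) * X" using NX by (simp add: algebra_simps)
    qed (use c1_pos N_nonneg E_nonneg in auto)
    have 2: "X powr ((p - 2) / 2) * X = X powr (p / 2)"
    proof (cases "X = 0")
      case False
      then have "0 < X" using NX by simp
      then have "X powr ((p - 2) / 2) * X powr 1 = X powr ((p - 2) / 2 + 1)" by (simp only: powr_add)
      then show ?thesis using \<open>0 < X\<close> by (simp add: diff_divide_distrib)
    qed simp
    have 3: "c\<^sub>3 * E f powr (p / 2) \<le> c\<^sub>3 * X powr (p / 2)"
      using NX p E_nonneg c3_nonneg by (intro mult_left_mono powr_mono2) auto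
    show "(8 ^ 0 * N f) powr ((p - 2) / 2) * (2 * N f + 2 * c\<^sub>1 * E f) + c\<^sub>3 * E f powr (p / 2) * \<rho> ^ 0 \<le> (2 + 2 * c\<^sub>1 + c\<^sub>3) * X powr (p / 2)"
      using 1 3 unfolding 2[symmetric] by (simp add: algebra_simps)
  qed simp
  finally show "nnLp f \<le> ennreal (2 powr p * (2 + 2 * c\<^sub>1 + c\<^sub>3) * (N f + E f) powr (p / 2))"
    unfolding X_def by (simp only: mult.assoc)
qed

lemma vanishing:
  assumes \<eta>: "0 < \<eta>"
  shows "\<exists>k \<delta>. 0 < \<delta> \<and> (\<forall>f\<in>HS. N f \<le> K \<longrightarrow> E f \<le> K \<longrightarrow>
    (\<forall>m. L2sq (\<lambda>y. indicator (dyadic_cell k m) y * f y) \<le> \<delta>) \<longrightarrow>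
    nnLp f \<le> ennreal \<eta>)"
proof (cases "0 \<le> K")
  case True
  have "(\<lambda>k. 2 powr p * (c\<^sub>3 * K powr (p / 2) * \<rho> ^ k)) \<longlonglongrightarrow> 2 powr p * (c\<^sub>3 * K powr (p / 2) * 0)"
    using \<rho>_bounds by (intro tendsto_mult tendsto_const LIMSEQ_power_zero) auto
  then have "eventually (\<lambda>k. 2 powr p * (c\<^sub>3 * K powr (p / 2) * \<rho> ^ k) < \<eta> / 2) sequentially"
    by (rule order_tendstoD) (use \<eta> in simp)
  then obtain k where k: "2 powr p * (c\<^sub>3 * K powr (p / 2) * \<rho> ^ k) < \<eta> / 2" by (auto simp: eventually_sequentially)
  define G where "G = 2 powr p * (2 * K + 2 * c\<^sub>1 * K)"
  have G: "0 \<le> G" using True c1_pos by (simp add: G_def)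
  define y where "y = \<eta> / (2 * (G + 1))"
  have y: "0 < y" "G * y \<le> \<eta> / 2" using \<eta> G by (auto simp: y_def field_simps)
  \<comment> \<open>The generation \<open>k\<close> is already fixed by the tail, so its factor
    \<open>8^k\<close> can be divided out; the exponent inverts \<open>(p - 2) / 2\<close>, which
    makes the coefficient of the projected part equal to \<open>y\<close>.\<close>
  define \<delta> where "\<delta> = y powr (2 / (p - 2)) / 8 ^ k"
  have "2 / (p - 2) * ((p - 2) / 2) = 1" using p by simp
  moreover have "8 ^ k * \<delta> = y powr (2 / (p - 2))" by (simp add: \<delta>_def)
  ultimately have "(8 ^ k * \<delta>) powr ((p - 2) / 2) = y powr 1" by (simp only: powr_powr)
  then have \<delta>: "0 < \<delta>" "(8 ^ k * \<delta>) powr ((p - 2) / 2) = y" using y by (simp_all add: \<delta>_def)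
  show ?thesis
  proof (intro exI[of _ k] exI[of _ \<delta>] conjI ballI impI \<delta>(1))
    fix f assume f: "f \<in> HS" "N f \<le> K" "E f \<le> K" "\<forall>m. L2sq (\<lambda>y. indicator (dyadic_cell k m) y * f y) \<le> \<delta>"
    have "nnLp f \<le>
       ennreal (2 powr p * ((8 ^ k * \<delta>) powr ((p - 2) / 2) * (2 * N f + 2 * c\<^sub>1 * E f) + c\<^sub>3 * E f powr (p / 2) * \<rho> ^ k))"
      by (rule Lp_estimate[OF f(1)]) (use f(4) in auto)
    also have "\<dots> \<le> ennreal \<eta>"
    proof (rule ennreal_leI)
      have 1: "c\<^sub>3 * E f powr (p / 2) * \<rho> ^ k \<le> c\<^sub>3 * K powr (p / 2) * \<rho> ^ k"
        using f(3) p E_nonneg c3_nonneg \<rho>_bounds by (intro mult_left_mono mult_right_mono powr_mono2) auto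
      have 2: "y * (2 * N f + 2 * c\<^sub>1 * E f) \<le> y * (2 * K + 2 * c\<^sub>1 * K)"
        using f(2,3) y c1_pos by (intro mult_left_mono add_mono) auto
      have "2 powr p * (y * (2 * N f + 2 * c\<^sub>1 * E f) + c\<^sub>3 * E f powr (p / 2) * \<rho> ^ k)
         \<le> 2 powr p * (y * (2 * K + 2 * c\<^sub>1 * K) + c\<^sub>3 * K powr (p / 2) * \<rho> ^ k)"
        by (intro mult_left_mono add_mono 1 2) auto
      also have "\<dots> = G * y + 2 powr p * (c\<^sub>3 * K powr (p / 2) * \<rho> ^ k)" by (simp add: G_def algebra_simps)
      also have "\<dots> \<le> \<eta>" using y(2) k by linarith
      finally show "2 powr p * ((8 ^ k * \<delta>) powr ((p - 2) / 2) * (2 * N f + 2 * c\<^sub>1 * E f) + c\<^sub>3 * E f powr (p / 2) * \<rho> ^ k) \<le> \<eta>"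
        unfolding \<delta>(2) .
    qed
    finally show "nnLp f \<le> ennreal \<eta>" .
  qed
next
  case False
  then have "\<not> N f \<le> K" for f using N_nonneg[of f] by linarith
  then show ?thesis by (intro exI[of _ 0] exI[of _ 1]) auto
qed

end

section \<open>Minimizing sequences\<close>

lemma lborel_shift:
  fixes f :: "'a::euclidean_space \<Rightarrow> 'b::{banach, second_countable_topology}"
  assumes "f \<in> borel_measurable borel"
  shows "integrable lborel (\<lambda>x. f (x + a)) \<longleftrightarrow> integrable lborel f"
    "(\<integral>x. f (x + a) \<partial>lborel) = (\<integral>x. f x \<partial>lborel)"
proof -
  have [measurable]: "f \<in> borel_measurable borel" by fact
  have eq: "lborel = distr lborel borel (\<lambda>x. x + a)"
  proof -
    have "(+) a = (\<lambda>x. x + a)" by (auto simp: add.commute)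
    then show ?thesis using lborel_distr_plus[of a] by simp
  qed
  show "integrable lborel (\<lambda>x. f (x + a)) \<longleftrightarrow> integrable lborel f"
    by (subst (2) eq, subst integrable_distr_eq) auto
  show "(\<integral>x. f (x + a) \<partial>lborel) = (\<integral>x. f x \<partial>lborel)"
    by (subst (2) eq, subst integral_distr) auto
qed

lemma square_integrable_shift:
  fixes f :: "'a::euclidean_space \<Rightarrow> complex"
  assumes f: "square_integrable lborel f" and g: "g \<in> borel_measurable borel" "\<And>x. cmod (g x) = cmod (f (x + a))"
  shows "square_integrable lborel g" "L2sq g = L2sq f"
proof -
  have [measurable]: "f \<in> borel_measurable borel" using f by (simp add: square_integrable_def)
  have m: "(\<lambda>x. (cmod (f x))\<^sup>2) \<in> borel_measurable borel" by measurable
  show "square_integrable lborel g"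
    using f g lborel_shift(1)[OF m, of a] by (simp add: square_integrable_def)
  show "L2sq g = L2sq f"
    using g lborel_shift(2)[OF m, of a] by simp
qed

text \<open>A magnetic translation: the shift by \<open>\<xi>\<close> together with the gauge factor
  that compensates the constant \<open>h\<close> added to the potential.\<close>

definition gauge_shift :: "real^3 \<Rightarrow> real^3 \<Rightarrow> (real^3 \<Rightarrow> complex) \<Rightarrow> real^3 \<Rightarrow> complex" where
  "gauge_shift h \<xi> u x = exp (\<i> * complex_of_real (h \<bullet> x)) * u (x + \<xi>)"

lemma cmod_gauge_shift: "cmod (gauge_shift h \<xi> u x) = cmod (u (x + \<xi>))"
  by (simp add: gauge_shift_def norm_mult norm_exp_eq_Re)

context fractional_order
begin

text \<open>The midpoint moves along with both points. The phase from
  \<open>(x - y) \<bullet> h\<close> turns the gauge factor at the first point into the one at the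
  second, which comes out as a common factor of modulus 1; the energy is therefore
  unchanged.\<close>

lemma quotient_gauge_shift:
  "D (\<lambda>x. A (x + \<xi>) + h) (gauge_shift h \<xi> u) z
    = exp (\<i> * complex_of_real (h \<bullet> snd z)) * D A u (z + (\<xi>, \<xi>))"
proof -
  obtain x y where z: "z = (x, y)" by (cases z)
  define m where "m = (1/2) *\<^sub>R (x + y)"
  have m2: "(1/2) *\<^sub>R (x + \<xi> + (y + \<xi>)) = m + \<xi>"
    by (simp add: m_def scaleR_add_right flip: scaleR_add_left)
  have "exp (- \<i> * complex_of_real ((x - y) \<bullet> (A (m + \<xi>) + h))) * exp (\<i> * complex_of_real (h \<bullet> x))
     = exp (\<i> * complex_of_real (h \<bullet> y)) * exp (- \<i> * complex_of_real ((x - y) \<bullet> A (m + \<xi>)))"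
    by (simp add: mult_exp_exp inner_add_right inner_diff_left inner_commute[of h] algebra_simps)
  then have "exp (- \<i> * complex_of_real ((x - y) \<bullet> (A (m + \<xi>) + h))) * (exp (\<i> * complex_of_real (h \<bullet> x)) * u (x + \<xi>))
       - exp (\<i> * complex_of_real (h \<bullet> y)) * u (y + \<xi>)
     = exp (\<i> * complex_of_real (h \<bullet> y)) * (exp (- \<i> * complex_of_real ((x - y) \<bullet> A (m + \<xi>))) * u (x + \<xi>) - u (y + \<xi>))"
    by (simp only: mult.assoc[symmetric] right_diff_distrib)
  then show ?thesis
    unfolding magnetic_quotient_def gauge_shift_def z fst_conv snd_conv plus_prod_def m_def[symmetric] m2 by simp
qed

lemma HA_gauge_shift:
  assumes u: "u \<in> HA A" and A[measurable]: "A \<in> borel_measurable borel"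
  shows "gauge_shift h \<xi> u \<in> HA (\<lambda>x. A (x + \<xi>) + h)" "Q (\<lambda>x. A (x + \<xi>) + h) (gauge_shift h \<xi> u) = Q A u"
proof -
  have um[measurable]: "u \<in> borel_measurable borel" by (rule HA_measurable[OF u])
  have gm: "gauge_shift h \<xi> u \<in> borel_measurable borel"
    unfolding gauge_shift_def[abs_def] by measurable
  have A': "(\<lambda>x. A (x + \<xi>) + h) \<in> borel_measurable borel" by measurable
  note 1 = square_integrable_shift[OF HA_L2(1)[OF u] gm cmod_gauge_shift]
  have c: "cmod (D (\<lambda>x. A (x + \<xi>) + h) (gauge_shift h \<xi> u) z) = cmod (D A u (z + (\<xi>, \<xi>)))" for z
    unfolding quotient_gauge_shift by (simp add: norm_mult norm_exp_eq_Re)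
  note 2 = square_integrable_shift[OF HA_D(1)[OF u] quotient_measurable[OF A' gm] c]
  show "gauge_shift h \<xi> u \<in> HA (\<lambda>x. A (x + \<xi>) + h)" using 1(1) 2(1) by (simp add: HA_def)
  show "Q (\<lambda>x. A (x + \<xi>) + h) (gauge_shift h \<xi> u) = Q A u" unfolding Q_def 1(2) 2(2) ..
qed

lemma H_gauge_shift:
  assumes u: "u \<in> H A" and A: "A \<in> borel_measurable borel"
  shows "gauge_shift h \<xi> u \<in> H (\<lambda>x. A (x + \<xi>) + h)"
  unfolding H_def
proof (intro CollectI conjI allI impI HA_gauge_shift[OF H_HA[OF u] A])
  fix e :: real assume "0 < e"
  then obtain \<phi> where \<phi>: "\<phi> \<in> test_functions" "\<phi> \<in> HA A" "Q A (\<lambda>x. u x - \<phi> x) < e"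
    using u unfolding H_def by blast
  have "gauge_shift h \<xi> \<phi> \<in> test_functions"
    unfolding gauge_shift_def[abs_def]
    by (rule test_function_mult[OF test_function_shift[OF \<phi>(1)]]) (rule C_k_exp_ii)
  moreover have "(\<lambda>x. gauge_shift h \<xi> u x - gauge_shift h \<xi> \<phi> x) = gauge_shift h \<xi> (\<lambda>x. u x - \<phi> x)"
    by (auto simp: gauge_shift_def algebra_simps)
  then have "Q (\<lambda>x. A (x + \<xi>) + h) (\<lambda>x. gauge_shift h \<xi> u x - gauge_shift h \<xi> \<phi> x) < e"
    using HA_gauge_shift(2)[OF HA_diff[OF H_HA[OF u] \<phi>(2)] A] \<phi>(3) by simp
  ultimately show "\<exists>\<phi>\<in>test_functions. \<phi> \<in> HA (\<lambda>x. A (x + \<xi>) + h)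
      \<and> Q (\<lambda>x. A (x + \<xi>) + h) (\<lambda>x. gauge_shift h \<xi> u x - \<phi> x) < e"
    using HA_gauge_shift(1)[OF \<phi>(2) A] by blast
qed

end

context fractional_subcritical
begin

section \<open>The L^p constraint, lower bounds and minimizing sequences\<close>

definition I :: "(real^3 \<Rightarrow> complex) \<Rightarrow> real" where
  "I u = (\<integral>x. cmod (u x) powr p \<partial>lborel)"

lemma I_nonneg: "0 \<le> I u"
  by (simp add: I_def)

text \<open>The Sobolev inequality is applied to the modulus, so the constant is the same for all
  potentials; small energy then makes \<open>I\<close> small uniformly in the potential.\<close>

lemma HA_Lp: "u \<in> HA A \<Longrightarrow> integrable lborel (\<lambda>x. cmod (u x) powr p)"
  and HA_Lp_bound: "\<exists>C>0. \<forall>A. \<forall>u\<in>HA A. I u \<le> C * Q A u powr (p / 2)"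
proof -
  obtain C where C: "0 < C" "\<And>f. f \<in> HS \<Longrightarrow> nnLp f \<le> ennreal (C * (N f + E f) powr (p / 2))"
    using sobolev by blast
  define C' where "C' = C * (1 + 2 / c_const s) powr (p / 2)"
  have "0 < 1 + 2 / c_const s" using const_pos by (intro add_pos_pos) auto
  then have C': "0 < C'" using C by (simp add: C'_def)
  have le: "nnLp u \<le> ennreal (C' * Q A u powr (p / 2))" if u: "u \<in> HA A" for u A
  proof -
    let ?a = "\<lambda>x. complex_of_real (cmod (u x))"
    note d = diamagnetic[OF u]
    have "nnLp u = nnLp ?a" by simp
    also have "\<dots> \<le> ennreal (C * (N ?a + E ?a) powr (p / 2))" by (rule C(2)[OF d(1)])
    also have "\<dots> \<le> ennreal (C * ((1 + 2 / c_const s) * Q A u) powr (p / 2))"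
      using C p d(2,3) N_nonneg[of ?a] E_nonneg[of ?a]
      by (intro ennreal_leI mult_left_mono powr_mono2) (auto simp: algebra_simps)
    also have "((1 + 2 / c_const s) * Q A u) powr (p / 2) = (1 + 2 / c_const s) powr (p / 2) * Q A u powr (p / 2)"
      by (rule powr_mult)
    finally show ?thesis by (simp add: C'_def mult.assoc)
  qed
  show int: "integrable lborel (\<lambda>x. cmod (u x) powr p)" if u: "u \<in> HA A" for u A
  proof (rule integrableI_nonneg)
    have [measurable]: "u \<in> borel_measurable borel" by (rule HA_measurable[OF u])
    show "(\<lambda>x. cmod (u x) powr p) \<in> borel_measurable lborel" by measurable
    show "nnLp u < \<infinity>" using le[OF u] by (auto intro: le_less_trans)
  qed auto
  have "I u \<le> C' * Q A u powr (p / 2)" if u: "u \<in> HA A" for u A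
  proof -
    have "nnLp u = ennreal (I u)"
      unfolding I_def by (rule nn_integral_eq_integral[OF int[OF u]]) simp
    then show ?thesis using le[OF u] C' by (simp add: ennreal_le_iff)
  qed
  then show "\<exists>C>0. \<forall>A. \<forall>u\<in>HA A. I u \<le> C * Q A u powr (p / 2)" using C' by blast
qed

lemma nn_integral_powr_eq: "u \<in> HA A \<Longrightarrow> nnLp u = ennreal (I u)"
  unfolding I_def by (rule nn_integral_eq_integral[OF HA_Lp]) auto

lemma I_cmult: "I (\<lambda>x. c * u x) = cmod c powr p * I u"
  unfolding I_def by (simp add: norm_mult powr_mult)

lemma constraint_set_iff:
  assumes "A \<in> borel_measurable borel" "u \<in> borel_measurable borel"
  shows "u \<in> constraint_set s p A \<longleftrightarrow> u \<in> H A \<and> I u = 1"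
proof (cases "u \<in> H A")
  case True
  then show ?thesis
    unfolding constraint_set_def nn_integral_completion
    using HsA_iff_H[OF assms] nn_integral_powr_eq[OF H_HA[OF True]] by simp
next
  case False
  then show ?thesis unfolding constraint_set_def using HsA_iff_H[OF assms] by simp
qed

lemma constraint_set_representative:
  assumes "u \<in> constraint_set s p A" and A: "A \<in> borel_measurable borel"
  obtains v where "v \<in> H A" "I v = 1" "AE x in lborel. u x = v x" "magnetic_norm_sq s A u = ennreal (Q A v)"
proof -
  have u: "u \<in> HsA s A" "nnLp u = 1"
    using assms(1) by (auto simp: constraint_set_def nn_integral_completion)
  then have "u \<in> borel_measurable lebesgue" by (auto simp: HsA_def magnetic_space_def)
  then obtain v where v: "v \<in> borel_measurable borel" "AE x in lborel. u x = v x" by (rule borel_representative)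
  have "v \<in> HsA s A" by (rule HsA_cong_AE[OF u(1) v(2,1)])
  moreover have "nnLp v = nnLp u"
    by (rule nn_integral_cong_AE) (use v(2) in auto)
  ultimately have "v \<in> constraint_set s p A" using u(2) by (simp add: constraint_set_def nn_integral_completion)
  then have "v \<in> H A" "I v = 1" using constraint_set_iff[OF A v(1)] by auto
  moreover have "magnetic_norm_sq s A u = ennreal (Q A v)"
    using magnetic_norm_sq_cong_AE[OF v(2), of A] magnetic_norm_sq_HA[OF H_HA[OF \<open>v \<in> H A\<close>] A] by simp
  ultimately show thesis using v(2) that by blast
qed

text \<open>The homogeneous form of a lower bound for the infimum: \<open>Q A\<close> and
  \<open>I powr (2 / p)\<close> both have degree 2. It applies to remainders, on which
  \<open>I\<close> is not normalised.\<close>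

definition lower_constant :: "(real^3 \<Rightarrow> real^3) \<Rightarrow> real \<Rightarrow> bool" where
  "lower_constant A m \<longleftrightarrow> (\<forall>w\<in>H A. m * I w powr (2 / p) \<le> Q A w)"

lemma lower_constantI:
  assumes le: "ennreal m \<le> M_inf s p A" and m: "0 \<le> m" and A: "A \<in> borel_measurable borel"
  shows "lower_constant A m"
  unfolding lower_constant_def
proof
  fix w assume w: "w \<in> H A"
  show "m * I w powr (2 / p) \<le> Q A w"
  proof (cases "I w = 0")
    case False
    then have I: "0 < I w" using I_nonneg[of w] by simp
    define t where "t = I w powr (- 1 / p)"
    have t: "0 < t" using I by (simp add: t_def)
    have "(\<lambda>x. complex_of_real t * w x) \<in> H A" by (rule H_cmult[OF w])
    moreover have "I (\<lambda>x. complex_of_real t * w x) = 1"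
    proof -
      have "t powr p = I w powr (- 1)" using p by (simp add: t_def powr_powr)
      then show ?thesis unfolding I_cmult using t I by (simp add: powr_minus)
    qed
    ultimately have "(\<lambda>x. complex_of_real t * w x) \<in> constraint_set s p A"
      using constraint_set_iff[OF A] H_HA HA_measurable by blast
    then have "M_inf s p A \<le> magnetic_norm_sq s A (\<lambda>x. complex_of_real t * w x)"
      unfolding M_inf_def by (rule INF_lower)
    also have "\<dots> = ennreal (t\<^sup>2 * Q A w)"
      using magnetic_norm_sq_HA[OF HA_cmult[OF H_HA[OF w]] A] t by (simp add: Q_cmult)
    finally have "ennreal m \<le> ennreal (t\<^sup>2 * Q A w)" using le by (rule order_trans[rotated])
    then have mt: "m \<le> t\<^sup>2 * Q A w" using Q_nonneg[of A w] by (simp add: ennreal_le_iff)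
    have "t\<^sup>2 = t powr 2" using t by simp
    also have "\<dots> = I w powr (- (2 / p))" by (simp add: t_def powr_powr)
    finally have t2: "t\<^sup>2 * I w powr (2 / p) = 1" using I by (simp add: powr_minus)
    have "m * I w powr (2 / p) \<le> t\<^sup>2 * Q A w * I w powr (2 / p)" using mt by (rule mult_right_mono) simp
    also have "\<dots> = (t\<^sup>2 * I w powr (2 / p)) * Q A w" by simp
    also have "\<dots> = Q A w" unfolding t2 by simp
    finally show ?thesis .
  qed (simp add: Q_nonneg)
qed

lemma I_gauge_shift:
  assumes "u \<in> borel_measurable borel" shows "I (gauge_shift h \<xi> u) = I u"
proof -
  have [measurable]: "u \<in> borel_measurable borel" by fact
  have "(\<lambda>x. cmod (u x) powr p) \<in> borel_measurable borel" by measurable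
  from lborel_shift(2)[OF this, of \<xi>] show ?thesis unfolding I_def cmod_gauge_shift .
qed

lemma lower_constant_gauge_shift:
  assumes lc: "lower_constant A m" and A[measurable]: "A \<in> borel_measurable borel"
  shows "lower_constant (\<lambda>x. A (x + \<xi>) + h) m"
  unfolding lower_constant_def
proof
  fix w assume w: "w \<in> H (\<lambda>x. A (x + \<xi>) + h)"
  have A': "(\<lambda>x. A (x + \<xi>) + h) \<in> borel_measurable borel" by measurable
  have eq: "(\<lambda>x. (\<lambda>x. A (x + \<xi>) + h) (x + - \<xi>) + - h) = A" by simp
  note 1 = H_gauge_shift[OF w A', of "- h" "- \<xi>", unfolded eq]
  note 2 = HA_gauge_shift(2)[OF H_HA[OF w] A', where h = "- h" and \<xi> = "- \<xi>", unfolded eq]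
  have "m * I (gauge_shift (- h) (- \<xi>) w) powr (2 / p) \<le> Q A (gauge_shift (- h) (- \<xi>) w)"
    using lc 1 by (simp add: lower_constant_def)
  then show "m * I w powr (2 / p) \<le> Q (\<lambda>x. A (x + \<xi>) + h) w"
    using 2 I_gauge_shift[OF HA_measurable[OF H_HA[OF w]]] by simp
qed

lemma cutoff_H:
  assumes "locally_bounded_potential A"
  shows "(\<lambda>x. complex_of_real (cutoff n x)) \<in> H A"
  unfolding H_def
proof (intro CollectI conjI allI impI cutoff_HA[OF assms])
  fix e :: real assume "0 < e"
  have "Q A (\<lambda>x. 0 * complex_of_real (cutoff n x)) = 0" unfolding Q_cmult by simp
  then have "Q A (\<lambda>x. complex_of_real (cutoff n x) - complex_of_real (cutoff n x)) < e" using \<open>0 < e\<close> by simp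
  then show "\<exists>\<phi>\<in>test_functions. \<phi> \<in> HA A \<and> Q A (\<lambda>x. complex_of_real (cutoff n x) - \<phi> x) < e"
    using cutoff_test_function cutoff_HA[OF assms] by blast
qed

text \<open>A normalised cutoff is a radial competitor for every locally bounded potential; it is at
  least 1/2 on a ball, so its \<open>L^p\<close> integral can be normalised. This keeps both infima
  finite.\<close>

lemma radial_constraint_set_nonempty:
  assumes A: "locally_bounded_potential A"
  shows "radial_constraint_set s p A \<noteq> {}"
proof -
  let ?\<chi> = "\<lambda>x. complex_of_real (cutoff 0 x)"
  have "I ?\<chi> \<noteq> 0"
  proof
    assume "I ?\<chi> = 0"
    then have "AE x in lborel. cmod (?\<chi> x) powr p = 0"
      using integral_nonneg_eq_0_iff_AE[OF HA_Lp[OF cutoff_HA[OF A]]] by (simp add: I_def)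
    then have "AE x in lborel. x \<notin> cball (0 :: real^3) (1/2)"
    proof eventually_elim
      case (elim x)
      then have "cutoff 0 x = 0" by simp
      then show ?case using cutoff_lower[of x 0] by auto
    qed
    then have "emeasure lborel {x \<in> space lborel. x \<in> cball (0 :: real^3) (1/2)} = 0"
      by (rule emeasure_eq_0_AE)
    moreover have "{x \<in> space lborel. x \<in> cball (0 :: real^3) (1/2)} = cball 0 (1/2)"
      unfolding space_lborel space_borel by blast
    ultimately have "emeasure lborel (cball (0 :: real^3) (1/2)) = 0" by (simp only:)
    moreover have "emeasure lborel (cball (0 :: real^3) (1/2)) = ennreal (unit_ball_vol (real DIM(real^3)) * (1/2) ^ DIM(real^3))"
      by (rule emeasure_cball) simp
    moreover have "0 < unit_ball_vol (real DIM(real^3)) * (1/2) ^ DIM(real^3)"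
      by (intro mult_pos_pos unit_ball_vol_pos) auto
    ultimately show False by simp
  qed
  then have I: "0 < I ?\<chi>" using I_nonneg[of ?\<chi>] by simp
  define t where "t = I ?\<chi> powr (- 1 / p)"
  have t: "0 < t" using I by (simp add: t_def)
  let ?u = "\<lambda>x. complex_of_real t * ?\<chi> x"
  have uH: "?u \<in> H A" by (rule H_cmult[OF cutoff_H[OF A]])
  have "t powr p = I ?\<chi> powr (- 1)" using p by (simp add: t_def powr_powr)
  then have "I ?u = 1" unfolding I_cmult using t I by (simp add: powr_minus)
  then have "?u \<in> constraint_set s p A"
    using constraint_set_iff[OF locally_bounded_potentialD(1)[OF A]] uH H_HA HA_measurable by blast
  moreover have "radially_symmetric ?u"
    unfolding radially_symmetric_def cutoff_def dot_square_norm
    by (intro exI[of _ "\<lambda>r. complex_of_real t * complex_of_real (exp 1 * flat 0 (1 - 1 / (real 0 + 1)\<^sup>2 * r\<^sup>2))"]) simp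
  ultimately show ?thesis unfolding radial_constraint_set_def by blast
qed

text \<open>Stated for an arbitrary part \<open>X\<close> of the constraint set in order to serve
  both infima. The sequence consists of Borel representatives; its link to members of
  \<open>X\<close> is what transfers radial symmetry to it.\<close>

lemma minimizing_sequence:
  assumes X: "X \<noteq> {}" "X \<subseteq> constraint_set s p A" and A: "A \<in> borel_measurable borel"
  obtains m u where "(INF u\<in>X. magnetic_norm_sq s A u) = ennreal m" "0 < m" "\<And>n. u n \<in> H A" "\<And>n. I (u n) = 1"
    "(\<lambda>n. Q A (u n)) \<longlonglongrightarrow> m" "\<And>n. \<exists>v\<in>X. AE x in lborel. v x = u n x"
proof -
  define \<mu> where "\<mu> = (INF u\<in>X. magnetic_norm_sq s A u)"
  obtain v0 where v0: "v0 \<in> X" using X by blast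
  obtain w0 where "magnetic_norm_sq s A v0 = ennreal (Q A w0)"
    using constraint_set_representative[of v0 A] v0 X(2) A by blast
  then have "\<mu> \<le> ennreal (Q A w0)" unfolding \<mu>_def using INF_lower[OF v0, of "magnetic_norm_sq s A"] by simp
  then have "\<mu> < \<infinity>" by (auto intro: le_less_trans)
  then obtain m where m: "\<mu> = ennreal m" "0 \<le> m" by (cases \<mu>) auto
  have "\<exists>v. v \<in> H A \<and> I v = 1 \<and> Q A v < m + 1 / real (Suc n) \<and> m \<le> Q A v \<and> (\<exists>u\<in>X. AE x in lborel. u x = v x)" for n
  proof -
    have "\<mu> < ennreal (m + 1 / real (Suc n))" using m by (simp add: ennreal_less_iff)
    then obtain u where u: "u \<in> X" "magnetic_norm_sq s A u < ennreal (m + 1 / real (Suc n))"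
      unfolding \<mu>_def INF_less_iff by blast
    then obtain v where v: "v \<in> H A" "I v = 1" "AE x in lborel. u x = v x" "magnetic_norm_sq s A u = ennreal (Q A v)"
      using constraint_set_representative[of u A] X(2) A by blast
    have "ennreal m \<le> ennreal (Q A v)" using INF_lower[OF u(1), of "magnetic_norm_sq s A"] v(4) m by (simp add: \<mu>_def)
    then have "m \<le> Q A v" using Q_nonneg by simp
    moreover have "Q A v < m + 1 / real (Suc n)" using u(2) v(4) Q_nonneg by (simp add: ennreal_less_iff)
    ultimately show ?thesis using v u(1) by blast
  qed
  then obtain u where u: "\<And>n. u n \<in> H A" "\<And>n. I (u n) = 1" "\<And>n. Q A (u n) < m + 1 / real (Suc n)" "\<And>n. m \<le> Q A (u n)"
      "\<And>n. \<exists>v\<in>X. AE x in lborel. v x = u n x" by metis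
  have lim: "(\<lambda>n. Q A (u n)) \<longlonglongrightarrow> m"
  proof (rule tendsto_sandwich[of "\<lambda>_. m"])
    show "(\<lambda>n. m + 1 / real (Suc n)) \<longlonglongrightarrow> m" by real_asymp
  qed (use u(3,4) in \<open>auto intro!: always_eventually less_imp_le\<close>)
  \<comment> \<open>The Sobolev inequality keeps the energy away from 0 under the constraint.
    Positivity permits cancelling \<open>m\<close> in the concavity argument.\<close>
  have "0 < m"
  proof (rule ccontr)
    assume "\<not> 0 < m"
    then have m0: "m = 0" using m by simp
    obtain C where C: "0 < C" "\<And>A u. u \<in> HA A \<Longrightarrow> I u \<le> C * Q A u powr (p / 2)" using HA_Lp_bound by blast
    have "(\<lambda>n. C * Q A (u n) powr (p / 2)) \<longlonglongrightarrow> C * m powr (p / 2)"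
      using p Q_nonneg by (intro tendsto_intros lim tendsto_powr') (auto simp: m0)
    moreover have "1 \<le> C * Q A (u n) powr (p / 2)" for n using C(2)[OF H_HA[OF u(1)[of n]]] u(2)[of n] by simp
    ultimately have "1 \<le> C * m powr (p / 2)" by (intro LIMSEQ_le_const) auto
    then show False using m0 p by simp
  qed
  then show thesis using that[of m u] m(1) u lim unfolding \<mu>_def by blast
qed

text \<open>Since \<open>2 / p < 1\<close>, every \<open>t\<close> strictly between 0 and 1
  satisfies \<open>t < t powr (2 / p)\<close>; a proper splitting would thus exceed 1.\<close>

lemma concave_splitting:
  fixes \<theta> :: real
  assumes "0 < \<theta>" "\<theta> \<le> 1" "\<theta> powr (2 / p) + (1 - \<theta>) powr (2 / p) \<le> 1"
  shows "\<theta> = 1"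
proof (rule ccontr)
  assume "\<theta> \<noteq> 1"
  then have \<theta>: "0 < \<theta>" "\<theta> < 1" using assms by auto
  have q: "2 / p < 1" using p by simp
  have gt: "t < t powr (2 / p)" if "0 < t" "t < 1" for t :: real
  proof -
    have "t powr 1 < t powr (2 / p)" using that q by (intro powr_less_mono') auto
    then show ?thesis using that by simp
  qed
  show False using gt[of \<theta>] gt[of "1 - \<theta>"] \<theta> assms(3) by simp
qed

text \<open>Homogeneous lower bounds hold for the remainders and for \<open>v0\<close>; adding them
  leaves only \<open>\<theta> = 1\<close>. The remainder inequality then reads
  \<open>0 \<le> m - Q A0 v0\<close>, so the energy bound and the constraint come out
  together.\<close>

lemma limit_of_minimizing_sequence:
  fixes A :: "nat \<Rightarrow> real^3 \<Rightarrow> real^3"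
  assumes A: "\<And>n. locally_bounded_potential (A n)" "locally_bounded_potential A0" "\<And>x. (\<lambda>n. A n x) \<longlonglongrightarrow> A0 x"
    and C: "\<And>R. \<exists>C. \<forall>n. \<forall>x\<in>cball 0 R. norm (A n x) \<le> C"
    and v: "\<And>n. v n \<in> H (A n)" "\<And>n. I (v n) = 1" "(\<lambda>n. Q (A n) (v n)) \<longlonglongrightarrow> m" "0 < m"
    and v0: "v0 \<in> borel_measurable borel" "AE x in lborel. (\<lambda>n. v n x) \<longlonglongrightarrow> v0 x" "I v0 \<noteq> 0"
    and lc: "\<And>n. lower_constant (A n) m" "lower_constant A0 m"
  shows "v0 \<in> H A0" "I v0 = 1" "Q A0 v0 \<le> m"
proof -
  note Am = A(1)[THEN locally_bounded_potentialD(1)] A(2)[THEN locally_bounded_potentialD(1)]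
  note vHA = v(1)[THEN H_HA]
  have vm[measurable]: "v n \<in> borel_measurable borel" for n by (rule HA_measurable[OF vHA])
  note [measurable] = v0(1)
  obtain K where K: "\<And>n. Q (A n) (v n) \<le> K"
    using convergent_imp_bounded_above[OF v(3)] by blast
  have DK: "L2sq (D (A n) (v n)) \<le> 2 / c_const s * K" for n
    by (rule quotient_integral_le[OF K])
  show v0H: "v0 \<in> H A0" by (rule H_limit[OF A C v(1) v0(1,2) K])
  note v0HA = H_HA[OF v0H]
  have limD: "AE z in lborel. (\<lambda>n. D (A n) (v n) z) \<longlonglongrightarrow> D A0 v0 z"
    using AE_lborel_fst_snd[OF v0(2)] by eventually_elim (intro quotient_tendsto A(3), auto)
  define \<theta> where "\<theta> = I v0"
  have \<theta>0: "0 < \<theta>" using v0(3) I_nonneg[of v0] by (simp add: \<theta>_def)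
  have \<theta>1: "\<theta> \<le> 1"
  proof -
    have "nnLp v0 = (\<integral>\<^sup>+x. liminf (\<lambda>n. ennreal (cmod (v n x) powr p)) \<partial>lborel)"
    proof (rule nn_integral_cong_AE)
      show "AE x in lborel. ennreal (cmod (v0 x) powr p) = liminf (\<lambda>n. ennreal (cmod (v n x) powr p))"
        using v0(2)
      proof eventually_elim
        case (elim x)
        have "(\<lambda>n. ennreal (cmod (v n x) powr p)) \<longlonglongrightarrow> ennreal (cmod (v0 x) powr p)"
          using p by (intro tendsto_ennrealI tendsto_powr' tendsto_norm elim tendsto_const) auto
        then show ?case by (intro lim_imp_Liminf[symmetric]) auto
      qed
    qed
    also have "\<dots> \<le> liminf (\<lambda>n. \<integral>\<^sup>+x. ennreal (cmod (v n x) powr p) \<partial>lborel)" by (rule nn_integral_liminf) simp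
    also have "\<dots> = 1" by (simp add: nn_integral_powr_eq[OF vHA] v(2) Liminf_const)
    finally show ?thesis by (simp add: nn_integral_powr_eq[OF v0HA] \<theta>_def)
  qed
  define vR where "vR R x = complex_of_real (cutoff R x) * v0 x" for R x
  have vRH: "vR R \<in> H (A n)" "vR R \<in> H A0" for R n
    unfolding vR_def[abs_def] by (rule H_cutoff[OF v0H A(2) A(1)], rule H_cutoff[OF v0H A(2) A(2)])
  have [measurable]: "vR R \<in> borel_measurable borel" for R by (rule HA_measurable[OF H_HA[OF vRH(2)]])
  have vRle: "cmod (vR R x) \<le> cmod (v0 x)" for R x
    using cutoff_bounds[of R x] by (simp add: vR_def norm_mult mult_left_le_one_le)
  have vRsupp: "vR R x \<noteq> 0 \<Longrightarrow> norm x \<le> real R + 1" for R x using cutoff_support[of R x] by (auto simp: vR_def)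
  have split_Q: "(\<lambda>n. Q (A n) (v n) - Q (A n) (\<lambda>x. v n x - vR R x)) \<longlonglongrightarrow> Q A0 v0 - Q A0 (\<lambda>x. v0 x - vR R x)" for R
  proof -
    have 1: "(\<lambda>n. L2sq (v n) - L2sq (\<lambda>x. v n x - vR R x)) \<longlonglongrightarrow>
       L2sq v0 - L2sq (\<lambda>x. v0 x - vR R x)"
    proof (rule square_integrable_splitting[OF HA_L2(1)[OF vHA] HA_L2(1)[OF v0HA] _ HA_L2(1)[OF H_HA[OF vRH(2)]] HA_L2(2)[OF v0HA] _ _ v0(2)])
      show "AE x in lborel. (cmod (vR R x))\<^sup>2 \<le> (cmod (v0 x))\<^sup>2" using vRle by (intro AE_I2 power_mono) auto
      show "L2sq (v n) \<le> K" for n by (rule order_trans[OF Q_bounds(1) K])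
    qed auto
    \<comment> \<open>The quotients of the fixed truncation \<open>vR R\<close> still vary with
      \<open>A n\<close>. The uniform bound on a ball one larger than its support yields a
      dominating function independent of \<open>n\<close>.\<close>
    obtain C1 where C1: "\<And>n x. x \<in> cball 0 (real R + 1 + 1) \<Longrightarrow> norm (A n x) \<le> C1" using C by blast
    have C2: "norm (A n x - A0 x) \<le> 2 * C1" if "x \<in> cball 0 (real R + 1 + 1)" for x n
      by (rule limit_diff_bound[OF A(3) C1[OF that]])
    have 2: "(\<lambda>n. L2sq (D (A n) (v n)) - L2sq (\<lambda>z. D (A n) (v n) z - D (A n) (vR R) z)) \<longlonglongrightarrow>
       L2sq (D A0 v0) - L2sq (\<lambda>z. D A0 v0 z - D A0 (vR R) z)"
    proof (rule square_integrable_splitting[OF HA_D(1)[OF vHA] HA_D(1)[OF v0HA] _ HA_D(1)[OF H_HA[OF vRH(2)]] _ _ DK limD])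
      show "D (A n) (vR R) \<in> borel_measurable lborel" for n using quotient_measurable[OF Am(1), of "vR R"] by simp
      show "integrable lborel (\<lambda>z. 2 * (cmod (D A0 (vR R) z))\<^sup>2 + 2 * (max 2 (2 * C1))\<^sup>2 * ((cmod (vR R (fst z)))\<^sup>2 * \<kappa> (fst z - snd z)))"
        using HA_D(2)[OF H_HA[OF vRH(2)[of R]]] kernel_fubini(1)[OF HA_L2(1)[OF H_HA[OF vRH(2)[of R]]]] by simp
      show "AE z in lborel. (cmod (D (A n) (vR R) z))\<^sup>2 \<le> 2 * (cmod (D A0 (vR R) z))\<^sup>2 + 2 * (max 2 (2 * C1))\<^sup>2 * ((cmod (vR R (fst z)))\<^sup>2 * \<kappa> (fst z - snd z))" for n
        by (intro AE_I2 quotient_phase_le_supported(2)[OF vRsupp C2])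
      show "AE z in lborel. (\<lambda>n. D (A n) (vR R) z) \<longlonglongrightarrow> D A0 (vR R) z"
        by (intro AE_I2 quotient_tendsto A(3) tendsto_const)
    qed
    have "(\<lambda>n. (L2sq (v n) - L2sq (\<lambda>x. v n x - vR R x))
      + c_const s / 2 * (L2sq (D (A n) (v n)) - L2sq (\<lambda>z. D (A n) (v n) z - D (A n) (vR R) z)))
      \<longlonglongrightarrow> (L2sq v0 - L2sq (\<lambda>x. v0 x - vR R x))
      + c_const s / 2 * (L2sq (D A0 v0) - L2sq (\<lambda>z. D A0 v0 z - D A0 (vR R) z))"
      by (intro tendsto_add tendsto_mult tendsto_const 1 2)
    then show ?thesis unfolding Q_def quotient_diff by (simp add: algebra_simps)
  qed
  have split_I: "(\<lambda>n. I (\<lambda>x. v n x - vR R x)) \<longlonglongrightarrow> 1 - \<theta> + I (\<lambda>x. v0 x - vR R x)" for R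
  proof -
    have "(\<lambda>n. (\<integral>x. cmod (v n x) powr p \<partial>lborel) - (\<integral>x. cmod (v n x - vR R x) powr p \<partial>lborel)) \<longlonglongrightarrow>
     (\<integral>x. cmod (v0 x) powr p \<partial>lborel) - (\<integral>x. cmod (v0 x - vR R x) powr p \<partial>lborel)"
    proof (rule powr_splitting(2)[OF _ _ _ HA_Lp[OF vHA] HA_Lp[OF v0HA] HA_Lp[OF H_HA[OF vRH(2)]] _ _ v0(2)])
      show "integrable lborel (\<lambda>x. cmod (v0 x - vR R x) powr p)" by (rule HA_Lp[OF HA_diff[OF v0HA H_HA[OF vRH(2)]]])
      show "(\<integral>x. cmod (v n x) powr p \<partial>lborel) \<le> 1" for n using v(2)[of n] by (simp add: I_def)
    qed (use p in auto)
    then have "(\<lambda>n. 1 - I (\<lambda>x. v n x - vR R x)) \<longlonglongrightarrow> \<theta> - I (\<lambda>x. v0 x - vR R x)"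
      using v(2) by (simp add: I_def \<theta>_def)
    from tendsto_diff[OF tendsto_const[of 1] this]
    have "(\<lambda>n. 1 - (1 - I (\<lambda>x. v n x - vR R x))) \<longlonglongrightarrow> 1 - (\<theta> - I (\<lambda>x. v0 x - vR R x))" .
    moreover have "1 - (\<theta> - I (\<lambda>x. v0 x - vR R x)) = 1 - \<theta> + I (\<lambda>x. v0 x - vR R x)" by simp
    ultimately show ?thesis by (simp only: diff_diff_eq2 add_diff_cancel_left')
  qed
  \<comment> \<open>First limit, \<open>n\<close> to infinity at fixed \<open>R\<close>: the lower
    bound for the potential \<open>A n\<close> is applied to the remainder after the truncated
    profile has been removed.\<close>
  have key: "m * (1 - \<theta> + I (\<lambda>x. v0 x - vR R x)) powr (2 / p) \<le> m - (Q A0 v0 - Q A0 (\<lambda>x. v0 x - vR R x))" for R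
  proof (rule LIMSEQ_le)
    show "(\<lambda>n. m * I (\<lambda>x. v n x - vR R x) powr (2 / p)) \<longlonglongrightarrow> m * (1 - \<theta> + I (\<lambda>x. v0 x - vR R x)) powr (2 / p)"
      using p I_nonneg by (intro tendsto_mult tendsto_const tendsto_powr' split_I) auto
    have "(\<lambda>n. Q (A n) (v n) - (Q (A n) (v n) - Q (A n) (\<lambda>x. v n x - vR R x))) \<longlonglongrightarrow> m - (Q A0 v0 - Q A0 (\<lambda>x. v0 x - vR R x))"
      by (intro tendsto_diff v(3) split_Q)
    then show "(\<lambda>n. Q (A n) (\<lambda>x. v n x - vR R x)) \<longlonglongrightarrow> m - (Q A0 v0 - Q A0 (\<lambda>x. v0 x - vR R x))" by simp
    show "\<exists>N. \<forall>n\<ge>N. m * I (\<lambda>x. v n x - vR R x) powr (2 / p) \<le> Q (A n) (\<lambda>x. v n x - vR R x)"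
      using lc(1) H_diff[OF v(1) vRH(1)] by (auto simp: lower_constant_def)
  qed
  have Q0: "(\<lambda>R. Q A0 (\<lambda>x. v0 x - vR R x)) \<longlonglongrightarrow> 0"
    unfolding vR_def
    by (rule Q_cutoff_tendsto[OF v0HA Am(2) cutoff_measurable cutoff_bounds(3) cutoff_Lipschitz cutoff_tendsto])
  have I0: "(\<lambda>R. I (\<lambda>x. v0 x - vR R x)) \<longlonglongrightarrow> 0"
  proof -
    obtain C where C: "0 < C" "\<And>A u. u \<in> HA A \<Longrightarrow> I u \<le> C * Q A u powr (p / 2)" using HA_Lp_bound by blast
    show ?thesis
    proof (rule tendsto_sandwich[of "\<lambda>_. 0"])
      have "(\<lambda>R. C * Q A0 (\<lambda>x. v0 x - vR R x) powr (p / 2)) \<longlonglongrightarrow> C * 0 powr (p / 2)"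
        using p Q_nonneg by (intro tendsto_mult tendsto_const tendsto_powr' Q0) auto
      then show "(\<lambda>R. C * Q A0 (\<lambda>x. v0 x - vR R x) powr (p / 2)) \<longlonglongrightarrow> 0" using p by simp
      show "\<forall>\<^sub>F R in sequentially. I (\<lambda>x. v0 x - vR R x) \<le> C * Q A0 (\<lambda>x. v0 x - vR R x) powr (p / 2)"
        by (intro always_eventually allI C(2) HA_diff v0HA H_HA vRH(2))
    qed (use I_nonneg in auto)
  qed
  \<comment> \<open>Second limit, \<open>R\<close> to infinity: energy and \<open>L^p\<close>
    integral of \<open>v0 - vR R\<close> both vanish, the latter by the Sobolev inequality.\<close>
  have main: "m * (1 - \<theta>) powr (2 / p) \<le> m - Q A0 v0"
  proof (rule LIMSEQ_le)
    have "(\<lambda>R. m * (1 - \<theta> + I (\<lambda>x. v0 x - vR R x)) powr (2 / p)) \<longlonglongrightarrow> m * (1 - \<theta> + 0) powr (2 / p)"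
      using p \<theta>1 I_nonneg by (intro tendsto_mult tendsto_add tendsto_const tendsto_powr' I0) auto
    then show "(\<lambda>R. m * (1 - \<theta> + I (\<lambda>x. v0 x - vR R x)) powr (2 / p)) \<longlonglongrightarrow> m * (1 - \<theta>) powr (2 / p)" by simp
    have "(\<lambda>R. m - (Q A0 v0 - Q A0 (\<lambda>x. v0 x - vR R x))) \<longlonglongrightarrow> m - (Q A0 v0 - 0)"
      by (intro tendsto_diff tendsto_const Q0)
    then show "(\<lambda>R. m - (Q A0 v0 - Q A0 (\<lambda>x. v0 x - vR R x))) \<longlonglongrightarrow> m - Q A0 v0" by simp
  qed (use key in auto)
  have "m * \<theta> powr (2 / p) \<le> Q A0 v0" using lc(2) v0H by (simp add: lower_constant_def \<theta>_def)
  with main have "m * (\<theta> powr (2 / p) + (1 - \<theta>) powr (2 / p)) \<le> m * 1" by (simp add: algebra_simps)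
  then have "\<theta> powr (2 / p) + (1 - \<theta>) powr (2 / p) \<le> 1" using v(4) by (simp only: mult_le_cancel_left_pos)
  then have "\<theta> = 1" by (rule concave_splitting[OF \<theta>0 \<theta>1])
  then show "I v0 = 1" by (simp add: \<theta>_def)
  show "Q A0 v0 \<le> m" using main \<open>\<theta> = 1\<close> p by simp
qed

text \<open>The generation \<open>k\<close> in \<open>vanishing\<close> depends on
  \<open>\<eta>\<close>. A cell of any generation has diameter at most 3 and lies in the ball of
  radius 3 about each of its points, so one fixed radius serves for all
  \<open>\<eta>\<close>.\<close>

lemma small_balls_imp_small_Lp:
  assumes \<eta>: "0 < \<eta>"
  shows "\<exists>\<delta>>0. \<forall>A. \<forall>u\<in>HA A. Q A u \<le> K \<longrightarrow> (\<forall>\<xi>. ball_mass \<xi> 3 u \<le> ennreal \<delta>) \<longrightarrow> I u \<le> \<eta>"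
proof -
  define K' where "K' = max K (2 / c_const s * K)"
  obtain k \<delta> where \<delta>: "0 < \<delta>" "\<forall>f\<in>HS. N f \<le> K' \<longrightarrow> E f \<le> K' \<longrightarrow>
    (\<forall>m. L2sq (\<lambda>y. indicator (dyadic_cell k m) y * f y) \<le> \<delta>) \<longrightarrow> nnLp f \<le> ennreal \<eta>"
    using vanishing[OF \<eta>, of K'] by blast
  have "I u \<le> \<eta>" if u: "u \<in> HA A" and K: "Q A u \<le> K" and ball: "\<And>\<xi>. ball_mass \<xi> 3 u \<le> ennreal \<delta>" for A u
  proof -
    let ?a = "\<lambda>x. complex_of_real (cmod (u x))"
    note d = diamagnetic[OF u]
    have "2 / c_const s * Q A u \<le> 2 / c_const s * K"
      by (rule mult_left_mono[OF K]) (use const_pos in simp)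
    then have NE: "N ?a \<le> K'" "E ?a \<le> K'"
      using d(2,3) K unfolding K'_def by (meson max.coboundedI1 max.coboundedI2 order_trans)+
    have cell: "L2sq (\<lambda>y. indicator (dyadic_cell k m) y * ?a y) \<le> \<delta>" for m
    proof (cases "dyadic_cell k m = {}")
      case False
      then obtain \<xi> where \<xi>: "\<xi> \<in> dyadic_cell k m" by blast
      have sub: "dyadic_cell k m \<subseteq> cball \<xi> 3"
      proof
        fix y assume "y \<in> dyadic_cell k m"
        then have "norm (\<xi> - y) \<le> 3 / 2 ^ k" using \<xi> by (intro dyadic_diameter) (simp add: dyadic_cell_def)
        also have "\<dots> \<le> 3 / 1" by (intro divide_left_mono) auto
        finally show "y \<in> cball \<xi> 3" by (simp add: dist_norm)
      qed
      have "ennreal (L2sq (\<lambda>y. indicator (dyadic_cell k m) y * ?a y))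
         = (\<integral>\<^sup>+y. ennreal ((cmod (indicator (dyadic_cell k m) y * ?a y))\<^sup>2) \<partial>lborel)"
        by (rule nn_integral_square[symmetric, OF square_integrable_cell_mult[OF HA_L2(1)[OF d(1)]]])
      also have "\<dots> \<le> ball_mass \<xi> 3 u"
        using sub by (intro nn_integral_mono) (auto simp: indicator_def)
      also have "\<dots> \<le> ennreal \<delta>" by (rule ball)
      finally show ?thesis using \<delta>(1) by simp
    qed (use \<delta>(1) in simp)
    have "nnLp ?a \<le> ennreal \<eta>" using bspec[OF \<delta>(2) d(1)] NE cell by blast
    then have "ennreal (I u) \<le> ennreal \<eta>" by (simp add: nn_integral_powr_eq[OF u])
    then show ?thesis using \<eta> by simp
  qed
  then show ?thesis using \<delta>(1) by blast
qed

lemma nonvanishing: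
  fixes u :: "nat \<Rightarrow> real^3 \<Rightarrow> complex"
  assumes u: "\<And>n. u n \<in> HA A" "\<And>n. I (u n) = 1" and K: "\<And>n. Q A (u n) \<le> K"
  obtains \<delta> \<xi> where "0 < \<delta>" "\<And>n. ennreal \<delta> \<le> ball_mass (\<xi> n) 3 (u n)"
proof -
  have "(0 :: real) < 1 / 2" by simp
  then obtain \<delta> where \<delta>: "0 < \<delta>"
    "\<forall>A. \<forall>u\<in>HA A. Q A u \<le> K \<longrightarrow> (\<forall>\<xi>. ball_mass \<xi> 3 u \<le> ennreal \<delta>) \<longrightarrow> I u \<le> 1 / 2"
    using small_balls_imp_small_Lp[of "1 / 2" K] by blast
  have "\<exists>\<xi>. ennreal \<delta> \<le> ball_mass \<xi> 3 (u n)" for n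
  proof (rule ccontr)
    assume "\<not> ?thesis"
    then have "\<forall>\<xi>. ball_mass \<xi> 3 (u n) \<le> ennreal \<delta>" by (meson linear)
    then have "I (u n) \<le> 1 / 2" using \<delta>(2) u(1)[of n] K[of n] by blast
    then show False using u(2)[of n] by simp
  qed
  then obtain \<xi> where "\<And>n. ennreal \<delta> \<le> ball_mass (\<xi> n) 3 (u n)" by metis
  then show thesis using \<delta>(1) that by blast
qed

text \<open>If \<open>v0\<close> vanished almost everywhere, the local \<open>L^2\<close>
  convergence would say that the mass of \<open>v n\<close> itself in the ball tends to 0.\<close>

lemma nonzero_limit:
  assumes \<delta>: "0 < \<delta>" "\<And>n. ennreal \<delta> \<le> ball_mass 0 R (v n)"
    and lim: "(\<lambda>n. \<integral>\<^sup>+x. indicator (cball 0 R) x * ennreal ((cmod (v n x - v0 x))\<^sup>2) \<partial>lborel) \<longlonglongrightarrow> 0"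
    and v0: "v0 \<in> HA A"
  shows "I v0 \<noteq> 0"
proof
  assume "I v0 = 0"
  then have "AE x in lborel. cmod (v0 x) powr p = 0"
    using integral_nonneg_eq_0_iff_AE[OF HA_Lp[OF v0]] by (simp add: I_def)
  then have "ball_mass 0 R (\<lambda>x. v n x - v0 x)
     = ball_mass 0 R (v n)" for n
    by (intro nn_integral_cong_AE) (auto elim!: eventually_mono)
  then have "ennreal \<delta> \<le> 0" using \<delta>(2) by (intro LIMSEQ_le_const[OF lim]) auto
  then show False using \<delta>(1) by simp
qed

end

section \<open>Existence of minimizers\<close>

text \<open>Boxes determine Lebesgue measure, and the preimage of a box is its image under the
  inverse rotation, which has the same measure.\<close>

lemma lborel_distr_orthogonal:
  fixes T :: "real^3 \<Rightarrow> real^3"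
  assumes T: "orthogonal_transformation T"
  shows "distr lborel borel T = lborel"
proof (rule lborel_eqI[symmetric])
  have lin: "linear T" by (rule orthogonal_transformation_linear[OF T])
  have Tm: "T \<in> borel_measurable borel"
    by (intro borel_measurable_continuous_onI linear_continuous_on linear_conv_bounded_linear[THEN iffD1] lin)
  have Ti: "orthogonal_transformation (inv T)" by (rule orthogonal_transformation_inv[OF T])
  have bij: "bij T" by (rule orthogonal_transformation_bij[OF T])
  fix l u :: "real^3" assume le: "\<And>b. b \<in> Basis \<Longrightarrow> l \<bullet> b \<le> u \<bullet> b"
  have "T -` box l u = inv T ` box l u" by (rule bij_vimage_eq_inv_image[OF bij])
  moreover have "measure lebesgue (inv T ` box l u) = measure lebesgue (box l u)"
    by (rule measure_orthogonal_image[OF Ti]) simp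
  moreover have fin: "inv T ` box l u \<in> lmeasurable"
    using measurable_orthogonal_image[OF Ti] by simp
  moreover have "box l u \<in> lmeasurable" by simp
  ultimately have "emeasure lebesgue (T -` box l u) = emeasure lebesgue (box l u)"
    by (simp only: emeasure_eq_measure2)
  moreover have "T -` box l u \<in> sets borel" using measurable_sets[OF Tm, of "box l u"] by simp
  ultimately have "emeasure lborel (T -` box l u) = emeasure lborel (box l u)" by simp
  then show "emeasure (distr lborel borel T) (box l u) = ennreal (\<Prod>b\<in>Basis. (u - l) \<bullet> b)"
    using Tm le by (simp add: emeasure_distr emeasure_lborel_box_eq inner_diff_left)
qed simp

lemma nn_integral_shift_ball:
  fixes u :: "real^3 \<Rightarrow> complex"
  assumes "u \<in> borel_measurable borel"
  shows "ball_mass 0 R (\<lambda>x. gauge_shift h \<xi> u x)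
     = ball_mass \<xi> R u"
proof -
  have [measurable]: "u \<in> borel_measurable borel" by fact
  have "indicator (cball \<xi> R) \<in> borel_measurable (borel :: (real^3) measure)"
    by (intro borel_measurable_indicator borel_closed closed_cball)
  then have "(\<lambda>x. indicator (cball \<xi> R) x * ennreal ((cmod (u x))\<^sup>2)) \<in> borel_measurable borel" by measurable
  from nn_integral_lborel_shift[OF this, of \<xi>] show ?thesis
    by (simp add: cmod_gauge_shift indicator_def dist_norm)
qed

text \<open>Disjoint rotated copies of a distant ball carry the same mass of a radial function.\<close>

lemma radial_decay:
  "\<exists>R0. \<forall>w \<xi>. w \<in> borel_measurable borel \<longrightarrow> radially_symmetric w \<longrightarrow> R0 \<le> norm \<xi> \<longrightarrow>
     of_nat n * ball_mass \<xi> 3 w \<le> (\<integral>\<^sup>+x. ennreal ((cmod (w x))\<^sup>2) \<partial>lborel)"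
proof -
  \<comment> \<open>A finite connected set has at most one point, but the sphere contains an
    antipodal pair. An infinite sphere provides any number of directions for the rotated
    copies.\<close>
  have "infinite (sphere (0 :: real^3) 1)"
  proof
    assume fin: "finite (sphere (0 :: real^3) 1)"
    have "connected (sphere (0 :: real^3) 1)" by (rule connected_sphere) simp
    then have "sphere (0 :: real^3) 1 = {} \<or> (\<exists>x. sphere (0 :: real^3) 1 = {x})"
      using connected_finite_iff_sing fin by blast
    moreover have ax: "axis 1 1 \<in> sphere (0 :: real^3) 1" "- axis 1 1 \<in> sphere (0 :: real^3) 1" by simp_all
    ultimately obtain x where x: "sphere (0 :: real^3) 1 = {x}" by blast
    have "axis 1 1 = x" "- axis 1 1 = x" using ax unfolding x singleton_iff by this+
    moreover have "axis 1 1 \<noteq> - (axis 1 1 :: real^3)"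
    proof
      assume e: "axis 1 1 = - (axis 1 1 :: real^3)"
      from arg_cong[OF e, of "\<lambda>v. v $ 1"] show False by (simp add: axis_def)
    qed
    ultimately show False by auto
  qed
  then obtain S where S: "finite S" "card S = n" "S \<subseteq> sphere (0 :: real^3) 1"
    using infinite_arbitrarily_large by blast
  \<comment> \<open>The element 1 keeps the set nonempty when \<open>S\<close> has fewer than two
    points.\<close>
  define W where "W = insert 1 ((\<lambda>(x, y). dist x y) ` (S \<times> S - Id))"
  have W: "finite W" "W \<noteq> {}" "\<And>d. d \<in> W \<Longrightarrow> 0 < d"
    using S(1) by (auto simp: W_def)
  define d where "d = Min W"
  have d: "0 < d" using W by (simp add: d_def)
  have dist: "d \<le> dist x y" if "x \<in> S" "y \<in> S" "x \<noteq> y" for x y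
    unfolding d_def by (rule Min_le[OF W(1)]) (use that in \<open>auto simp: W_def intro!: image_eqI[of _ _ "(x, y)"]\<close>)
  show ?thesis
  \<comment> \<open>Centres in distinct directions are then at least 7 apart, while intersecting
    balls of radius 3 have centres at distance at most 6.\<close>
  proof (intro exI[of _ "7 / d"] allI impI)
    fix w :: "real^3 \<Rightarrow> complex" and \<xi> :: "real^3"
    assume [measurable]: "w \<in> borel_measurable borel" and rad: "radially_symmetric w" and \<xi>: "7 / d \<le> norm \<xi>"
    obtain g where g: "AE x in lborel. w x = g (norm x)"
      using rad unfolding radially_symmetric_def by (auto simp: AE_completion_iff)
    have im: "indicator (cball z 3) \<in> borel_measurable (borel :: (real^3) measure)" for z :: "real^3"
      by (intro borel_measurable_indicator borel_closed closed_cball)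
    define F where "F z = ball_mass z 3 w" for z :: "real^3"
    have F_rot: "F z = F \<xi>" if nz: "norm z = norm \<xi>" for z
    proof -
      obtain T where T: "orthogonal_transformation T" "T \<xi> = z"
        using orthogonal_transformation_exists[of \<xi> z] nz by metis
      note eq = lborel_distr_orthogonal[OF T(1)]
      have Tm[measurable]: "T \<in> borel_measurable borel"
        by (intro borel_measurable_continuous_onI linear_continuous_on linear_conv_bounded_linear[THEN iffD1] orthogonal_transformation_linear T)
      have "AE x in distr lborel borel T. w x = g (norm x)" unfolding eq by (rule g)
      then have "AE x in lborel. w (T x) = g (norm (T x))" by (rule AE_distrD[rotated]) simp
      then have wT: "AE x in lborel. w (T x) = w x"
        using g by eventually_elim (simp add: orthogonal_transformation_norm[OF T(1)])
      have cb: "indicator (cball z 3) (T x) = (indicator (cball \<xi> 3) x :: ennreal)" for x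
      proof -
        have "dist (T \<xi>) (T x) = dist \<xi> x" using T(1) unfolding orthogonal_transformation_isometry by blast
        then show ?thesis using T(2) by (simp add: indicator_def)
      qed
      have "F z = (\<integral>\<^sup>+x. indicator (cball z 3) x * ennreal ((cmod (w x))\<^sup>2) \<partial>(distr lborel borel T))"
        unfolding eq F_def ..
      also have "\<dots> = (\<integral>\<^sup>+x. indicator (cball z 3) (T x) * ennreal ((cmod (w (T x)))\<^sup>2) \<partial>lborel)"
        by (rule nn_integral_distr) (use im in measurable)
      also have "\<dots> = F \<xi>" unfolding F_def cb
        by (rule nn_integral_cong_AE) (use wT in eventually_elim, simp)
      finally show ?thesis .
    qed
    have "of_nat n * F \<xi> = (\<Sum>x\<in>S. F (norm \<xi> *\<^sub>R x))"
    proof -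
      have "(\<Sum>x\<in>S. F (norm \<xi> *\<^sub>R x)) = (\<Sum>x\<in>S. F \<xi>)"
        by (rule sum.cong[OF refl], rule F_rot) (use S(3) in auto)
      then show ?thesis using S(2) by simp
    qed
    also have "\<dots> = (\<integral>\<^sup>+y. (\<Sum>x\<in>S. indicator (cball (norm \<xi> *\<^sub>R x) 3) y * ennreal ((cmod (w y))\<^sup>2)) \<partial>lborel)"
      unfolding F_def by (rule nn_integral_sum[symmetric]) (use im in measurable)
    also have "\<dots> \<le> (\<integral>\<^sup>+y. ennreal ((cmod (w y))\<^sup>2) \<partial>lborel)"
    proof (rule nn_integral_mono)
      fix y
      have "(\<Sum>x\<in>S. indicator (cball (norm \<xi> *\<^sub>R x) 3) y :: ennreal) \<le> 1"
      proof (cases "\<exists>x\<in>S. y \<in> cball (norm \<xi> *\<^sub>R x) 3")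
        case True
        then obtain x where x: "x \<in> S" "y \<in> cball (norm \<xi> *\<^sub>R x) 3" by blast
        have "y \<notin> cball (norm \<xi> *\<^sub>R x') 3" if "x' \<in> S" "x' \<noteq> x" for x'
        proof
          assume "y \<in> cball (norm \<xi> *\<^sub>R x') 3"
          then have "dist (norm \<xi> *\<^sub>R x') (norm \<xi> *\<^sub>R x) \<le> 6"
            using x(2) dist_triangle2[of "norm \<xi> *\<^sub>R x'" "norm \<xi> *\<^sub>R x" y] by simp
          moreover have "dist (norm \<xi> *\<^sub>R x') (norm \<xi> *\<^sub>R x) = norm \<xi> * dist x' x"
            by (simp add: dist_norm flip: scaleR_diff_right)
          moreover have "7 / d * d \<le> norm \<xi> * dist x' x"
            using \<xi> dist[OF that(1) x(1) that(2)] d by (intro mult_mono) auto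
          ultimately show False using d by simp
        qed
        then have "(\<Sum>x\<in>S. indicator (cball (norm \<xi> *\<^sub>R x) 3) y :: ennreal) = (\<Sum>x'\<in>S. if x' = x then 1 else 0)"
          using x(2) by (intro sum.cong) (auto simp: indicator_def)
        then show ?thesis using x(1) S(1) by simp
      next
        case False
        then have "(\<Sum>x\<in>S. indicator (cball (norm \<xi> *\<^sub>R x) 3) y :: ennreal) = (\<Sum>x\<in>S. 0)"
          by (intro sum.cong) (auto simp: indicator_def)
        then show ?thesis by simp
      qed
      then have "(\<Sum>x\<in>S. indicator (cball (norm \<xi> *\<^sub>R x) 3) y :: ennreal) * ennreal ((cmod (w y))\<^sup>2) \<le> 1 * ennreal ((cmod (w y))\<^sup>2)"
        by (rule mult_right_mono) simp
      then show "(\<Sum>x\<in>S. indicator (cball (norm \<xi> *\<^sub>R x) 3) y * ennreal ((cmod (w y))\<^sup>2)) \<le> ennreal ((cmod (w y))\<^sup>2)"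
        by (simp only: sum_distrib_right mult_1)
    qed
    finally show "of_nat n * ball_mass \<xi> 3 w \<le> (\<integral>\<^sup>+x. ennreal ((cmod (w x))\<^sup>2) \<partial>lborel)"
      unfolding F_def .
  qed
qed

section \<open>Stability of radial symmetry\<close>

lemma radially_symmetric_cong_AE:
  assumes "radially_symmetric u" "AE x in lborel. u x = v x"
  shows "radially_symmetric v"
proof -
  obtain g where "AE x in lborel. u x = g (norm x)"
    using assms(1) unfolding radially_symmetric_def by (auto simp: AE_completion_iff)
  with assms(2) have "AE x in lborel. v x = g (norm x)" by eventually_elim simp
  then show ?thesis unfolding radially_symmetric_def by (auto simp: AE_completion_iff)
qed

lemma radially_symmetric_diff:
  assumes "radially_symmetric u" "radially_symmetric v"
  shows "radially_symmetric (\<lambda>x. u x - v x)"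
proof -
  obtain f g where "AE x in lborel. u x = f (norm x)" "AE x in lborel. v x = g (norm x)"
    using assms unfolding radially_symmetric_def by (auto simp: AE_completion_iff)
  then have a: "AE x in lborel. u x - v x = f (norm x) - g (norm x)" by eventually_elim simp
  show ?thesis unfolding radially_symmetric_def AE_completion_iff
    by (intro exI[of _ "\<lambda>r. f r - g r"]) (use a in simp)
qed

text \<open>The limit of the profiles is a profile of the limit; \<open>lim\<close> is total, so the
  profile also has some value at radii where the sequence does not converge.\<close>

lemma radially_symmetric_limit:
  assumes u: "\<And>n. radially_symmetric (u n)" and lim: "AE x in lborel. (\<lambda>n. u n x) \<longlonglongrightarrow> u0 x"
  shows "radially_symmetric u0"
proof -
  have "\<forall>n. \<exists>g. AE x in lborel. u n x = g (norm x)"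
    using u unfolding radially_symmetric_def by (simp add: AE_completion_iff)
  then obtain g where "\<And>n. AE x in lborel. u n x = g n (norm x)" by metis
  then have "AE x in lborel. \<forall>n. u n x = g n (norm x)" by (simp add: AE_all_countable)
  then have a: "AE x in lborel. u0 x = lim (\<lambda>n. g n (norm x))"
    using lim by eventually_elim (simp add: limI)
  show ?thesis unfolding radially_symmetric_def AE_completion_iff
    by (intro exI[of _ "\<lambda>r. lim (\<lambda>n. g n r)"]) (use a in simp)
qed

context fractional_subcritical
begin

lemma attained_constraint:
  assumes v: "v \<in> H A" "I v = 1" "Q A v \<le> m" and m: "(INF u\<in>X. magnetic_norm_sq s A u) = ennreal m"
    and A: "A \<in> borel_measurable borel" and X: "v \<in> X"
  shows "magnetic_norm_sq s A v = (INF u\<in>X. magnetic_norm_sq s A u)"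
proof (rule antisym)
  show "magnetic_norm_sq s A v \<le> (INF u\<in>X. magnetic_norm_sq s A u)"
    unfolding m magnetic_norm_sq_HA[OF H_HA[OF v(1)] A] by (rule ennreal_leI[OF v(3)])
qed (rule INF_lower[OF X])

text \<open>Magnetic translations by the centres carry the retained mass to a fixed ball, keep
  energy and constraint, and replace \<open>A\<close> by translates tending to \<open>A0\<close>.
  Allowing \<open>A0\<close> to differ from \<open>A\<close> covers both genuine minimizers
  (\<open>A0 = A\<close>) and competitors for a limit potential.\<close>

lemma compactness_up_to_gauge:
  fixes u :: "nat \<Rightarrow> real^3 \<Rightarrow> complex"
  assumes A: "locally_bounded_potential A" "locally_bounded_potential A0"
    and lim: "\<And>x. (\<lambda>n. A (x + \<xi> n) + h n) \<longlonglongrightarrow> A0 x"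
    and C: "\<And>R. \<exists>C. \<forall>n. \<forall>x\<in>cball 0 R. norm (A (x + \<xi> n) + h n) \<le> C"
    and u: "\<And>n. u n \<in> H A" "\<And>n. I (u n) = 1" "(\<lambda>n. Q A (u n)) \<longlonglongrightarrow> m" "0 < m"
    and lc: "lower_constant A m" "lower_constant A0 m"
    and \<delta>: "0 < \<delta>" "\<And>n. ennreal \<delta> \<le> ball_mass (\<xi> n) R (u n)"
  shows "\<exists>v\<in>H A0. I v = 1 \<and> Q A0 v \<le> m"
proof -
  have Am[measurable]: "A \<in> borel_measurable borel" by (rule locally_bounded_potentialD[OF A(1)])
  define A' where "A' n = (\<lambda>x. A (x + \<xi> n) + h n)" for n
  have A'm[measurable]: "A' n \<in> borel_measurable borel" for n unfolding A'_def by measurable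
  have A'b: "\<exists>C. \<forall>n. \<forall>x\<in>cball 0 R. norm (A' n x) \<le> C" for R unfolding A'_def by (rule C)
  have A'lb: "locally_bounded_potential (A' n)" for n
    unfolding locally_bounded_potential_def using A'b A'm by metis
  have A'lim: "(\<lambda>n. A' n x) \<longlonglongrightarrow> A0 x" for x unfolding A'_def by (rule lim)
  define v where "v n = gauge_shift (h n) (\<xi> n) (u n)" for n
  have um: "u n \<in> borel_measurable borel" for n by (rule HA_measurable[OF H_HA[OF u(1)]])
  have vH: "v n \<in> H (A' n)" for n unfolding v_def A'_def by (rule H_gauge_shift[OF u(1) Am])
  have vI: "I (v n) = 1" for n unfolding v_def by (simp add: I_gauge_shift[OF um] u(2))
  have vQ: "Q (A' n) (v n) = Q A (u n)" for n unfolding v_def A'_def by (rule HA_gauge_shift(2)[OF H_HA[OF u(1)] Am])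
  have v\<delta>: "ennreal \<delta> \<le> ball_mass 0 R (v n)" for n
    unfolding v_def nn_integral_shift_ball[OF um] by (rule \<delta>(2))
  have vlc: "lower_constant (A' n) m" for n unfolding A'_def by (rule lower_constant_gauge_shift[OF lc(1) Am])
  obtain K where K: "\<And>n. Q (A' n) (v n) \<le> K"
    using convergent_imp_bounded_above[OF u(3)] unfolding vQ by blast
  obtain r v0 where r: "strict_mono r" "v0 \<in> borel_measurable borel" "AE x in lborel. (\<lambda>n. v (r n) x) \<longlonglongrightarrow> v0 x"
    "\<And>R. (\<lambda>n. \<integral>\<^sup>+x. indicator (cball 0 R) x * ennreal ((cmod (v (r n) x - v0 x))\<^sup>2) \<partial>lborel) \<longlonglongrightarrow> 0"
    using rellich[OF H_HA[OF vH] A'm A'b K] by blast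
  have A'lim_r: "(\<lambda>n. A' (r n) x) \<longlonglongrightarrow> A0 x" for x
    using LIMSEQ_subseq_LIMSEQ[OF A'lim r(1)] by (simp add: o_def)
  have A'b_r: "\<exists>C. \<forall>n. \<forall>x\<in>cball 0 R. norm (A' (r n) x) \<le> C" for R using A'b[of R] by blast
  have "v0 \<in> H A0"
    by (rule H_limit[OF A'lb A(2) A'lim_r A'b_r vH r(2,3) K])
  then have "I v0 \<noteq> 0" by (intro nonzero_limit[OF \<delta>(1) v\<delta> r(4)] H_HA)
  have Qlim: "(\<lambda>n. Q (A' (r n)) (v (r n))) \<longlonglongrightarrow> m"
    unfolding vQ using LIMSEQ_subseq_LIMSEQ[OF u(3) r(1)] by (simp add: o_def)
  show ?thesis
    using limit_of_minimizing_sequence[OF A'lb A(2) A'lim_r A'b_r vH vI Qlim u(4) r(2,3) \<open>I v0 \<noteq> 0\<close> vlc lc(2)] by blast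
qed

lemma attained_linear:
  assumes A: "linear A"
  shows "\<exists>u\<in>constraint_set s p A. magnetic_norm_sq s A u = M_inf s p A"
proof -
  have lb: "locally_bounded_potential A"
    by (rule locally_bounded_potential_continuous[OF linear_continuous_on[OF linear_conv_bounded_linear[THEN iffD1, OF A]]])
  note Am = locally_bounded_potentialD(1)[OF lb]
  have ne: "constraint_set s p A \<noteq> {}"
    using radial_constraint_set_nonempty[OF lb] by (auto simp: radial_constraint_set_def)
  obtain m u where m: "M_inf s p A = ennreal m" "0 < m" and u: "\<And>n. u n \<in> H A" "\<And>n. I (u n) = 1" "(\<lambda>n. Q A (u n)) \<longlonglongrightarrow> m"
      "\<And>n. \<exists>v\<in>constraint_set s p A. AE x in lborel. v x = u n x"
    by (rule minimizing_sequence[OF ne subset_refl Am, folded M_inf_def]) (rule that)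
  obtain K where K: "\<And>n. Q A (u n) \<le> K"
    using convergent_imp_bounded_above[OF u(3)] by blast
  obtain \<delta> \<xi> where \<delta>: "0 < \<delta>" "\<And>n. ennreal \<delta> \<le> ball_mass (\<xi> n) 3 (u n)"
    by (rule nonvanishing[OF H_HA[OF u(1)] u(2) K]) (rule that)
  have lc: "lower_constant A m" by (rule lower_constantI) (use m Am in auto)
  \<comment> \<open>By additivity the constant \<open>- A (\<xi> n)\<close> undoes the translation,
    so that every translated potential is \<open>A\<close> itself.\<close>
  have shift: "A (x + \<xi> n) + - A (\<xi> n) = A x" for x n using linear_add[OF A, of x "\<xi> n"] by simp
  have "\<exists>v\<in>H A. I v = 1 \<and> Q A v \<le> m"
  proof (rule compactness_up_to_gauge[OF lb lb _ _ u(1-3) m(2) lc lc \<delta>])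
    show "(\<lambda>n. A (x + \<xi> n) + - A (\<xi> n)) \<longlonglongrightarrow> A x" for x unfolding shift by simp
    show "\<exists>C. \<forall>n. \<forall>x\<in>cball 0 R. norm (A (x + \<xi> n) + - A (\<xi> n)) \<le> C" for R
      unfolding shift using locally_bounded_potentialD(2)[OF lb] by blast
  qed
  then obtain v where v: "v \<in> H A" "I v = 1" "Q A v \<le> m" by blast
  have vc: "v \<in> constraint_set s p A" using v constraint_set_iff[OF Am HA_measurable[OF H_HA[OF v(1)]]] by blast
  show ?thesis
    using attained_constraint[OF v m(1)[unfolded M_inf_def] Am vc] vc unfolding M_inf_def by blast
qed

text \<open>The bounds in \<open>is_limit_potential\<close> hold almost everywhere. As
  \<open>A\<close> is continuous, the set where one holds is closed; containing almost all of an
  open ball of radius \<open>R + 1\<close>, it contains the ball of radius \<open>R\<close>. The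
  bound and Borel measurability then pass to the pointwise limit.\<close>

lemma limit_potential_bounds:
  assumes A: "continuous_on UNIV A" and r: "\<And>x. (\<lambda>n. A (x + \<xi> n) + h n) \<longlonglongrightarrow> A0 x"
    and b: "\<And>K. compact K \<Longrightarrow> \<exists>C. \<forall>n. AE x in lebesgue. x \<in> K \<longrightarrow> norm (A (x + \<xi> n) + h n) \<le> C"
  shows "\<exists>C. \<forall>n. \<forall>x\<in>cball 0 R. norm (A (x + \<xi> n) + h n) \<le> C" "locally_bounded_potential A0"
proof -
  have cont: "continuous_on UNIV (\<lambda>x. A (x + \<xi> n) + h n)" for n
    by (intro continuous_intros continuous_on_compose2[OF A]) auto
  show bd: "\<exists>C. \<forall>n. \<forall>x\<in>cball 0 R. norm (A (x + \<xi> n) + h n) \<le> C" for R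
  proof -
    obtain C where C: "\<And>n. AE x in lebesgue. x \<in> cball 0 (R + 1) \<longrightarrow> norm (A (x + \<xi> n) + h n) \<le> C"
      using b[of "cball 0 (R + 1)"] by auto
    have "norm (A (x + \<xi> n) + h n) \<le> C" if x: "x \<in> cball 0 R" for n x
    proof -
      have "x \<in> {x. norm (A (x + \<xi> n) + h n) \<le> C}"
      proof (rule mem_closed_if_AE_lebesgue_open[of "ball 0 (R + 1)"])
        show "closed {x. norm (A (x + \<xi> n) + h n) \<le> C}"
          by (intro closed_Collect_le continuous_intros cont)
        show "AE x\<in>ball 0 (R + 1) in lebesgue. x \<in> {x. norm (A (x + \<xi> n) + h n) \<le> C}"
          using C[of n] by eventually_elim auto
      qed (use x in auto)
      then show ?thesis by simp
    qed
    then show ?thesis by blast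
  qed
  show "locally_bounded_potential A0"
    unfolding locally_bounded_potential_def
  proof (intro conjI allI)
    show "A0 \<in> borel_measurable borel"
      by (rule borel_measurable_LIMSEQ_metric[OF borel_measurable_continuous_onI[OF cont] r])
    fix R
    obtain C where C: "\<And>n x. x \<in> cball 0 R \<Longrightarrow> norm (A (x + \<xi> n) + h n) \<le> C" using bd[of R] by blast
    have "norm (A0 x) \<le> C" if "x \<in> cball 0 R" for x
      by (rule LIMSEQ_le_const2[OF tendsto_norm[OF r]]) (use C that in auto)
    then show "\<exists>C. \<forall>x\<in>cball 0 R. norm (A0 x) \<le> C" by blast
  qed
qed

text \<open>If the centres stay bounded, one larger ball about the origin holds the retained mass of
  every term, and compactness applies without translating. If they do not, it yields a competitor
  for the limit potential with energy at most \<open>M_inf s p A\<close>, against the strict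
  inequality.\<close>

lemma attained_assumption_A:
  assumes A: "continuous_on UNIV A" and AA: "assumption_A A"
    and A_lim: "\<And>\<Xi>. \<Xi> \<in> admissible_seqs A \<Longrightarrow> is_limit_potential A \<Xi> (A_lim \<Xi>)"
    and less: "M_inf s p A < (INF \<Xi>\<in>admissible_seqs A. M_inf s p (A_lim \<Xi>))"
  shows "\<exists>u\<in>constraint_set s p A. magnetic_norm_sq s A u = M_inf s p A"
proof -
  have lb: "locally_bounded_potential A" by (rule locally_bounded_potential_continuous[OF A])
  note Am = locally_bounded_potentialD(1)[OF lb]
  have ne: "constraint_set s p A \<noteq> {}"
    using radial_constraint_set_nonempty[OF lb] by (auto simp: radial_constraint_set_def)
  obtain m u where m: "M_inf s p A = ennreal m" "0 < m" and u: "\<And>n. u n \<in> H A" "\<And>n. I (u n) = 1" "(\<lambda>n. Q A (u n)) \<longlonglongrightarrow> m"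
      "\<And>n. \<exists>v\<in>constraint_set s p A. AE x in lborel. v x = u n x"
    by (rule minimizing_sequence[OF ne subset_refl Am, folded M_inf_def]) (rule that)
  obtain K where K: "\<And>n. Q A (u n) \<le> K"
    using convergent_imp_bounded_above[OF u(3)] by blast
  obtain \<delta> \<xi> where \<delta>: "0 < \<delta>" "\<And>n. ennreal \<delta> \<le> ball_mass (\<xi> n) 3 (u n)"
    by (rule nonvanishing[OF H_HA[OF u(1)] u(2) K]) (rule that)
  have lc: "lower_constant A m" by (rule lower_constantI) (use m Am in auto)
  have "\<exists>v\<in>H A. I v = 1 \<and> Q A v \<le> m"
  proof (cases "bounded (range \<xi>)")
    case True
    then obtain L where L: "\<And>n. norm (\<xi> n) \<le> L" by (auto simp: bounded_iff)
    show ?thesis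
    proof (rule compactness_up_to_gauge[of A A "\<lambda>_. 0" "\<lambda>_. 0", OF lb lb _ _ u(1-3) m(2) lc lc \<delta>(1)])
      show "\<exists>C. \<forall>n. \<forall>x\<in>cball 0 R. norm (A (x + 0) + 0) \<le> C" for R
        using locally_bounded_potentialD(2)[OF lb, of R] by simp
      have sub: "cball (\<xi> n) 3 \<subseteq> cball 0 (L + 3)" for n
      proof
        fix x assume "x \<in> cball (\<xi> n) 3"
        then show "x \<in> cball 0 (L + 3)"
          using L[of n] norm_triangle_sub[of x "\<xi> n"] by (simp add: dist_norm norm_minus_commute)
      qed
      show "ennreal \<delta> \<le> ball_mass 0 (L + 3) (u n)" for n
        by (rule order_trans[OF \<delta>(2)[of n]], rule nn_integral_mono) (use sub[of n] in \<open>auto simp: indicator_def\<close>)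
    qed simp
  next
    case False
    then have adm: "\<xi> \<in> admissible_seqs A" using AA by (simp add: assumption_A_def)
    define A0 where "A0 = A_lim \<xi>"
    obtain r h where r: "strict_mono r" and lim: "\<And>x. (\<lambda>n. A (x + \<xi> (r n)) + h n) \<longlonglongrightarrow> A0 x"
      and b: "\<And>K. compact K \<Longrightarrow> \<exists>C. \<forall>n. AE x in lebesgue. x \<in> K \<longrightarrow> norm (A (x + \<xi> (r n)) + h n) \<le> C"
      using A_lim[OF adm] unfolding is_limit_potential_def A0_def by blast
    note bd = limit_potential_bounds[OF A lim b]
    note A0m = locally_bounded_potentialD(1)[OF bd(2)]
    have less': "ennreal m < M_inf s p A0"
      using less_le_trans[OF less INF_lower[OF adm]] m(1) by (simp add: A0_def)
    \<comment> \<open>The strict inequality already enters here: \<open>m\<close> lies below the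
      infimum of the limit problem, so it is a lower constant for \<open>A0\<close> as well.\<close>
    have lc0: "lower_constant A0 m" by (rule lower_constantI) (use less' m A0m in auto)
    have ur: "(\<lambda>n. Q A (u (r n))) \<longlonglongrightarrow> m" using LIMSEQ_subseq_LIMSEQ[OF u(3) r] by (simp add: o_def)
    have "\<exists>v\<in>H A0. I v = 1 \<and> Q A0 v \<le> m"
      by (rule compactness_up_to_gauge[OF lb bd(2) lim bd(1) u(1,2) ur m(2) lc lc0 \<delta>])
    then obtain v where v: "v \<in> H A0" "I v = 1" "Q A0 v \<le> m" by blast
    have "v \<in> constraint_set s p A0" using v constraint_set_iff[OF A0m HA_measurable[OF H_HA[OF v(1)]]] by blast
    then have "M_inf s p A0 \<le> magnetic_norm_sq s A0 v" unfolding M_inf_def by (rule INF_lower)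
    also have "\<dots> \<le> ennreal m"
      using ennreal_leI[OF v(3)] by (simp add: magnetic_norm_sq_HA[OF H_HA[OF v(1)] A0m])
    finally show ?thesis using less' by simp
  qed
  then obtain v where v: "v \<in> H A" "I v = 1" "Q A v \<le> m" by blast
  have vc: "v \<in> constraint_set s p A" using v constraint_set_iff[OF Am HA_measurable[OF H_HA[OF v(1)]]] by blast
  show ?thesis
    using attained_constraint[OF v m(1)[unfolded M_inf_def] Am vc] vc unfolding M_inf_def by blast
qed

text \<open>Expand the nonnegative energy of \<open>u0 - u n\<close>; its cross term tends to the
  energy of \<open>u0\<close> by weak convergence.\<close>

lemma Q_weakly_lower_semicontinuous:
  assumes u: "\<And>n. u n \<in> HA A" "u0 \<in> HA A" and A: "A \<in> borel_measurable borel"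
    and lim: "AE x in lborel. (\<lambda>n. u n x) \<longlonglongrightarrow> u0 x" and Qlim: "(\<lambda>n. Q A (u n)) \<longlonglongrightarrow> m" and K: "\<And>n. Q A (u n) \<le> K"
  shows "Q A u0 \<le> m"
proof -
  have "(\<lambda>n. Q A u0 - 2 * B A u0 (u n) + Q A (u n)) \<longlonglongrightarrow> Q A u0 - 2 * B A u0 u0 + m"
    by (intro tendsto_add tendsto_diff tendsto_mult tendsto_const B_tendsto[OF u(2) A u lim K] Qlim)
  moreover have "0 \<le> Q A u0 - 2 * B A u0 (u n) + Q A (u n)" for n
    using Q_diff[OF u(2) u(1), of 1 n] Q_nonneg[of A "\<lambda>x. u0 x - complex_of_real 1 * u n x"] by simp
  ultimately have "0 \<le> Q A u0 - 2 * B A u0 u0 + m" by (intro LIMSEQ_le_const) auto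
  then show ?thesis by (simp add: B_self)
qed

text \<open>Balls with distant centre hold little mass because of their rotated copies; the other
  balls lie in one fixed ball, whose mass tends to 0. So all balls of radius 3 become uniformly
  light, which forces the \<open>L^p\<close> integral to 0.\<close>

lemma radial_vanishing:
  assumes w: "\<And>n. w n \<in> HA A" "\<And>n. radially_symmetric (w n)" and K: "\<And>n. Q A (w n) \<le> K"
    and lim: "\<And>R. (\<lambda>n. \<integral>\<^sup>+x. indicator (cball 0 R) x * ennreal ((cmod (w n x))\<^sup>2) \<partial>lborel) \<longlonglongrightarrow> 0"
  shows "(\<lambda>n. I (w n)) \<longlonglongrightarrow> 0"
proof (rule LIMSEQ_I)
  fix \<eta> :: real assume \<eta>: "0 < \<eta>"
  have K0: "0 \<le> K" using order_trans[OF Q_nonneg K[of 0]] .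
  have "0 < \<eta> / 2" using \<eta> by simp
  then obtain \<delta> where \<delta>: "0 < \<delta>"
    "\<forall>A. \<forall>u\<in>HA A. Q A u \<le> K \<longrightarrow> (\<forall>\<xi>. ball_mass \<xi> 3 u \<le> ennreal \<delta>) \<longrightarrow> I u \<le> \<eta> / 2"
    using small_balls_imp_small_Lp[of "\<eta> / 2" K] by blast
  \<comment> \<open>With \<open>j\<close> disjoint copies sharing a total mass of at most
    \<open>K\<close>, each holds less than \<open>\<delta>\<close>.\<close>
  obtain j :: nat where j: "K / \<delta> < real j" using reals_Archimedean2 by blast
  have j0: "0 < real j" using j K0 \<delta>(1) by (meson divide_nonneg_pos le_less_trans)
  have Kj: "K \<le> \<delta> * real j" using j \<delta>(1) by (simp add: field_simps)
  obtain R0 where R0: "\<And>w \<xi>. w \<in> borel_measurable borel \<Longrightarrow> radially_symmetric w \<Longrightarrow> R0 \<le> norm \<xi> \<Longrightarrow>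
     of_nat j * ball_mass \<xi> 3 w \<le> (\<integral>\<^sup>+x. ennreal ((cmod (w x))\<^sup>2) \<partial>lborel)"
    using radial_decay[of j] by blast
  have "\<forall>\<^sub>F n in sequentially. ball_mass 0 (R0 + 3) (w n) < ennreal \<delta>"
    by (rule order_tendstoD(2)[OF lim]) (use \<delta>(1) in simp)
  then obtain n0 where n0: "\<And>n. n \<ge> n0 \<Longrightarrow> ball_mass 0 (R0 + 3) (w n) < ennreal \<delta>"
    by (auto simp: eventually_sequentially)
  have "I (w n) \<le> \<eta> / 2" if n: "n0 \<le> n" for n
  proof -
    have wm: "w n \<in> borel_measurable borel" by (rule HA_measurable[OF w(1)])
    have ball: "ball_mass \<xi> 3 (w n) \<le> ennreal \<delta>" for \<xi>
    proof (cases "R0 \<le> norm \<xi>")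
      case True
      let ?F = "\<integral>\<^sup>+x. indicator (cball \<xi> 3) x * ennreal ((cmod (w n x))\<^sup>2) \<partial>lborel"
      have "of_nat j * ?F \<le> (\<integral>\<^sup>+x. ennreal ((cmod (w n x))\<^sup>2) \<partial>lborel)" by (rule R0[OF wm w(2) True])
      also have "\<dots> = ennreal (N (w n))" unfolding N_def by (rule nn_integral_square[OF HA_L2(1)[OF w(1)]])
      also have "\<dots> \<le> ennreal (\<delta> * real j)"
        using N_le_Q[of "w n" A] K[of n] Kj by (intro ennreal_leI) linarith
      also have "\<dots> = of_nat j * ennreal \<delta>" using \<delta>(1) by (simp add: ennreal_mult ennreal_of_nat_eq_real_of_nat mult.commute)
      finally show ?thesis using j0 by (subst (asm) ennreal_mult_le_mult_iff) auto
    next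
      case False
      have sub: "cball \<xi> 3 \<subseteq> cball 0 (R0 + 3)"
      proof
        fix x assume "x \<in> cball \<xi> 3"
        then show "x \<in> cball 0 (R0 + 3)"
          using False norm_triangle_sub[of x \<xi>] by (simp add: dist_norm norm_minus_commute)
      qed
      have "ball_mass \<xi> 3 (w n)
         \<le> ball_mass 0 (R0 + 3) (w n)"
        by (rule nn_integral_mono) (use sub in \<open>auto simp: indicator_def\<close>)
      then show ?thesis using n0[OF n] by simp
    qed
    show ?thesis using \<delta>(2) w(1)[of n] K[of n] ball by blast
  qed
  then show "\<exists>n0. \<forall>n\<ge>n0. norm (I (w n) - 0) < \<eta>"
    using \<eta> I_nonneg by (intro exI[of _ n0] allI impI) (fastforce simp: abs_of_nonneg intro: le_less_trans)
qed

text \<open>Translations would destroy the symmetry, so compactness is sought about the origin. The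
  differences from the limit are radial with locally vanishing mass; hence they tend to 0 in
  \<open>L^p\<close>, the constraint passes to the limit, and weak lower semicontinuity bounds its
  energy.\<close>

lemma attained_radial:
  assumes A: "continuous_on UNIV A"
  shows "\<exists>u\<in>radial_constraint_set s p A. magnetic_norm_sq s A u = M_inf_rad s p A"
proof -
  have lb: "locally_bounded_potential A" by (rule locally_bounded_potential_continuous[OF A])
  note Am = locally_bounded_potentialD(1)[OF lb]
  have sub: "radial_constraint_set s p A \<subseteq> constraint_set s p A" by (auto simp: radial_constraint_set_def)
  obtain m u where m: "M_inf_rad s p A = ennreal m" "0 < m" and u: "\<And>n. u n \<in> H A" "\<And>n. I (u n) = 1" "(\<lambda>n. Q A (u n)) \<longlonglongrightarrow> m"
      "\<And>n. \<exists>v\<in>radial_constraint_set s p A. AE x in lborel. v x = u n x"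
    by (rule minimizing_sequence[OF radial_constraint_set_nonempty[OF lb] sub Am, folded M_inf_rad_def]) (rule that)
  have ur: "radially_symmetric (u n)" for n
    using u(4)[of n] radially_symmetric_cong_AE by (auto simp: radial_constraint_set_def)
  obtain K where K: "\<And>n. Q A (u n) \<le> K"
    using convergent_imp_bounded_above[OF u(3)] by blast
  have bd: "\<exists>C. \<forall>n::nat. \<forall>x\<in>cball 0 R. norm (A x) \<le> C" for R
    using locally_bounded_potentialD(2)[OF lb, of R] by simp
  obtain r u0 where r: "strict_mono r" "u0 \<in> borel_measurable borel" "AE x in lborel. (\<lambda>n. u (r n) x) \<longlonglongrightarrow> u0 x"
    "\<And>R. (\<lambda>n. \<integral>\<^sup>+x. indicator (cball 0 R) x * ennreal ((cmod (u (r n) x - u0 x))\<^sup>2) \<partial>lborel) \<longlonglongrightarrow> 0"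
    by (rule rellich[where A = "\<lambda>_. A", OF H_HA[OF u(1)] Am bd K]) (rule that)
  have u0: "u0 \<in> H A"
    by (rule H_limit[of "\<lambda>_. A", OF lb lb tendsto_const bd u(1) r(2,3) K])
  have u0rad: "radially_symmetric u0" by (rule radially_symmetric_limit[OF ur r(3)])
  note uHA = H_HA[OF u(1)] and u0HA = H_HA[OF u0]
  define w where "w n = (\<lambda>x. u (r n) x - u0 x)" for n
  have w: "w n \<in> HA A" "radially_symmetric (w n)" for n
    unfolding w_def by (rule HA_diff[OF uHA u0HA], rule radially_symmetric_diff[OF ur u0rad])
  have wK: "Q A (w n) \<le> 2 * K + 2 * Q A u0" for n
    unfolding w_def using Q_diff_le[OF uHA[of "r n"] u0HA] K[of "r n"] by simp
  have "(\<lambda>n. I (w n)) \<longlonglongrightarrow> 0"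
    by (rule radial_vanishing[OF w wK]) (use r(4) in \<open>simp add: w_def\<close>)
  moreover have "(\<lambda>n. I (u (r n)) - I (w n)) \<longlonglongrightarrow> I u0 - I (\<lambda>x. u0 x - u0 x)"
    unfolding I_def w_def
  proof (rule powr_splitting(2)[OF _ _ _ HA_Lp[OF uHA] HA_Lp[OF u0HA] HA_Lp[OF u0HA] _ _ r(3)])
    show "(\<integral>x. cmod (u (r n) x) powr p \<partial>lborel) \<le> 1" for n using u(2)[of "r n"] by (simp add: I_def)
    show "u (r n) \<in> borel_measurable lborel" for n using HA_measurable[OF uHA] by simp
  qed (use p r(2) in auto)
  then have "(\<lambda>n. 1 - I (w n)) \<longlonglongrightarrow> I u0" using u(2) p by (simp add: I_def)
  ultimately have "I u0 = 1 - 0"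
    by (intro LIMSEQ_unique[of "\<lambda>n. 1 - I (w n)"] tendsto_diff tendsto_const)
  then have I1: "I u0 = 1" by simp
  have Q1: "Q A u0 \<le> m"
    by (rule Q_weakly_lower_semicontinuous[OF uHA u0HA Am r(3) _ K])
       (use LIMSEQ_subseq_LIMSEQ[OF u(3) r(1)] in \<open>simp add: o_def\<close>)
  have c: "u0 \<in> radial_constraint_set s p A"
    using u0 I1 u0rad constraint_set_iff[OF Am r(2)] by (simp add: radial_constraint_set_def)
  show ?thesis
    using attained_constraint[OF u0 I1 Q1 m(1)[unfolded M_inf_rad_def] Am c] c unfolding M_inf_rad_def by blast
qed

end

text \<open>The association of a limit with each sequence is a choice, since a sequence may have
  several limits; part (iii) therefore holds for every choice function \<open>A_lim\<close>.\<close>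

theorem theorem1p2:
  fixes s p :: real and A :: "real^3 \<Rightarrow> real^3"
  assumes "0 < s" and "s < 1"
    and "2 < p" and "p < 6 / (3 - 2 * s)"
    and "continuous_on UNIV A" and "locally_Lipschitz A"
  shows "(\<exists>u\<in>radial_constraint_set s p A. magnetic_norm_sq s A u = M_inf_rad s p A)
    \<and> (linear A \<longrightarrow>
         (\<exists>u\<in>constraint_set s p A. magnetic_norm_sq s A u = M_inf s p A))
    \<and> (\<forall>A_lim :: (nat \<Rightarrow> real^3) \<Rightarrow> (real^3 \<Rightarrow> real^3).
         assumption_A A \<and>
         (\<forall>\<Xi>\<in>admissible_seqs A. is_limit_potential A \<Xi> (A_lim \<Xi>)) \<and>
         M_inf s p A < (INF \<Xi>\<in>admissible_seqs A. M_inf s p (A_lim \<Xi>)) \<longrightarrow>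
         (\<exists>u\<in>constraint_set s p A. magnetic_norm_sq s A u = M_inf s p A))"
proof -
  interpret fractional_subcritical s p
    using assms by unfold_locales
  show ?thesis
    using attained_radial[OF assms(5)] attained_linear attained_assumption_A[OF assms(5)] by blast
qed

end
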